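(* Assume that the general assumptions hold. Let $\lambda\notin\mathrm{rg}(d)$ be an eigenvalue of $U$ and $M\subset\mathbb{C}$ an open neighborhood of $\lambda$ such that $\sigma(U)\cap M=\{\lambda\}$. Then: 1. (Convergence of eigenvalues) The eigenvalues in $\sigma(\frac1nL_n)\cap M$ converge to $\lambda$ in the sense that every sequence $(\lambda_n)_{n\in\mathbb{N}}$ with $\lambda_n\in\sigma(\frac1nL_n)\cap M$ satisfies $\lambda_n\to\lambda$ almost surely. 2. (Convergence of spectral projections) There exists some $N\in\mathbb{N}$ such that, for $n>N$, the sets $\sigma(U_n)\cap M$ are isolated in $\sigma(U_n)$. For $n>N$, let $\mathrm{Pr}_n$ be the spectral projections of $U_n$ corresponding to $\sigma(U_n)\cap M$, and $\mathrm{Pr}$ the spectral projection of $U$ for $\lambda$. Then $\mathrm{Pr}_n\to\mathrm{Pr}$ pointwise almost surely. 3. (Convergence of eigenvectors) If $\lambda$ is a simple eigenvalue, then the eigenvectors of $\frac1nL_n$ converge almost surely up to a change of sign: if $v_n$ is the eigenvector of $\frac1nL_n$ with eigenvalue $\lambda_n$, $v_{n,i}$ its $i$th coordinate, and $f$ the eigenfunction of $U$ with eigenvalue $\lambda$, then there exists a sequence $(a_n)_{n\in\mathbb{N}}$ with $a_n\in\{+1,-1\}$ such that $\sup_{i=1,\dots,n}|a_nv_{n,i}-f(X_i)|\to0$ almost surely. In particular, for all $b\in\mathbb{R}$, the sets $\{a_nf_n>b\}$ and $\{f>b\}$ converge, that is, their symmetric difference satisfies $P(\{f>b\}\,\tr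iangle\,\{a_nf_n>b\})\to0$.
   Context: General assumptions: $\mathcal{X}$ is a compact metric space with Borel $\sigma$-algebra, $P$ a probability measure on $\mathcal{X}$ whose support is $\mathcal{X}$; the sample points $X_1,X_2,\dots$ are drawn independently according to $P$, and $P_n=\frac1n\sum_{i=1}^n\delta_{X_i}$; the similarity function $k:\mathcal{X}\times\mathcal{X}\to\mathbb{R}$ is symmetric and continuous, and there is a constant $l>0$ with $k(x,y)>l$ for all $x,y\in\mathcal{X}$. Matrices: $K_n=(k(X_i,X_j))_{i,j\le n}$; $D_n$ is the diagonal matrix with diagonal entries $\sum_{j=1}^nk(X_i,X_j)$; $L_n=D_n-K_n$. Operators on the Banach space $(C(\mathcal{X}),\|\cdot\|_\infty)$ of continuous functions: with $d_n(x)=\int k(x,y)\,dP_n(y)$ and $d(x)=\int k(x,y)\,dP(y)$, set $U_ng(x)=d_n(x)g(x)-\int k(x,y)g(y)\,dP_n(y)$ and $Ug(x)=d(x)g(x)-\int k(x,y)g(y)\,dP(y)$. $\mathrm{rg}(d)$ is the range of the function $d$. In part 3, $\lambda_n\in\sigma(\frac1nL_n)\cap M$, and $f_n\in C(\mathcal{X})$ denotes the eigenfunction of $U_n$ with eigenvalue $\lambda_n$ corresponding to $v_n$, i.e. $(f_n(X_1),\dots,f_n(X_n))^t=v_n$. $\sigma(\cdot)$ denotes the spectrum. A subset $\tau\subset\sigma(A)$ of the spectrum of a bounded operator $A$ is isolated if there is an open neighborhood $O\subset\mathbb{C}$ of $\tau$ with $\sigma(A)\cap O=\tau$; the corresponding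 spectral projection is $\frac{1}{2\pi i}\int_\Gamma(A-\zeta I)^{-1}\,d\zeta$, where $\Gamma$ is a closed Jordan curve separating $\tau$ from the rest of $\sigma(A)$. Operators $S_n$ converge pointwise to $S$ if $\|S_ng-Sg\|_\infty\to0$ for all $g\in C(\mathcal{X})$. An eigenvalue is simple if it has algebraic multiplicity 1.
   Formalization: Formal version also assumes that the closure of M meets σ(U) ∪ rg(d) only in λ, and restricts the level-set claim to b with P({f=b})=0; both fail otherwise. Eigenvectors v_n and f are real with sup norm 1, and N may depend on the sample. *)

theory Defs
  imports
    "HOL-Probability.Probability"
    "HOL-Complex_Analysis.Complex_Analysis"
    "Jordan_Normal_Form.Spectral_Radius"
begin

text \<open>
  Over a compact space the type of bounded continuous functions is the Banach space of all
  continuous functions with the supremum norm. The scalars are complex because the spectrum is a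
  subset of the complex plane. The library has no complex vector space structure on this type, so
  multiplication by a complex number is the following operator; in particular \<open>cmult \<zeta>\<close> is
  \<open>\<zeta>\<close> times the identity.
\<close>

definition cmult ::
  "complex \<Rightarrow> ('a::topological_space \<Rightarrow>\<^sub>C complex) \<Rightarrow>\<^sub>L ('a \<Rightarrow>\<^sub>C complex)" where
  "cmult c = Blinfun (\<lambda>g :: 'a \<Rightarrow>\<^sub>C complex. Bcontfun (\<lambda>x. c * g x))"

definition complexify ::
  "('a::topological_space \<Rightarrow>\<^sub>C real) \<Rightarrow> ('a \<Rightarrow>\<^sub>C complex)" where
  "complexify f = Bcontfun (\<lambda>x. complex_of_real (f x))"

text \<open>
  The elements of the type of bounded operators are only real-linear. For a complex-linear
  operator the two-sided inverse below is complex-linear automatically.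
\<close>

definition is_resolvent ::
  "(('a::topological_space \<Rightarrow>\<^sub>C complex) \<Rightarrow>\<^sub>L ('a \<Rightarrow>\<^sub>C complex)) \<Rightarrow> complex \<Rightarrow>
    (('a \<Rightarrow>\<^sub>C complex) \<Rightarrow>\<^sub>L ('a \<Rightarrow>\<^sub>C complex)) \<Rightarrow> bool" where
  "is_resolvent A \<zeta> R \<longleftrightarrow>
     R o\<^sub>L (A - cmult \<zeta>) = id_blinfun \<and> (A - cmult \<zeta>) o\<^sub>L R = id_blinfun"

definition op_spectrum ::
  "(('a::topological_space \<Rightarrow>\<^sub>C complex) \<Rightarrow>\<^sub>L ('a \<Rightarrow>\<^sub>C complex)) \<Rightarrow> complex set" where
  "op_spectrum A = {\<zeta>. \<nexists>R. is_resolvent A \<zeta> R}"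

definition resolvent ::
  "(('a::topological_space \<Rightarrow>\<^sub>C complex) \<Rightarrow>\<^sub>L ('a \<Rightarrow>\<^sub>C complex)) \<Rightarrow> complex \<Rightarrow>
    ('a \<Rightarrow>\<^sub>C complex) \<Rightarrow>\<^sub>L ('a \<Rightarrow>\<^sub>C complex)" where
  "resolvent A \<zeta> = (THE R. is_resolvent A \<zeta> R)"

definition op_eigenfunction ::
  "(('a::topological_space \<Rightarrow>\<^sub>C complex) \<Rightarrow>\<^sub>L ('a \<Rightarrow>\<^sub>C complex)) \<Rightarrow> complex \<Rightarrow>
    ('a \<Rightarrow>\<^sub>C complex) \<Rightarrow> bool" where
  "op_eigenfunction A \<zeta> g \<longleftrightarrow> g \<noteq> 0 \<and> A g = cmult \<zeta> g"

definition op_eigenvalue ::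
  "(('a::topological_space \<Rightarrow>\<^sub>C complex) \<Rightarrow>\<^sub>L ('a \<Rightarrow>\<^sub>C complex)) \<Rightarrow> complex \<Rightarrow> bool" where
  "op_eigenvalue A \<zeta> \<longleftrightarrow> (\<exists>g. op_eigenfunction A \<zeta> g)"

definition gen_eigenspace ::
  "(('a::topological_space \<Rightarrow>\<^sub>C complex) \<Rightarrow>\<^sub>L ('a \<Rightarrow>\<^sub>C complex)) \<Rightarrow> complex \<Rightarrow>
    ('a \<Rightarrow>\<^sub>C complex) set" where
  "gen_eigenspace A \<zeta> = {g. \<exists>m. (blinfun_apply (A - cmult \<zeta>) ^^ m) g = 0}"

text \<open>
  The algebraic multiplicity is the complex dimension of the generalized eigenspace; the library's
  dimension function is 0 on infinite-dimensional spaces, so the value 1 is unambiguous.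
\<close>

definition alg_multiplicity ::
  "(('a::topological_space \<Rightarrow>\<^sub>C complex) \<Rightarrow>\<^sub>L ('a \<Rightarrow>\<^sub>C complex)) \<Rightarrow> complex \<Rightarrow> nat" where
  "alg_multiplicity A \<zeta> =
     vector_space.dim (\<lambda>c. blinfun_apply (cmult c)) (gen_eigenspace A \<zeta>)"

definition simple_eigenvalue ::
  "(('a::topological_space \<Rightarrow>\<^sub>C complex) \<Rightarrow>\<^sub>L ('a \<Rightarrow>\<^sub>C complex)) \<Rightarrow> complex \<Rightarrow> bool" where
  "simple_eigenvalue A \<zeta> \<longleftrightarrow> op_eigenvalue A \<zeta> \<and> alg_multiplicity A \<zeta> = 1"

definition isolated_part ::
  "(('a::topological_space \<Rightarrow>\<^sub>C complex) \<Rightarrow>\<^sub>L ('a \<Rightarrow>\<^sub>C complex)) \<Rightarrow> complex set \<Rightarrow> bool" where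
  "isolated_part A \<tau> \<longleftrightarrow> (\<exists>S. open S \<and> \<tau> \<subseteq> S \<and> op_spectrum A \<inter> S = \<tau>)"

text \<open>
  A closed Jordan curve with \<open>\<tau>\<close> inside and the rest of the spectrum outside. It is run through
  clockwise: with the integrand \<open>(A - \<zeta> I)\<^sup>-\<^sup>1\<close> (not \<open>(\<zeta> I - A)\<^sup>-\<^sup>1\<close>) this is the orientation
  for which the normalized contour integral is a projection rather than its negative.
\<close>

definition separating_curve ::
  "(('a::topological_space \<Rightarrow>\<^sub>C complex) \<Rightarrow>\<^sub>L ('a \<Rightarrow>\<^sub>C complex)) \<Rightarrow> complex set \<Rightarrow>
    (real \<Rightarrow> complex) \<Rightarrow> bool" where
  "separating_curve A \<tau> \<Gamma> \<longleftrightarrow>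
     valid_path \<Gamma> \<and> simple_path \<Gamma> \<and> pathfinish \<Gamma> = pathstart \<Gamma> \<and>
     \<tau> \<subseteq> inside (path_image \<Gamma>) \<and> op_spectrum A - \<tau> \<subseteq> outside (path_image \<Gamma>) \<and>
     (\<forall>z \<in> inside (path_image \<Gamma>). winding_number \<Gamma> z = - 1)"

text \<open>
  \<open>Q = 1 / (2 \<pi> \<i>) * \<integral>\<^sub>\<Gamma> (A - \<zeta> I)\<^sup>-\<^sup>1 d\<zeta>\<close>, as an integral in the Banach space of bounded
  operators. The library's contour integral is for complex-valued integrands only, so the
  integral is pulled back along the curve, exactly as the library's contour integral is defined.
\<close>

definition is_spectral_projection ::
  "(('a::topological_space \<Rightarrow>\<^sub>C complex) \<Rightarrow>\<^sub>L ('a \<Rightarrow>\<^sub>C complex)) \<Rightarrow> complex set \<Rightarrow>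
    (('a \<Rightarrow>\<^sub>C complex) \<Rightarrow>\<^sub>L ('a \<Rightarrow>\<^sub>C complex)) \<Rightarrow> bool" where
  "is_spectral_projection A \<tau> Q \<longleftrightarrow>
     (\<exists>\<Gamma>. separating_curve A \<tau> \<Gamma> \<and>
        ((\<lambda>t. cmult (vector_derivative \<Gamma> (at t within {0..1})) o\<^sub>L resolvent A (\<Gamma> t))
           has_integral (cmult (2 * of_real pi * \<i>) o\<^sub>L Q)) {0..1})"

definition measure_support :: "'a::topological_space measure \<Rightarrow> 'a set" where
  "measure_support \<mu> = {x. \<forall>S. open S \<longrightarrow> x \<in> S \<longrightarrow> emeasure \<mu> S > 0}"

definition empirical_measure :: "nat \<Rightarrow> (nat \<Rightarrow> 'a::topological_space) \<Rightarrow> 'a measure" where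
  "empirical_measure n xs = distr (uniform_count_measure {..<n}) borel xs"

definition degree_fun :: "('a \<Rightarrow> 'a \<Rightarrow> real) \<Rightarrow> 'a measure \<Rightarrow> 'a \<Rightarrow> real" where
  "degree_fun k \<mu> x = (\<integral>y. k x y \<partial>\<mu>)"

text \<open>
  With \<open>\<mu> = P\<close> this is \<open>U\<close>, with \<open>\<mu>\<close> the empirical measure of the sample it is \<open>U\<^sub>n\<close>.
\<close>

definition laplace_op ::
  "('a::topological_space \<Rightarrow> 'a \<Rightarrow> real) \<Rightarrow> 'a measure \<Rightarrow>
    ('a \<Rightarrow>\<^sub>C complex) \<Rightarrow>\<^sub>L ('a \<Rightarrow>\<^sub>C complex)" where
  "laplace_op k \<mu> = Blinfun (\<lambda>g :: 'a \<Rightarrow>\<^sub>C complex. Bcontfun (\<lambda>x.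
     complex_of_real (degree_fun k \<mu> x) * g x - (\<integral>y. complex_of_real (k x y) * g y \<partial>\<mu>)))"

definition similarity_mat :: "('a \<Rightarrow> 'a \<Rightarrow> real) \<Rightarrow> nat \<Rightarrow> (nat \<Rightarrow> 'a) \<Rightarrow> real mat" where
  "similarity_mat k n xs = mat n n (\<lambda>(i, j). k (xs i) (xs j))"

definition degree_mat :: "('a \<Rightarrow> 'a \<Rightarrow> real) \<Rightarrow> nat \<Rightarrow> (nat \<Rightarrow> 'a) \<Rightarrow> real mat" where
  "degree_mat k n xs = mat n n (\<lambda>(i, j). if i = j then \<Sum>m<n. k (xs i) (xs m) else 0)"

definition laplace_mat :: "('a \<Rightarrow> 'a \<Rightarrow> real) \<Rightarrow> nat \<Rightarrow> (nat \<Rightarrow> 'a) \<Rightarrow> real mat" where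
  "laplace_mat k n xs = degree_mat k n xs - similarity_mat k n xs"

text \<open>\<open>1/n L\<^sub>n\<close>, as a complex matrix so that its spectrum is a set of complex numbers\<close>

definition scaled_laplace_mat :: "('a \<Rightarrow> 'a \<Rightarrow> real) \<Rightarrow> nat \<Rightarrow> (nat \<Rightarrow> 'a) \<Rightarrow> complex mat" where
  "scaled_laplace_mat k n xs = map_mat complex_of_real ((1 / real n) \<cdot>\<^sub>m laplace_mat k n xs)"

text \<open>the eigenfunction \<open>f\<^sub>n\<close> of \<open>U\<^sub>n\<close> corresponding to the eigenvector \<open>v\<close> of \<open>1/n L\<^sub>n\<close>\<close>

definition eigenfunction_of_vector ::
  "('a::topological_space \<Rightarrow> 'a \<Rightarrow> real) \<Rightarrow> nat \<Rightarrow> (nat \<Rightarrow> 'a) \<Rightarrow> complex \<Rightarrow> (nat \<Rightarrow> real) \<Rightarrow>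
    ('a \<Rightarrow>\<^sub>C real) \<Rightarrow> bool" where
  "eigenfunction_of_vector k n xs \<zeta> v f \<longleftrightarrow>
     op_eigenfunction (laplace_op k (empirical_measure n xs)) \<zeta> (complexify f) \<and>
     (\<forall>i<n. f (xs i) = v i)"

text \<open>The abstraction functions used above are applied inside their domains:\<close>

lemma cmult_apply:
  fixes g :: "'a::topological_space \<Rightarrow>\<^sub>C complex"
  shows "cmult c g x = c * g x"
proof -
  define T where "T h x = c * h x" for h :: "'a \<Rightarrow>\<^sub>C complex" and x
  have "T h \<in> bcontfun" for h
  proof -
    have "bounded ((\<lambda>z. c * z) ` range (apply_bcontfun h))"
      by (rule bounded_linear_image[OF bounded_apply_bcontfun bounded_linear_mult_right])
    then show ?thesis
      unfolding bcontfun_def T_def by (auto intro!: continuous_intros simp: image_image)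
  qed
  note ap = Bcontfun_inverse[OF this]
  have "bounded_linear (\<lambda>h. Bcontfun (T h))"
  proof (rule bounded_linear_intro[where K = "norm c"])
    fix h h' :: "'a \<Rightarrow>\<^sub>C complex" and r :: real
    show "Bcontfun (T (h + h')) = Bcontfun (T h) + Bcontfun (T h')"
      by (rule bcontfun_eqI) (simp add: ap, simp add: T_def algebra_simps)
    show "Bcontfun (T (r *\<^sub>R h)) = r *\<^sub>R Bcontfun (T h)"
      by (rule bcontfun_eqI) (simp add: ap, simp add: T_def)
    show "norm (Bcontfun (T h)) \<le> norm h * norm c"
      by (rule norm_bound)
        (simp add: ap, simp add: T_def norm_mult mult.commute[of _ "norm c"] mult_left_mono norm_bounded)
  qed
  then have "Blinfun (\<lambda>h. Bcontfun (T h)) g x = T g x"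
    by (simp add: bounded_linear_Blinfun_apply ap)
  then show ?thesis
    by (simp add: cmult_def T_def[abs_def])
qed

lemma complexify_apply:
  fixes f :: "'a::topological_space \<Rightarrow>\<^sub>C real"
  shows "complexify f x = complex_of_real (f x)"
proof -
  have "bounded (complex_of_real ` range (apply_bcontfun f))"
    by (rule bounded_linear_image[OF bounded_apply_bcontfun bounded_linear_of_real])
  then have "(\<lambda>x. complex_of_real (f x)) \<in> bcontfun"
    unfolding bcontfun_def by (auto intro!: continuous_intros simp: image_image)
  then show ?thesis
    by (simp add: complexify_def Bcontfun_inverse)
qed

lemma resolvent_eq:
  assumes "is_resolvent A \<zeta> R"
  shows "resolvent A \<zeta> = R"
  unfolding resolvent_def
proof (rule the_equality)
  show "is_resolvent A \<zeta> R" by (rule assms)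
next
  fix R' assume "is_resolvent A \<zeta> R'"
  then have "R' = R' o\<^sub>L ((A - cmult \<zeta>) o\<^sub>L R)"
    using assms by (auto simp: is_resolvent_def intro: blinfun_eqI)
  also have "\<dots> = (R' o\<^sub>L (A - cmult \<zeta>)) o\<^sub>L R"
    by (rule blinfun_eqI) simp
  also have "\<dots> = R"
    using \<open>is_resolvent A \<zeta> R'\<close> by (auto simp: is_resolvent_def intro: blinfun_eqI)
  finally show "R' = R" .
qed

lemma laplace_op_apply:
  fixes k :: "'a::metric_space \<Rightarrow> 'a \<Rightarrow> real" and g :: "'a \<Rightarrow>\<^sub>C complex"
  assumes compact: "compact (UNIV :: 'a set)"
    and cont: "continuous_on UNIV (\<lambda>(x, y). k x y)"
    and fin: "finite_measure \<mu>" and borel: "sets \<mu> = sets borel"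
  shows "laplace_op k \<mu> g x =
    complex_of_real (degree_fun k \<mu> x) * g x - (\<integral>y. complex_of_real (k x y) * g y \<partial>\<mu>)"
proof -
  interpret finite_measure \<mu> by (rule fin)
  have "compact ((\<lambda>(x, y). k x y) ` (UNIV \<times> UNIV))"
    by (intro compact_continuous_image compact_Times compact) (use cont in simp)
  then obtain B where "\<forall>z \<in> (\<lambda>(x, y). k x y) ` (UNIV \<times> UNIV). norm z \<le> B"
    using compact_imp_bounded bounded_iff by metis
  then have B: "\<bar>k x y\<bar> \<le> B" for x y by auto
  then have B0: "0 \<le> B" using abs_ge_zero order_trans by blast
  have ky: "continuous_on UNIV (k x)" for x
    using continuous_on_compose2[OF cont, of UNIV "\<lambda>y. (x, y)"]
    by (simp add: continuous_on_Pair)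
  have kx: "continuous_on UNIV (\<lambda>x. k x y)" for y
    using continuous_on_compose2[OF cont, of UNIV "\<lambda>x. (x, y)"]
    by (simp add: continuous_on_Pair)
  have meas [measurable]: "k x \<in> borel_measurable \<mu>" for x
    using borel_measurable_continuous_onI[OF ky] measurable_cong_sets[OF borel refl] by blast
  have hmeas [measurable]: "apply_bcontfun h \<in> borel_measurable \<mu>" for h :: "'a \<Rightarrow>\<^sub>C complex"
    using borel_measurable_continuous_onI[OF continuous_on_apply_bcontfun]
      measurable_cong_sets[OF borel refl] by blast
  have bnd: "norm (complex_of_real (k x y) * h y) \<le> B * norm h" for x y and h :: "'a \<Rightarrow>\<^sub>C complex"
    using B B0 norm_bounded[of h y] by (auto simp: norm_mult intro!: mult_mono)
  have int: "integrable \<mu> (\<lambda>y. complex_of_real (k x y) * h y)" for x and h :: "'a \<Rightarrow>\<^sub>C complex"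
    by (rule integrable_const_bound[where B = "B * norm h"]) (use bnd in auto)
  have contI: "continuous_on UNIV (\<lambda>x. \<integral>y. complex_of_real (k x y) * h y \<partial>\<mu>)"
    for h :: "'a \<Rightarrow>\<^sub>C complex"
  proof (rule continuous_on_sequentiallyI)
    fix u :: "nat \<Rightarrow> 'a" and a :: 'a
    assume u: "u \<longlonglongrightarrow> a"
    show "(\<lambda>n. \<integral>y. complex_of_real (k (u n) y) * h y \<partial>\<mu>)
            \<longlonglongrightarrow> (\<integral>y. complex_of_real (k a y) * h y \<partial>\<mu>)"
    proof (rule integral_dominated_convergence[where w = "\<lambda>_. B * norm h"])
      show "AE y in \<mu>. (\<lambda>n. complex_of_real (k (u n) y) * h y)
              \<longlonglongrightarrow> complex_of_real (k a y) * h y"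
        using kx u by (intro AE_I2 tendsto_intros) (auto simp: continuous_on_sequentially comp_def)
    qed (use bnd in auto)
  qed
  have deg: "complex_of_real (degree_fun k \<mu> x)
      = (\<integral>y. complex_of_real (k x y) * const_bcontfun 1 y \<partial>\<mu>)" for x
    by (simp add: degree_fun_def const_bcontfun.rep_eq integral_complex_of_real)
  define T where "T h x = complex_of_real (degree_fun k \<mu> x) * h x
      - (\<integral>y. complex_of_real (k x y) * h y \<partial>\<mu>)" for h :: "'a \<Rightarrow>\<^sub>C complex" and x
  have T_cont: "continuous_on UNIV (T h)" for h
    unfolding T_def deg by (intro continuous_intros contI) simp
  have "bounded (range (T h))" for h
    by (rule compact_imp_bounded[OF compact_continuous_image[OF T_cont compact]])
  then have T_bc: "T h \<in> bcontfun" for h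
    using T_cont by (simp add: bcontfun_def)
  note ap = Bcontfun_inverse[OF T_bc]
  let ?m = "measure \<mu> (space \<mu>)"
  have int_bnd: "norm (\<integral>y. complex_of_real (k x y) * h y \<partial>\<mu>) \<le> B * norm h * ?m"
    for x and h :: "'a \<Rightarrow>\<^sub>C complex"
  proof -
    have "norm (\<integral>y. complex_of_real (k x y) * h y \<partial>\<mu>)
        \<le> (\<integral>y. norm (complex_of_real (k x y) * h y) \<partial>\<mu>)"
      by (rule integral_norm_bound)
    also have "\<dots> \<le> (\<integral>y. B * norm h \<partial>\<mu>)"
      by (intro integral_mono integrable_norm int bnd) simp
    finally show ?thesis by (simp add: mult_ac)
  qed
  have norm1: "norm (const_bcontfun 1 :: 'a \<Rightarrow>\<^sub>C complex) \<le> 1"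
    by (rule norm_bound) (simp add: const_bcontfun.rep_eq)
  have deg_bnd: "norm (complex_of_real (degree_fun k \<mu> x)) \<le> B * ?m" for x
  proof -
    have "norm (complex_of_real (degree_fun k \<mu> x))
        \<le> B * norm (const_bcontfun 1 :: 'a \<Rightarrow>\<^sub>C complex) * ?m"
      unfolding deg by (rule int_bnd)
    also have "\<dots> \<le> B * 1 * ?m"
      by (intro mult_right_mono mult_left_mono norm1 B0) simp
    finally show ?thesis by simp
  qed
  have "bounded_linear (\<lambda>h. Bcontfun (T h))"
  proof (rule bounded_linear_intro[where K = "2 * B * ?m"])
    fix h h' :: "'a \<Rightarrow>\<^sub>C complex" and r :: real
    show "Bcontfun (T (h + h')) = Bcontfun (T h) + Bcontfun (T h')"
      by (rule bcontfun_eqI)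
        (simp add: ap, simp add: T_def distrib_left Bochner_Integration.integral_add[OF int int])
    have "(\<integral>y. complex_of_real (k x y) * (r *\<^sub>R h y) \<partial>\<mu>)
        = r *\<^sub>R (\<integral>y. complex_of_real (k x y) * h y \<partial>\<mu>)" for x
      by (simp flip: integral_scaleR_right)
    then show "Bcontfun (T (r *\<^sub>R h)) = r *\<^sub>R Bcontfun (T h)"
      by (intro bcontfun_eqI) (simp add: ap, simp add: T_def scaleR_diff_right)
    show "norm (Bcontfun (T h)) \<le> norm h * (2 * B * ?m)"
    proof (rule norm_bound)
      fix x
      have "norm (T h x) \<le> norm (complex_of_real (degree_fun k \<mu> x) * h x) + B * norm h * ?m"
        unfolding T_def by (rule order_trans[OF norm_triangle_ineq4 add_left_mono[OF int_bnd]])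
      also have "norm (complex_of_real (degree_fun k \<mu> x) * h x) \<le> (B * ?m) * norm h"
        unfolding norm_mult by (rule mult_mono[OF deg_bnd norm_bounded]) (use B0 in auto)
      finally show "norm (Bcontfun (T h) x) \<le> norm h * (2 * B * ?m)"
        by (simp add: ap algebra_simps)
    qed
  qed
  then have "Blinfun (\<lambda>h. Bcontfun (T h)) g x = T g x"
    by (simp add: bounded_linear_Blinfun_apply ap)
  then show ?thesis
    by (simp add: laplace_op_def T_def[abs_def])
qed

end

theory Submission
  imports Defs
begin

text \<open>
  The empirical measures converge on the cells of fine finite partitions almost surely
  (Hoeffding's inequality and Borel--Cantelli), hence the empirical integral operators converge
  pointwise. Since their images of a bounded set are equicontinuous, bounded approximate
  eigenfunctions of \<open>U\<^sub>n\<close> for parameters converging to a point off the range of \<open>d\<close> have a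
  subsequence converging to an eigenfunction of \<open>U\<close> (Arzela--Ascoli). By contradiction this bounds
  \<open>U\<^sub>n - \<zeta>\<close> from below, uniformly in \<open>n\<close> and in \<open>\<zeta>\<close> in \<open>M\<close> away from \<open>\<lambda>\<close>; off the range
  of \<open>d\<^sub>n\<close> injectivity gives invertibility because \<open>U\<^sub>n\<close> is determined there by the matrix
  \<open>1/n L\<^sub>n\<close>. So the spectrum in \<open>M\<close> contracts to \<open>\<lambda>\<close>, the resolvents converge pointwise,
  uniformly on a small circle around \<open>\<lambda>\<close>, and with them the spectral projections, which are
  independent of the curve by the residue theorem. For simple \<open>\<lambda>\<close> the limits of normalized
  eigenfunctions are \<open>f\<close> and \<open>-f\<close> only, the normalization surviving because the sample is dense.
\<close>

section \<open>Resolvents and spectral projections\<close>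

text \<open>The multiplication parts of \<open>U_n\<close> and \<open>U\<close> are close in norm,
  but the integral parts are only known to converge pointwise, so norm perturbation theory does not
  apply. What replaces it is one modulus of continuity shared by all images of bounded functions,
  whatever the measure of mass at most 1. Such compactness arguments see eigenvalues, while spectra
  ask for invertibility. For \<open>U\<close> this gap never has to be closed: the assumption on the
  spectrum in the closure of \<open>M\<close> already supplies the resolvent. The closure of
  \<open>M\<close> must avoid the rest of the spectrum and the range of \<open>d\<close> because
  limits of parameters from \<open>M\<close> occur. Moreover \<open>M\<close> may be unbounded, so
  large parameters are treated by a norm bound and only the others by compactness. Randomness enters
  once, through a single almost sure event on which the kernel operators converge at all
  \<open>g\<close> together. From there on the sample is a fixed sequence, and the quantification
  over all sequences of eigenvalues and eigenvectors is deterministic.\<close>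

instance bcontfun :: (metric_space, banach) banach ..

type_synonym 'a cop = "('a \<Rightarrow>\<^sub>C complex) \<Rightarrow>\<^sub>L ('a \<Rightarrow>\<^sub>C complex)"

lemma cmult_cmult: "cmult a (cmult b g) = cmult (a * b) g"
  by (rule bcontfun_eqI) (simp add: cmult_apply mult_ac)

lemma cmult_one [simp]: "cmult 1 g = g"
  by (rule bcontfun_eqI) (simp add: cmult_apply)

lemma cmult_diff_left: "cmult (a - b) g = cmult a g - cmult b g"
  by (rule bcontfun_eqI) (simp add: cmult_apply algebra_simps)

lemma norm_cmult_le: "norm (cmult c g) \<le> norm c * norm g"
  by (rule norm_bound) (simp add: cmult_apply norm_mult mult_left_mono norm_bounded)

lemma norm_cmult: "norm (cmult c g) = norm c * norm g"
proof (cases "c = 0")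
  case True
  then show ?thesis
    using norm_cmult_le[of 0 g] by simp
next
  case False
  have "norm g \<le> norm (inverse c) * norm (cmult c g)"
    using norm_cmult_le[of "inverse c" "cmult c g"] False by (simp add: cmult_cmult)
  then have "norm c * norm g \<le> norm (cmult c g)"
    using False by (simp add: norm_divide field_simps)
  then show ?thesis
    using norm_cmult_le[of c g] by simp
qed

lemma norm_cmult_op_le: "norm (cmult c) \<le> norm c"
  by (rule norm_blinfun_bound) (auto simp: norm_cmult)

lemma bounded_linear_cmult: "bounded_linear cmult"
proof (rule bounded_linear_intro[where K = 1])
  show "cmult (x + y) = cmult x + (cmult y :: 'a cop)" for x y
    by (intro blinfun_eqI bcontfun_eqI) (simp add: cmult_apply blinfun.add_left algebra_simps)
  show "cmult (r *\<^sub>R x) = r *\<^sub>R (cmult x :: 'a cop)" for r x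
    by (intro blinfun_eqI bcontfun_eqI) (simp add: cmult_apply blinfun.scaleR_left)
  show "norm (cmult x :: 'a cop) \<le> norm x * 1" for x
    using norm_cmult_op_le by simp
qed

text \<open>The operator type records real-linearity only. The resolvent identity, and with it
  holomorphy of the resolvent, rests on complex-linearity.\<close>

definition clinear_op :: "'a::topological_space cop \<Rightarrow> bool" where
  "clinear_op A \<longleftrightarrow> (\<forall>c g. A (cmult c g) = cmult c (A g))"

lemma clinear_op_cmult: "clinear_op (cmult c)"
  by (simp add: clinear_op_def cmult_cmult mult.commute)

lemma clinear_op_diff: "clinear_op A \<Longrightarrow> clinear_op B \<Longrightarrow> clinear_op (A - B)"
  by (simp add: clinear_op_def blinfun.diff_left blinfun.diff_right)

text \<open>The lower bound makes \<open>A - cmult \<zeta>\<close> injective and bounds the inverse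
  at the same time, so no open mapping theorem is involved.\<close>

lemma is_resolventI:
  fixes A :: "'a::topological_space cop"
  assumes surj: "\<And>h. \<exists>g. A g - cmult \<zeta> g = h"
    and c: "c > 0" and lower: "\<And>g. c * norm g \<le> norm (A g - cmult \<zeta> g)"
  obtains R where "is_resolvent A \<zeta> R" "norm R \<le> 1 / c"
proof -
  define B where "B = A - cmult \<zeta>"
  have B: "B g = A g - cmult \<zeta> g" for g
    by (simp add: B_def blinfun.diff_left)
  obtain r where r: "B (r h) = h" for h
    using surj unfolding B by metis
  have inj: "g = g'" if "B g = B g'" for g g'
    using lower[of "g - g'"] that c unfolding B[symmetric]
    by (simp add: blinfun.diff_right mult_le_0_iff)
  have norm_r: "norm (r h) \<le> norm h * (1 / c)" for h
    using lower[of "r h"] c unfolding B[symmetric] r by (simp add: field_simps)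
  \<comment> \<open>\<open>r\<close> is chosen value by value; it is linear because the injective
    \<open>B\<close> maps both sides of each linearity identity to the same function.\<close>
  have "bounded_linear r"
    by (rule bounded_linear_intro[OF _ _ norm_r]; rule inj)
      (simp_all add: r blinfun.add_right blinfun.scaleR_right)
  then have R: "Blinfun r h = r h" for h
    by (simp add: bounded_linear_Blinfun_apply)
  show thesis
  proof (rule that)
    show "is_resolvent A \<zeta> (Blinfun r)"
      unfolding is_resolvent_def B_def[symmetric]
    proof
      show "Blinfun r o\<^sub>L B = id_blinfun"
        by (intro blinfun_eqI, simp add: R, rule inj) (simp add: r)
      show "B o\<^sub>L Blinfun r = id_blinfun"
        by (intro blinfun_eqI) (simp add: R r)
    qed
    show "norm (Blinfun r) \<le> 1 / c"
      by (rule norm_blinfun_bound) (use c norm_r in \<open>auto simp: R mult.commute\<close>)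
  qed
qed

section \<open>Resolvent calculus: perturbation, continuity, holomorphy\<close>

lemma is_resolvent_left:
  assumes "is_resolvent A \<zeta> R" shows "R (A g - cmult \<zeta> g) = g"
proof -
  have "(R o\<^sub>L (A - cmult \<zeta>)) g = id_blinfun g"
    using assms by (simp add: is_resolvent_def)
  then show ?thesis by (simp add: blinfun.diff_left)
qed

lemma is_resolvent_right:
  assumes "is_resolvent A \<zeta> R" shows "A (R g) - cmult \<zeta> (R g) = g"
proof -
  have "((A - cmult \<zeta>) o\<^sub>L R) g = id_blinfun g"
    using assms by (simp add: is_resolvent_def)
  then show ?thesis by (simp add: blinfun.diff_left)
qed

lemma is_resolvent_resolvent:
  assumes "\<zeta> \<notin> op_spectrum A" shows "is_resolvent A \<zeta> (resolvent A \<zeta>)"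
  using assms resolvent_eq by (auto simp: op_spectrum_def)

text \<open>The space contains the nonzero constant 1. Radii such as \<open>1 / (2 * norm R)\<close>
  are thereby positive.\<close>

lemma is_resolvent_norm_pos:
  fixes A :: "'a::topological_space cop"
  assumes "is_resolvent A \<zeta> R" shows "0 < norm R"
proof -
  have "(const_bcontfun 1 :: 'a \<Rightarrow>\<^sub>C complex) \<noteq> 0"
    by (metis const_bcontfun.rep_eq zero_bcontfun.rep_eq zero_neq_one)
  then have "R \<noteq> 0"
    using is_resolvent_left[OF assms, of "const_bcontfun 1"] by auto
  then show ?thesis by simp
qed

lemma is_resolvent_lower:
  assumes "is_resolvent A \<zeta> R" shows "norm g \<le> norm R * norm (A g - cmult \<zeta> g)"
  using norm_blinfun[of R "A g - cmult \<zeta> g"] is_resolvent_left[OF assms, of g] by simp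

lemma is_resolvent_clinear:
  fixes A :: "'a::topological_space cop"
  assumes R: "is_resolvent A \<zeta> R" and A: "clinear_op A"
  shows "R (cmult c g) = cmult c (R g)"
proof -
  let ?B = "A - cmult \<zeta>"
  have B: "?B h = A h - cmult \<zeta> h" for h
    by (simp add: blinfun.diff_left)
  have "cmult c g = cmult c (?B (R g))"
    using is_resolvent_right[OF R, of g] by (simp add: B)
  also have "\<dots> = ?B (cmult c (R g))"
    using clinear_op_diff[OF A clinear_op_cmult] by (simp add: clinear_op_def)
  finally show ?thesis
    using is_resolvent_left[OF R] by (simp add: B)
qed

lemma resolvent_identity:
  fixes A :: "'a::topological_space cop"
  assumes R: "is_resolvent A \<zeta> R" and S: "is_resolvent A \<eta> S" and A: "clinear_op A"
  shows "R g - S g = cmult (\<zeta> - \<eta>) (R (S g))"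
proof -
  have "R g - S g = R (A (S g) - cmult \<eta> (S g)) - R (A (S g) - cmult \<zeta> (S g))"
    using is_resolvent_left[OF R] is_resolvent_right[OF S] by simp
  also have "\<dots> = R (cmult (\<zeta> - \<eta>) (S g))"
    by (simp add: blinfun.diff_right cmult_diff_left)
  finally show ?thesis
    using is_resolvent_clinear[OF R A] by simp
qed

text \<open>A fixed point takes the place of the Neumann series:
  \<open>A g - cmult \<eta> g = h\<close> is equivalent to
  \<open>g = R (h + cmult (\<eta> - \<zeta>) g)\<close>, a contraction with factor 1/2. The same
  factor, absorbed on the left, gives the bound \<open>2 * norm R\<close>.\<close>

lemma resolvent_perturb:
  fixes A :: "'a::metric_space cop"
  assumes R: "is_resolvent A \<zeta> R" and small: "norm (\<eta> - \<zeta>) * norm R \<le> 1 / 2"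
  obtains S where "is_resolvent A \<eta> S" "norm S \<le> 2 * norm R"
proof -
  have pos: "0 < norm R" by (rule is_resolvent_norm_pos[OF R])
  have eta: "A g - cmult \<eta> g = (A g - cmult \<zeta> g) - cmult (\<eta> - \<zeta>) g" for g
    by (simp add: cmult_diff_left)
  have surj: "\<exists>g. A g - cmult \<eta> g = h" for h
  proof -
    let ?F = "\<lambda>g. R (h + cmult (\<eta> - \<zeta>) g)"
    have "dist (?F g) (?F g') \<le> 1 / 2 * dist g g'" for g g'
    proof -
      have "?F g - ?F g' = R (cmult (\<eta> - \<zeta>) (g - g'))"
        by (simp add: blinfun.diff_right blinfun.add_right)
      also have "norm \<dots> \<le> norm R * (norm (\<eta> - \<zeta>) * norm (g - g'))"
        by (metis norm_blinfun norm_cmult)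
      also have "\<dots> \<le> 1 / 2 * norm (g - g')"
        using mult_right_mono[OF small norm_ge_zero[of "g - g'"]] by (simp add: mult_ac)
      finally show ?thesis by (simp add: dist_norm)
    qed
    then obtain g where g: "?F g = g"
      using banach_fix_type[of "1 / 2" ?F] by auto
    have "A g - cmult \<zeta> g = h + cmult (\<eta> - \<zeta>) g"
      using is_resolvent_right[OF R, of "h + cmult (\<eta> - \<zeta>) g"] g by simp
    then show ?thesis unfolding eta by (intro exI[of _ g]) simp
  qed
  have lower: "1 / (2 * norm R) * norm g \<le> norm (A g - cmult \<eta> g)" for g
  proof -
    have "norm g \<le> norm R * norm (A g - cmult \<zeta> g)"
      by (rule is_resolvent_lower[OF R])
    also have "\<dots> \<le> norm R * (norm (A g - cmult \<eta> g) + norm (\<eta> - \<zeta>) * norm g)"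
      using norm_triangle_ineq[of "A g - cmult \<eta> g" "cmult (\<eta> - \<zeta>) g"]
      by (intro mult_left_mono) (simp_all add: eta norm_cmult)
    also have "\<dots> \<le> norm R * norm (A g - cmult \<eta> g) + 1 / 2 * norm g"
      using mult_right_mono[OF small norm_ge_zero[of g]] by (simp add: algebra_simps)
    finally show ?thesis using pos by (simp add: field_simps)
  qed
  show thesis
    by (rule is_resolventI[OF surj _ lower]) (use pos that in auto)
qed

lemma closed_op_spectrum:
  fixes A :: "'a::metric_space cop"
  shows "closed (op_spectrum A)"
  unfolding closed_def open_dist
proof
  fix \<zeta> assume "\<zeta> \<in> - op_spectrum A"
  then obtain R where R: "is_resolvent A \<zeta> R" by (auto simp: op_spectrum_def)
  have pos: "0 < norm R" by (rule is_resolvent_norm_pos[OF R])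
  have "\<eta> \<in> - op_spectrum A" if "dist \<eta> \<zeta> < 1 / (2 * norm R)" for \<eta>
  proof -
    have "norm (\<eta> - \<zeta>) * norm R \<le> 1 / 2"
      using that pos by (simp add: dist_norm field_simps)
    from resolvent_perturb[OF R this] show ?thesis by (auto simp: op_spectrum_def)
  qed
  then show "\<exists>e>0. \<forall>\<eta>. dist \<eta> \<zeta> < e \<longrightarrow> \<eta> \<in> - op_spectrum A"
    using pos by (intro exI[of _ "1 / (2 * norm R)"]) auto
qed

text \<open>The resolvent identity turns the local bound from \<open>resolvent_perturb\<close> into
  a Lipschitz estimate at \<open>\<zeta>\<close> in operator norm.\<close>

lemma continuous_on_resolvent:
  fixes A :: "'a::metric_space cop"
  assumes A: "clinear_op A"
  shows "continuous_on (- op_spectrum A) (resolvent A)"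
proof (rule continuous_at_imp_continuous_on, rule ballI)
  fix \<zeta> assume "\<zeta> \<in> - op_spectrum A"
  then have R: "is_resolvent A \<zeta> (resolvent A \<zeta>)" (is "is_resolvent A \<zeta> ?R")
    by (intro is_resolvent_resolvent) auto
  have pos: "0 < norm ?R" by (rule is_resolvent_norm_pos[OF R])
  have bound: "norm (resolvent A \<eta> - ?R) \<le> norm (\<eta> - \<zeta>) * (2 * norm ?R * norm ?R)"
    if "dist \<eta> \<zeta> < 1 / (2 * norm ?R)" for \<eta>
  proof -
    have "norm (\<eta> - \<zeta>) * norm ?R \<le> 1 / 2"
      using that pos by (simp add: dist_norm field_simps)
    from resolvent_perturb[OF R this] obtain S
      where S: "is_resolvent A \<eta> S" and norm_S: "norm S \<le> 2 * norm ?R" .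
    have "norm ((resolvent A \<eta> - ?R) g) \<le> norm (\<eta> - \<zeta>) * (2 * norm ?R * norm ?R) * norm g" for g
    proof -
      have "norm ((resolvent A \<eta> - ?R) g) = norm (\<eta> - \<zeta>) * norm (S (?R g))"
        using resolvent_identity[OF S R A, of g]
        by (simp add: resolvent_eq[OF S] blinfun.diff_left norm_cmult)
      also have "\<dots> \<le> norm (\<eta> - \<zeta>) * (2 * norm ?R * (norm ?R * norm g))"
        by (intro mult_left_mono order_trans[OF norm_blinfun] mult_mono norm_S norm_blinfun) auto
      finally show ?thesis by (simp add: mult_ac)
    qed
    then show ?thesis by (intro norm_blinfun_bound) auto
  qed
  show "isCont (resolvent A) \<zeta>"
    unfolding isCont_def
  proof (rule Lim_transform_bound[where g = "\<lambda>\<eta>. norm (\<eta> - \<zeta>) * (2 * norm ?R * norm ?R)", THEN Lim_null[THEN iffD2]])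
    show "\<forall>\<^sub>F \<eta> in at \<zeta>. norm (resolvent A \<eta> - ?R) \<le> norm (norm (\<eta> - \<zeta>) * (2 * norm ?R * norm ?R))"
      unfolding eventually_at using bound pos
      by (intro exI[of _ "1 / (2 * norm ?R)"]) fastforce
  qed (auto intro!: tendsto_eq_intros)
qed

text \<open>Carries operator-valued limits and integrals to complex-valued ones, to which the
  residue theorem applies.\<close>

lemma bounded_linear_eval:
  "bounded_linear (\<lambda>T :: 'a::topological_space cop. apply_bcontfun (blinfun_apply T h) x)"
  by (rule bounded_linear_intro[where K = "norm h"])
    (simp_all add: blinfun.add_left blinfun.scaleR_left
      order_trans[OF norm_bounded norm_blinfun])

text \<open>By the resolvent identity the difference quotient equals
  \<open>resolvent A \<eta> (resolvent A \<zeta> g) x\<close>, so continuity of the resolvent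
  already provides the derivative.\<close>

lemma holomorphic_on_resolvent:
  fixes A :: "'a::metric_space cop"
  assumes A: "clinear_op A"
  shows "(\<lambda>\<zeta>. resolvent A \<zeta> g x) holomorphic_on (- op_spectrum A)"
  unfolding holomorphic_on_def
proof
  fix \<zeta> assume z: "\<zeta> \<in> - op_spectrum A"
  have "((\<lambda>\<eta>. resolvent A \<eta> (resolvent A \<zeta> g) x) \<longlongrightarrow> resolvent A \<zeta> (resolvent A \<zeta> g) x)
      (at \<zeta> within - op_spectrum A)"
    using continuous_on_resolvent[OF A] z
    by (intro bounded_linear.tendsto[OF bounded_linear_eval]) (auto simp: continuous_on_def)
  then have "((\<lambda>\<zeta>. resolvent A \<zeta> g x) has_field_derivative resolvent A \<zeta> (resolvent A \<zeta> g) x)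
      (at \<zeta> within - op_spectrum A)"
    unfolding has_field_derivative_iff
  proof (rule Lim_transform_within[where d = 1])
    show "0 < (1 :: real)" by simp
    fix \<eta> assume e: "\<eta> \<in> - op_spectrum A" "0 < dist \<eta> \<zeta>"
    have "resolvent A \<eta> g - resolvent A \<zeta> g = cmult (\<eta> - \<zeta>) (resolvent A \<eta> (resolvent A \<zeta> g))"
      using e z by (intro resolvent_identity[OF is_resolvent_resolvent is_resolvent_resolvent A]) auto
    then have "resolvent A \<eta> g x - resolvent A \<zeta> g x = (\<eta> - \<zeta>) * resolvent A \<eta> (resolvent A \<zeta> g) x"
      by (metis cmult_apply minus_bcontfun.rep_eq)
    then show "resolvent A \<eta> (resolvent A \<zeta> g) x =
        (resolvent A \<eta> g x - resolvent A \<zeta> g x) / (\<eta> - \<zeta>)"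
      using e by auto
  qed
  then show "(\<lambda>\<zeta>. resolvent A \<zeta> g x) field_differentiable at \<zeta> within - op_spectrum A"
    by (auto simp: field_differentiable_def)
qed


text \<open>The point is that the right side does not mention \<open>\<Gamma>\<close>. A finite
  isolated part consists of isolated singularities, each with winding number -1.\<close>

lemma separating_curve_contour_integral:
  fixes A :: "'a::metric_space cop"
  assumes A: "clinear_op A" and fin: "finite \<tau>" and iso: "isolated_part A \<tau>"
    and sep: "separating_curve A \<tau> \<Gamma>"
  shows "contour_integral \<Gamma> (\<lambda>\<zeta>. resolvent A \<zeta> g x)
    = - (2 * of_real pi * \<i> * (\<Sum>p\<in>\<tau>. residue (\<lambda>\<zeta>. resolvent A \<zeta> g x) p))"
proof -
  let ?I = "path_image \<Gamma>"
  let ?S = "- (op_spectrum A - \<tau>)"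
  have valid: "valid_path \<Gamma>" and loop: "pathfinish \<Gamma> = pathstart \<Gamma>"
    and ins: "\<tau> \<subseteq> inside ?I" and out: "op_spectrum A - \<tau> \<subseteq> outside ?I"
    and wn: "\<And>z. z \<in> inside ?I \<Longrightarrow> winding_number \<Gamma> z = - 1"
    using sep by (auto simp: separating_curve_def)
  have path: "path \<Gamma>" using valid by (rule valid_path_imp_path)
  obtain V where "open V" "\<tau> \<subseteq> V" "op_spectrum A \<inter> V = \<tau>"
    using iso by (auto simp: isolated_part_def)
  then have "?S = - op_spectrum A \<union> V" by auto
  then have openS: "open ?S"
    using \<open>open V\<close> closed_op_spectrum[of A] by auto
  \<comment> \<open>The complement of the remaining spectrum may be disconnected, but the residue
    theorem asks for a connected domain. The component of the curve contains its inside, since curve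
    and inside form a connected set.\<close>
  define C where "C = connected_component_set ?S (pathstart \<Gamma>)"
  have disj: "?I \<inter> inside ?I = {}" "?I \<inter> outside ?I = {}" "inside ?I \<inter> outside ?I = {}"
    by (simp_all add: Int_commute[of ?I])
  have conn: "connected (?I \<union> inside ?I)"
    by (intro connected_with_inside closed_path_image connected_path_image path)
  have sub: "?I \<union> inside ?I \<subseteq> C"
    unfolding C_def
  proof (rule connected_component_maximal[OF _ conn])
    show "pathstart \<Gamma> \<in> ?I \<union> inside ?I" using pathstart_in_path_image by blast
    show "?I \<union> inside ?I \<subseteq> ?S" using disj out by blast
  qed
  have "C \<subseteq> ?S" unfolding C_def by (rule connected_component_subset)
  have "contour_integral \<Gamma> (\<lambda>\<zeta>. resolvent A \<zeta> g x) = of_real (2 * pi) * \<i> *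
      (\<Sum>p\<in>\<tau>. winding_number \<Gamma> p * residue (\<lambda>\<zeta>. resolvent A \<zeta> g x) p)"
  proof (rule Residue_theorem[where S = C])
    show "open C" unfolding C_def by (rule open_connected_component[OF openS])
    show "connected C" unfolding C_def by simp
    show "(\<lambda>\<zeta>. resolvent A \<zeta> g x) holomorphic_on C - \<tau>"
      by (rule holomorphic_on_subset[OF holomorphic_on_resolvent[OF A]])
        (use \<open>C \<subseteq> ?S\<close> in auto)
    show "path_image \<Gamma> \<subseteq> C - \<tau>" using sub ins disj by auto
    \<comment> \<open>A point off \<open>C\<close> is neither on the curve nor inside it, hence
      outside.\<close>
    show "\<forall>z. z \<notin> C \<longrightarrow> winding_number \<Gamma> z = 0"
      using sub inside_Un_outside[of ?I] winding_number_zero_in_outside[OF path loop] by blast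
  qed (use fin valid loop in auto)
  also have "(\<Sum>p\<in>\<tau>. winding_number \<Gamma> p * residue (\<lambda>\<zeta>. resolvent A \<zeta> g x) p)
      = (\<Sum>p\<in>\<tau>. - residue (\<lambda>\<zeta>. resolvent A \<zeta> g x) p)"
    using ins wn by (intro sum.cong) auto
  finally show ?thesis by (simp add: sum_negf)
qed

text \<open>\<open>is_spectral_projection\<close> permits any separating curve, but each value
  \<open>Q g x\<close> is minus the same sum of residues.\<close>

lemma spectral_projection_unique:
  fixes A :: "'a::metric_space cop"
  assumes A: "clinear_op A" and fin: "finite \<tau>" and iso: "isolated_part A \<tau>"
    and Q: "is_spectral_projection A \<tau> Q" and Q': "is_spectral_projection A \<tau> Q'"
  shows "Q = Q'"
proof -
  have *: "Q g x = - (\<Sum>p\<in>\<tau>. residue (\<lambda>\<zeta>. resolvent A \<zeta> g x) p)"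
    if Q: "is_spectral_projection A \<tau> Q" for Q g x
  proof -
    obtain \<Gamma> where sep: "separating_curve A \<tau> \<Gamma>"
      and int: "((\<lambda>t. cmult (vector_derivative \<Gamma> (at t within {0..1})) o\<^sub>L resolvent A (\<Gamma> t))
           has_integral (cmult (2 * of_real pi * \<i>) o\<^sub>L Q)) {0..1}"
      using Q by (auto simp: is_spectral_projection_def)
    have "((\<lambda>\<zeta>. resolvent A \<zeta> g x) has_contour_integral 2 * of_real pi * \<i> * Q g x) \<Gamma>"
      using has_integral_linear[OF int bounded_linear_eval[of g x]]
      by (simp add: has_contour_integral_def comp_def cmult_apply mult_ac)
    then have eq: "2 * of_real pi * \<i> * Q g x = - (2 * of_real pi * \<i> *
        (\<Sum>p\<in>\<tau>. residue (\<lambda>\<zeta>. resolvent A \<zeta> g x) p))"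
      by (rule trans[OF contour_integral_unique[symmetric]
          separating_curve_contour_integral[OF A fin iso sep]])
    have cancel: "u = - v" if "c * u = - (c * v)" "c \<noteq> 0" for c u v :: complex
      using that mult_left_cancel[of c u "- v"] by simp
    show ?thesis by (rule cancel[OF eq]) simp
  qed
  show ?thesis
    by (intro blinfun_eqI bcontfun_eqI) (simp only: *[OF Q] *[OF Q'])
qed

text \<open>The angle runs from 2 pi down to 0, the orientation demanded by
  \<open>separating_curve\<close>. Written as a circular arc, the path has an explicit derivative at
  once.\<close>

definition cw_circle :: "complex \<Rightarrow> real \<Rightarrow> real \<Rightarrow> complex" where
  "cw_circle z r = part_circlepath z r (2 * pi) 0"

lemma cw_circle_eq_reversepath: "cw_circle z r = reversepath (circlepath z r)"
  by (simp add: cw_circle_def circlepath_def)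

lemma path_image_cw_circle: "0 \<le> r \<Longrightarrow> path_image (cw_circle z r) = sphere z r"
  by (simp add: cw_circle_eq_reversepath)

lemma vector_derivative_cw_circle:
  assumes "t \<in> {0..1}"
  shows "vector_derivative (cw_circle z r) (at t within {0..1})
    = - (\<i> * r * (2 * pi)) * exp (\<i> * linepath (2 * pi) 0 t)"
  using assms vector_derivative_part_circlepath01[of t z r "2 * pi" 0]
  by (simp add: cw_circle_def)

lemma separating_curve_cw_circle:
  assumes r: "0 < r" and ins: "\<tau> \<subseteq> ball z r" and out: "op_spectrum A - \<tau> \<subseteq> - cball z r"
  shows "separating_curve A \<tau> (cw_circle z r)"
proof -
  have "inside (sphere z r) = ball z r"
    using inside_frontier_eq_interior[of "cball z r"] r by simp
  moreover have "outside (sphere z r) = - cball z r"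
    using outside_frontier_eq_complement_closure[of "cball z r"] r by simp
  moreover have "winding_number (cw_circle z r) w = - 1" if "w \<in> ball z r" for w
    using that winding_number_circlepath[of w z r] r
    by (simp add: cw_circle_eq_reversepath winding_number_reversepath dist_norm norm_minus_commute)
  ultimately show ?thesis
    using r ins out
    by (auto simp: separating_curve_def path_image_cw_circle cw_circle_eq_reversepath
        simple_path_reversepath simple_path_circlepath)
qed

text \<open>With the contour fixed, integrals for different operators can be subtracted under one
  integral sign.\<close>

definition circle_projection ::
  "'a::topological_space cop \<Rightarrow> complex \<Rightarrow> real \<Rightarrow> 'a cop \<Rightarrow> bool" where
  "circle_projection A z r Q \<longleftrightarrow>
     ((\<lambda>t. cmult (vector_derivative (cw_circle z r) (at t within {0..1})) o\<^sub>L
          resolvent A (cw_circle z r t))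
       has_integral (cmult (2 * of_real pi * \<i>) o\<^sub>L Q)) {0..1}"

lemma circle_projection_imp_spectral_projection:
  assumes "0 < r" "\<tau> \<subseteq> ball z r" "op_spectrum A - \<tau> \<subseteq> - cball z r" "circle_projection A z r Q"
  shows "is_spectral_projection A \<tau> Q"
  using assms separating_curve_cw_circle[of r \<tau> z A]
  by (auto simp: is_spectral_projection_def circle_projection_def)

lemma circle_projection_exists:
  fixes A :: "'a::metric_space cop"
  assumes A: "clinear_op A" and r: "0 < r" and sph: "sphere z r \<inter> op_spectrum A = {}"
  obtains Q where "circle_projection A z r Q"
proof -
  let ?f = "\<lambda>t. cmult (vector_derivative (cw_circle z r) (at t within {0..1})) o\<^sub>L
    resolvent A (cw_circle z r t)"
  let ?c = "2 * of_real pi * \<i> :: complex"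
  have "continuous_on {0..1} (\<lambda>t. - (\<i> * r * (2 * pi)) * exp (\<i> * linepath (2 * pi) 0 t))"
    by (intro continuous_intros)
  then have d: "continuous_on {0..1} (\<lambda>t. vector_derivative (cw_circle z r) (at t within {0..1}))"
    by (rule continuous_on_eq) (simp only: vector_derivative_cw_circle)
  have "path (cw_circle z r)" by (simp add: cw_circle_def)
  then have c: "continuous_on {0..1} (cw_circle z r)" by (simp add: path_def)
  have "continuous_on {0..1} (\<lambda>t. resolvent A (cw_circle z r t))"
    by (rule continuous_on_compose2[OF continuous_on_resolvent[OF A] c])
      (use sph r path_image_cw_circle[of r z] in \<open>auto simp: path_image_def\<close>)
  then have "continuous_on {0..1} ?f"
    by (rule bounded_bilinear.continuous_on[OF bounded_bilinear_blinfun_compose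
        bounded_linear.continuous_on[OF bounded_linear_cmult d]])
  then have J: "(?f has_integral integral {0..1} ?f) {0..1}" (is "(_ has_integral ?J) _")
    by (intro integrable_integral integrable_continuous_interval)
  have "cmult ?c o\<^sub>L (cmult (1 / ?c) o\<^sub>L ?J) = ?J"
    by (rule blinfun_eqI) (simp add: cmult_cmult)
  with J show thesis
    by (intro that[of "cmult (1 / ?c) o\<^sub>L ?J"]) (simp add: circle_projection_def)
qed

text \<open>Only values at one \<open>g\<close> are compared, because the resolvents will be
  controlled pointwise and not in norm. The factor \<open>r\<close> is the circumference divided by
  \<open>2 * pi\<close>.\<close>

lemma circle_projection_diff_bound:
  assumes r: "0 < r" and Q: "circle_projection A z r Q" and Q': "circle_projection B z r Q'"
    and bound: "\<And>\<zeta>. \<zeta> \<in> sphere z r \<Longrightarrow> norm (resolvent A \<zeta> g - resolvent B \<zeta> g) \<le> e"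
  shows "norm (Q g - Q' g) \<le> r * e"
proof -
  let ?d = "\<lambda>t. vector_derivative (cw_circle z r) (at t within {0..1})"
  let ?c = "2 * of_real pi * \<i> :: complex"
  have mem: "cw_circle z r t \<in> sphere z r" if "t \<in> {0..1}" for t
    using that path_image_cw_circle[of r z] r by (auto simp: path_image_def)
  have e: "0 \<le> e"
    by (rule order_trans[OF norm_ge_zero bound[OF mem[of 0]]]) simp
  have ev: "bounded_linear (\<lambda>T. blinfun_apply T g)" by (rule blinfun.bounded_linear_left)
  have "((\<lambda>t. cmult (?d t) (resolvent A (cw_circle z r t) g) -
          cmult (?d t) (resolvent B (cw_circle z r t) g))
      has_integral cmult ?c (Q g) - cmult ?c (Q' g)) (cbox 0 1)"
    using has_integral_diff[OF has_integral_linear[OF Q[unfolded circle_projection_def] ev]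
        has_integral_linear[OF Q'[unfolded circle_projection_def] ev]]
    by (simp add: comp_def)
  then have "norm (cmult ?c (Q g) - cmult ?c (Q' g)) \<le> (2 * pi * r * e) * measure lborel (cbox 0 (1 :: real))"
  proof (rule has_integral_bound[rotated])
    fix t :: real assume "t \<in> cbox 0 1"
    then have t: "t \<in> {0..1}" by simp
    have "norm (?d t) = 2 * pi * r"
      unfolding vector_derivative_cw_circle[OF t] using r by (simp add: norm_mult)
    then show "norm (cmult (?d t) (resolvent A (cw_circle z r t) g) -
        cmult (?d t) (resolvent B (cw_circle z r t) g)) \<le> 2 * pi * r * e"
      using bound[OF mem[OF t]] r
      by (simp add: blinfun.diff_right[symmetric] norm_cmult mult_left_mono)
  qed (use r e in simp)
  then show ?thesis
    by (simp add: blinfun.diff_right[symmetric] norm_cmult norm_mult)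
qed

section \<open>Kernel operators and collective compactness\<close>

lemma continuous_in_bcontfun:
  fixes f :: "'a::topological_space \<Rightarrow> 'b::metric_space"
  assumes "compact (UNIV :: 'a set)" "continuous_on UNIV f"
  shows "f \<in> bcontfun"
  using compact_imp_bounded[OF compact_continuous_image[OF assms(2,1)]] assms(2)
  by (simp add: bcontfun_def)

lemma compact_UNIV_net:
  assumes "compact (UNIV :: 'a::metric_space set)" "e > 0"
  obtains C :: "'a::metric_space set" where "finite C" "\<And>x. \<exists>c\<in>C. dist x c < e"
proof -
  obtain C :: "'a set" where "finite C" "UNIV \<subseteq> (\<Union>c\<in>C. ball c e)"
    using assms by (auto simp: compact_eq_totally_bounded)
  then have "\<exists>c\<in>C. dist x c < e" for x
  proof -
    obtain c where "c \<in> C" "x \<in> ball c e" using \<open>UNIV \<subseteq> _\<close> by blast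
    then show ?thesis by (auto simp: dist_commute)
  qed
  with \<open>finite C\<close> show thesis by (rule that)
qed

text \<open>A diagonal subsequence converges on the countable union of finite nets. By
  equicontinuity a single net of mesh below \<open>d\<close> then makes it Cauchy in the supremum
  norm.\<close>

lemma bcontfun_Arzela_Ascoli:
  fixes F :: "nat \<Rightarrow> 'a::metric_space \<Rightarrow>\<^sub>C 'b::{banach, heine_borel}"
  assumes compact: "compact (UNIV :: 'a set)"
    and bound: "\<And>n. norm (F n) \<le> B"
    and equi: "\<And>e. e > 0 \<Longrightarrow> \<exists>d>0. \<forall>n x y. dist x y < d \<longrightarrow> norm (F n x - F n y) < e"
  obtains s h where "strict_mono (s :: nat \<Rightarrow> nat)" "(\<lambda>n. F (s n)) \<longlonglongrightarrow> h"
proof -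
  have "\<exists>C :: 'a set. finite C \<and> (\<forall>x. \<exists>c\<in>C. dist x c < 1 / real (Suc m))" for m
    using compact_UNIV_net[OF compact, of "1 / real (Suc m)"] by (metis of_nat_0_less_iff zero_less_Suc zero_less_divide_1_iff)
  then obtain C :: "nat \<Rightarrow> 'a set" where C: "\<And>m. finite (C m)"
    "\<And>m x. \<exists>c\<in>C m. dist x c < 1 / real (Suc m)"
    by metis
  obtain s where s: "strict_mono (s :: nat \<Rightarrow> nat)"
    and conv: "\<And>x. x \<in> (\<Union>m. C m) \<Longrightarrow> \<exists>l. (\<lambda>n. F (s n) x) \<longlonglongrightarrow> l"
  proof (rule function_convergent_subsequence[of "\<Union>m. C m" "\<lambda>n. apply_bcontfun (F n)" B])
    show "countable (\<Union>m. C m)" using C(1) by (auto intro: countable_finite)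
    show "norm (F n x) \<le> B" for n x using norm_bounded[of "F n" x] bound[of n] by simp
  qed blast
  have "Cauchy (\<lambda>n. F (s n))"
  proof (rule metric_CauchyI)
    fix e :: real assume e: "0 < e"
    then obtain d where d: "d > 0" "\<And>n x y. dist x y < d \<Longrightarrow> norm (F n x - F n y) < e / 4"
      using equi[of "e / 4"] by auto
    obtain m where m: "1 / real (Suc m) < d"
      using d(1) nat_approx_posE by blast
    have "\<forall>\<^sub>F N in sequentially. \<forall>i\<ge>N. \<forall>j\<ge>N. dist (F (s i) c) (F (s j) c) < e / 4" if "c \<in> C m" for c
    proof -
      have "Cauchy (\<lambda>n. F (s n) c)"
        using conv that by (auto intro: LIMSEQ_imp_Cauchy)
      then obtain N where "\<forall>i\<ge>N. \<forall>j\<ge>N. dist (F (s i) c) (F (s j) c) < e / 4"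
        using e unfolding Cauchy_def by (meson zero_less_divide_iff zero_less_numeral)
      then show ?thesis
        unfolding eventually_sequentially by (meson order_trans)
    qed
    then have "\<forall>\<^sub>F N in sequentially. \<forall>c\<in>C m. \<forall>i\<ge>N. \<forall>j\<ge>N. dist (F (s i) c) (F (s j) c) < e / 4"
      using C(1)[of m] by (simp add: eventually_ball_finite)
    then obtain N where N: "\<And>c i j. c \<in> C m \<Longrightarrow> i \<ge> N \<Longrightarrow> j \<ge> N \<Longrightarrow> dist (F (s i) c) (F (s j) c) < e / 4"
      unfolding eventually_sequentially by blast
    have "dist (F (s i)) (F (s j)) < e" if ij: "i \<ge> N" "j \<ge> N" for i j
    proof -
      \<comment> \<open>Passing to the supremum loses strictness, hence the spare
        \<open>e / 4\<close>.\<close>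
      have "dist (F (s i) x) (F (s j) x) \<le> 3 * e / 4" for x
      proof -
        obtain c where c: "c \<in> C m" "dist x c < d"
          using C(2)[of m x] m by force
        have "dist (F (s i) x) (F (s j) x)
            \<le> dist (F (s i) x) (F (s i) c) + dist (F (s i) c) (F (s j) c) + dist (F (s j) c) (F (s j) x)"
          using dist_triangle[of "F (s i) x" "F (s j) x" "F (s i) c"]
            dist_triangle[of "F (s i) c" "F (s j) x" "F (s j) c"] by linarith
        then show ?thesis
          using d(2)[OF c(2), of "s i"] d(2)[OF c(2), of "s j"] N[OF c(1) ij]
          by (simp add: dist_norm norm_minus_commute)
      qed
      then have "dist (F (s i)) (F (s j)) \<le> 3 * e / 4" by (rule dist_bound)
      then show ?thesis using e by simp
    qed
    then show "\<exists>N. \<forall>i\<ge>N. \<forall>j\<ge>N. dist (F (s i)) (F (s j)) < e" by blast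
  qed
  then show thesis
    using s that by (auto simp: Cauchy_convergent_iff convergent_def)
qed

text \<open>Mass at most 1, not exactly 1: the empirical measure of the empty sample has mass 0, and
  statements can then range over all \<open>n\<close>.\<close>

definition subprob :: "'a::topological_space measure \<Rightarrow> bool" where
  "subprob \<mu> \<longleftrightarrow> finite_measure \<mu> \<and> sets \<mu> = sets borel \<and> measure \<mu> (space \<mu>) \<le> 1"

definition ker_op :: "('a::topological_space \<Rightarrow> 'a \<Rightarrow> real) \<Rightarrow> 'a measure \<Rightarrow>
    ('a \<Rightarrow>\<^sub>C complex) \<Rightarrow> ('a \<Rightarrow>\<^sub>C complex)" where
  "ker_op k \<mu> g = Bcontfun (\<lambda>x. \<integral>y. complex_of_real (k x y) * g y \<partial>\<mu>)"

text \<open>Uniform convergence of degree functions becomes the instance \<open>g = 1\<close> of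
  pointwise convergence of kernel operators.\<close>

abbreviation deg :: "('a::topological_space \<Rightarrow> 'a \<Rightarrow> real) \<Rightarrow> 'a measure \<Rightarrow> ('a \<Rightarrow>\<^sub>C complex)" where
  "deg k \<mu> \<equiv> ker_op k \<mu> (const_bcontfun 1)"

locale kernel_space =
  fixes k :: "'a::metric_space \<Rightarrow> 'a \<Rightarrow> real"
  assumes compact: "compact (UNIV :: 'a set)"
    and k_cont: "continuous_on UNIV (\<lambda>(x, y). k x y)"
begin

text \<open>Chosen strictly positive because it is divided by later.\<close>

definition kmax :: real where "kmax = (SOME B. 0 < B \<and> (\<forall>x y. \<bar>k x y\<bar> \<le> B))"

lemma kmax: "0 < kmax" "\<bar>k x y\<bar> \<le> kmax"
proof -
  have "compact ((\<lambda>(x, y). k x y) ` (UNIV \<times> UNIV))"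
    by (intro compact_continuous_image compact_Times compact) (use k_cont in simp)
  then obtain B where "B > 0" "\<forall>z \<in> (\<lambda>(x, y). k x y) ` (UNIV \<times> UNIV). norm z \<le> B"
    using compact_imp_bounded bounded_pos by metis
  then have "\<exists>B. 0 < B \<and> (\<forall>x y. \<bar>k x y\<bar> \<le> B)" by auto
  from someI_ex[OF this] show "0 < kmax" "\<bar>k x y\<bar> \<le> kmax"
    by (auto simp: kmax_def)
qed

lemma uniformly_continuous_section:
  fixes F :: "'a \<Rightarrow> 'a \<Rightarrow> 'c::metric_space"
  assumes "continuous_on UNIV (\<lambda>(x, y). F x y)" "e > 0"
  obtains d where "d > 0" "\<And>x x' y y'. dist x x' < d \<Longrightarrow> dist y y' < d \<Longrightarrow> dist (F x y) (F x' y') < e"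
proof -
  have "uniformly_continuous_on (UNIV \<times> UNIV) (\<lambda>(x, y). F x y)"
    by (intro compact_uniformly_continuous compact_Times compact) (use assms in simp)
  then obtain d where d: "d > 0" "\<And>p q. dist p q < d \<Longrightarrow> dist (case_prod F p) (case_prod F q) < e"
    using assms(2) unfolding uniformly_continuous_on_def by (metis UNIV_Times_UNIV UNIV_I)
  have "dist (F x y) (F x' y') < e" if "dist x x' < d / 2" "dist y y' < d / 2" for x x' y y'
  proof -
    have "dist (x, y) (x', y') \<le> dist x x' + dist y y'"
      by (simp add: dist_Pair_Pair sqrt_sum_squares_le_sum)
    then show ?thesis using d(2)[of "(x, y)" "(x', y')"] that by simp
  qed
  then show thesis using d(1) that[of "d / 2"] by simp
qed

lemma measurable_ker:
  assumes "sets \<mu> = sets borel"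
  shows "(\<lambda>y. complex_of_real (k x y) * apply_bcontfun g y) \<in> borel_measurable \<mu>"
proof -
  have "continuous_on UNIV (k x)"
    using continuous_on_compose2[OF k_cont, of UNIV "\<lambda>y. (x, y)"]
    by (simp add: continuous_on_Pair)
  then have "continuous_on UNIV (\<lambda>y. complex_of_real (k x y) * apply_bcontfun g y)"
    by (intro continuous_intros) auto
  then show ?thesis
    using borel_measurable_continuous_onI measurable_cong_sets[OF assms refl] by blast
qed

lemma norm_ker_le: "norm (complex_of_real (k x y) * apply_bcontfun g y) \<le> kmax * norm g"
  using kmax(2)[of x y] kmax(1) norm_bounded[of g y]
  by (auto simp: norm_mult intro!: mult_mono)

lemma integrable_ker:
  assumes "subprob \<mu>"
  shows "integrable \<mu> (\<lambda>y. complex_of_real (k x y) * apply_bcontfun g y)"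
proof -
  interpret finite_measure \<mu> using assms by (simp add: subprob_def)
  show ?thesis
    by (rule integrable_const_bound[where B = "kmax * norm g"])
      (use measurable_ker assms norm_ker_le in \<open>auto simp: subprob_def\<close>)
qed

lemma norm_integral_subprob:
  fixes f :: "'a \<Rightarrow> complex"
  assumes "subprob \<mu>" "\<And>y. norm (f y) \<le> e"
  shows "norm (\<integral>y. f y \<partial>\<mu>) \<le> e"
proof -
  interpret finite_measure \<mu> using assms by (simp add: subprob_def)
  have e: "0 \<le> e" using assms(2) norm_ge_zero order_trans by blast
  show ?thesis
  proof (cases "integrable \<mu> f")
    case True
    have "norm (\<integral>y. f y \<partial>\<mu>) \<le> (\<integral>y. norm (f y) \<partial>\<mu>)"
      by (rule integral_norm_bound)
    also have "\<dots> \<le> (\<integral>y. e \<partial>\<mu>)"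
      by (intro integral_mono integrable_norm True assms(2)) simp
    also have "\<dots> \<le> e"
      using assms(1) e mult_left_mono[of "measure \<mu> (space \<mu>)" 1 e] by (simp add: subprob_def mult.commute)
    finally show ?thesis .
  next
    \<comment> \<open>The Bochner integral of a nonintegrable function is 0 by convention.\<close>
    case False
    then show ?thesis using e by (simp add: not_integrable_integral_eq)
  qed
qed

text \<open>The measure enters only through its mass bound, so the modulus of continuity of
  \<open>k\<close> in the first argument serves all measures at once. This is the source of
  equicontinuity.\<close>

lemma ker_integral_diff_le:
  assumes "subprob \<mu>" "\<And>y. \<bar>k x y - k x' y\<bar> \<le> e"
  shows "norm ((\<integral>y. complex_of_real (k x y) * apply_bcontfun g y \<partial>\<mu>)
    - (\<integral>y. complex_of_real (k x' y) * apply_bcontfun g y \<partial>\<mu>)) \<le> e * norm g"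
proof -
  have "0 \<le> e" using assms(2) abs_ge_zero order_trans by blast
  have "norm (\<integral>y. complex_of_real (k x y) * g y - complex_of_real (k x' y) * g y \<partial>\<mu>) \<le> e * norm g"
  proof (rule norm_integral_subprob[OF assms(1)])
    fix y
    have "norm (complex_of_real (k x y - k x' y) * g y) \<le> e * norm g"
      unfolding norm_mult norm_of_real using assms(2) \<open>0 \<le> e\<close> by (intro mult_mono norm_bounded) auto
    then show "norm (complex_of_real (k x y) * g y - complex_of_real (k x' y) * g y) \<le> e * norm g"
      by (simp add: left_diff_distrib)
  qed
  then show ?thesis
    by (simp add: Bochner_Integration.integral_diff[OF integrable_ker integrable_ker] assms(1))
qed

lemma k_equicontinuous:
  assumes "e > 0"
  obtains d where "d > 0" "\<And>x x' y. dist x x' < d \<Longrightarrow> \<bar>k x y - k x' y\<bar> \<le> e"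
proof -
  obtain d where "d > 0" "\<And>x x' y y'. dist x x' < d \<Longrightarrow> dist y y' < d \<Longrightarrow> dist (k x y) (k x' y') < e"
    using uniformly_continuous_section[OF k_cont assms] by blast
  then show thesis by (intro that[of d]) (auto simp: dist_real_def intro: less_imp_le)
qed

lemma ker_op_apply:
  assumes "subprob \<mu>"
  shows "ker_op k \<mu> g x = (\<integral>y. complex_of_real (k x y) * g y \<partial>\<mu>)"
proof -
  let ?f = "\<lambda>x. \<integral>y. complex_of_real (k x y) * g y \<partial>\<mu>"
  have "continuous_on UNIV ?f"
    unfolding continuous_on_iff
  proof (intro ballI allI impI)
    fix x and e :: real assume "e > 0"
    \<comment> \<open>The summand 1 covers \<open>g = 0\<close> and makes the final estimate
      strict.\<close>
    then have e: "e / (norm g + 1) > 0"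
      by (simp add: add_nonneg_pos)
    obtain d where d: "d > 0" "\<And>x x' y. dist x x' < d \<Longrightarrow> \<bar>k x y - k x' y\<bar> \<le> e / (norm g + 1)"
      using k_equicontinuous[OF e] by blast
    have "dist (?f x') (?f x) < e" if "dist x' x < d" for x'
    proof -
      have "dist (?f x') (?f x) \<le> e / (norm g + 1) * norm g"
        unfolding dist_norm by (rule ker_integral_diff_le[OF assms d(2)[OF that]])
      also have "\<dots> < e"
        using \<open>e > 0\<close> by (simp add: add_nonneg_pos divide_less_eq)
      finally show ?thesis .
    qed
    with d(1) show "\<exists>d>0. \<forall>x'\<in>UNIV. dist x' x < d \<longrightarrow> dist (?f x') (?f x) < e" by blast
  qed
  then show ?thesis
    by (simp add: ker_op_def Bcontfun_inverse continuous_in_bcontfun compact)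
qed

lemma norm_ker_op_le:
  assumes "subprob \<mu>" shows "norm (ker_op k \<mu> g) \<le> kmax * norm g"
  by (rule norm_bound) (simp add: ker_op_apply assms norm_integral_subprob norm_ker_le)

lemma ker_op_diff:
  assumes "subprob \<mu>" shows "ker_op k \<mu> (g - h) = ker_op k \<mu> g - ker_op k \<mu> h"
  by (rule bcontfun_eqI)
    (simp add: ker_op_apply assms right_diff_distrib
      Bochner_Integration.integral_diff[OF integrable_ker integrable_ker])

lemma deg_apply:
  assumes "subprob \<mu>" shows "deg k \<mu> x = complex_of_real (degree_fun k \<mu> x)"
  by (simp add: ker_op_apply assms degree_fun_def integral_complex_of_real)

lemma laplace_apply:
  assumes "subprob \<mu>" shows "laplace_op k \<mu> g x = deg k \<mu> x * g x - ker_op k \<mu> g x"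
  unfolding deg_apply[OF assms] unfolding ker_op_apply[OF assms]
  using assms by (intro laplace_op_apply[OF compact k_cont]) (simp_all add: subprob_def)

lemma clinear_laplace:
  assumes "subprob \<mu>" shows "clinear_op (laplace_op k \<mu>)"
  unfolding clinear_op_def
proof (intro allI bcontfun_eqI)
  fix c :: complex and g :: "'a \<Rightarrow>\<^sub>C complex" and x
  have "(\<integral>y. complex_of_real (k x y) * (c * g y) \<partial>\<mu>) = c * (\<integral>y. complex_of_real (k x y) * g y \<partial>\<mu>)"
    by (simp add: mult.left_commute)
  then show "laplace_op k \<mu> (cmult c g) x = cmult c (laplace_op k \<mu> g) x"
    by (simp add: laplace_apply assms cmult_apply ker_op_apply algebra_simps)
qed

lemma norm_laplace_le:
  assumes "subprob \<mu>" shows "norm (laplace_op k \<mu> g) \<le> 2 * kmax * norm g"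
proof (rule norm_bound)
  fix x
  have n1: "norm (const_bcontfun 1 :: 'a \<Rightarrow>\<^sub>C complex) \<le> 1" by (rule norm_bound) simp
  have "norm (deg k \<mu> x) \<le> kmax"
    using norm_bounded[of "deg k \<mu>" x] norm_ker_op_le[OF assms, of "const_bcontfun 1"]
      mult_left_mono[OF n1, of kmax] kmax(1) by linarith
  then have "norm (deg k \<mu> x * g x) \<le> kmax * norm g"
    unfolding norm_mult using kmax(1) by (intro mult_mono norm_bounded) auto
  moreover have "norm (ker_op k \<mu> g x) \<le> kmax * norm g"
    using norm_bounded norm_ker_op_le[OF assms] order_trans by blast
  ultimately show "norm (laplace_op k \<mu> g x) \<le> 2 * kmax * norm g"
    unfolding laplace_apply[OF assms]
    using norm_triangle_ineq4[of "deg k \<mu> x * g x" "ker_op k \<mu> g x"] by linarith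
qed

text \<open>The common bound \<open>kmax\<close> allows the argument to vary along with the
  operator.\<close>

lemma ker_op_tendsto:
  assumes \<mu>: "\<And>j. subprob (\<mu> j)" and conv: "\<And>g. (\<lambda>j. ker_op k (\<mu> j) g) \<longlonglongrightarrow> ker_op k \<mu>0 g"
    and g: "g \<longlonglongrightarrow> g0"
  shows "(\<lambda>j. ker_op k (\<mu> j) (g j)) \<longlonglongrightarrow> ker_op k \<mu>0 g0"
proof -
  have "(\<lambda>j. ker_op k (\<mu> j) (g j - g0)) \<longlonglongrightarrow> 0"
  proof (rule Lim_null_comparison)
    show "\<forall>\<^sub>F j in sequentially. norm (ker_op k (\<mu> j) (g j - g0)) \<le> kmax * norm (g j - g0)"
      using norm_ker_op_le[OF \<mu>] by simp
    show "(\<lambda>j. kmax * norm (g j - g0)) \<longlonglongrightarrow> 0"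
      using g by (auto intro!: tendsto_eq_intros simp: LIM_zero_iff tendsto_norm_zero_iff)
  qed
  from tendsto_add[OF this conv[of g0]] show ?thesis
    by (simp add: ker_op_diff[OF \<mu>])
qed

text \<open>
  The kernel operators are collectively compact: the functions \<open>ker_op k (\<mu> j) (g j)\<close> are
  equicontinuous, and away from the range of the degree function an approximate eigenfunction
  is recovered from its image under the kernel operator.
\<close>

lemma approximate_eigenfunctions_converge:
  assumes \<mu>: "\<And>j. subprob (\<mu> j)" and \<mu>0: "subprob \<mu>0"
    and conv: "\<And>g. (\<lambda>j. ker_op k (\<mu> j) g) \<longlonglongrightarrow> ker_op k \<mu>0 g"
    and z: "\<zeta> \<longlonglongrightarrow> \<zeta>0" and range: "\<zeta>0 \<notin> complex_of_real ` range (degree_fun k \<mu>0)"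
    and bound: "\<And>j. norm (g j) \<le> B"
    and approx: "(\<lambda>j. laplace_op k (\<mu> j) (g j) - cmult (\<zeta> j) (g j)) \<longlonglongrightarrow> 0"
  obtains s g0 where "strict_mono (s :: nat \<Rightarrow> nat)" "(\<lambda>j. g (s j)) \<longlonglongrightarrow> g0"
    "laplace_op k \<mu>0 g0 = cmult \<zeta>0 g0"
proof -
  define t where "t j = ker_op k (\<mu> j) (g j)" for j
  \<comment> \<open>The multiplier of \<open>laplace_op k \<mu>0 - cmult \<zeta>0\<close>; the
    eigenvalue equation for \<open>g0\<close> says that \<open>m\<close> times \<open>g0\<close> is
    the kernel image of \<open>g0\<close>.\<close>
  define m where "m x = deg k \<mu>0 x - \<zeta>0" for x
  have B: "0 \<le> B" using bound[of 0] norm_ge_zero order_trans by blast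
  obtain s h where s: "strict_mono (s :: nat \<Rightarrow> nat)" and h: "(\<lambda>j. t (s j)) \<longlonglongrightarrow> h"
  proof (rule bcontfun_Arzela_Ascoli[OF compact, of t "kmax * B"])
    show "norm (t n) \<le> kmax * B" for n
      unfolding t_def
      by (rule order_trans[OF norm_ker_op_le[OF \<mu>] mult_left_mono[OF bound]]) (use kmax(1) in simp)
    fix e :: real assume "e > 0"
    then have e: "e / (B + 1) > 0" using B by simp
    obtain d where d: "d > 0" "\<And>x x' y. dist x x' < d \<Longrightarrow> \<bar>k x y - k x' y\<bar> \<le> e / (B + 1)"
      using k_equicontinuous[OF e] by blast
    have "norm (t n x - t n y) < e" if "dist x y < d" for n x y
    proof -
      have "norm (t n x - t n y) \<le> e / (B + 1) * norm (g n)"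
        unfolding t_def ker_op_apply[OF \<mu>] by (rule ker_integral_diff_le[OF \<mu> d(2)[OF that]])
      also have "\<dots> \<le> e / (B + 1) * B"
        using bound e by (intro mult_left_mono) auto
      also have "\<dots> < e"
        using \<open>e > 0\<close> B by (simp add: divide_less_eq)
      finally show ?thesis .
    qed
    with d(1) show "\<exists>d>0. \<forall>n x y. dist x y < d \<longrightarrow> norm (t n x - t n y) < e" by blast
  qed
  have m_cont: "continuous_on UNIV m"
    unfolding m_def by (intro continuous_intros) auto
  \<comment> \<open>The range hypothesis enters here: on a compact space a continuous multiplier
    without zeros is bounded away from 0.\<close>
  have "closed (range m)"
    by (rule compact_imp_closed[OF compact_continuous_image[OF m_cont compact]])
  moreover have "0 \<notin> range m"
    using range by (auto simp: m_def deg_apply[OF \<mu>0])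
  ultimately obtain \<delta> where \<delta>: "\<delta> > 0" "\<And>x. \<delta> \<le> norm (m x)"
    using separate_point_closed[of "range m" 0] by auto
  then have m0: "m x \<noteq> 0" for x by (metis norm_zero not_le)
  \<comment> \<open>The only possible limit: up to errors \<open>m x * g j x\<close> is
    \<open>t j x\<close>, and \<open>t\<close> converges to \<open>h\<close> along
    \<open>s\<close>.\<close>
  define g0 where "g0 = Bcontfun (\<lambda>x. h x / m x)"
  have g0: "g0 x = h x / m x" for x
  proof -
    have "continuous_on UNIV (\<lambda>x. h x / m x)"
      using m0 m_cont by (intro continuous_intros) auto
    then show ?thesis
      by (simp add: g0_def Bcontfun_inverse continuous_in_bcontfun compact)
  qed
  \<comment> \<open>Collects the defect of the approximate equation and the cost of replacing the
    degree function and the parameter by their limits.\<close>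
  define \<epsilon> where "\<epsilon> j = norm (laplace_op k (\<mu> j) (g j) - cmult (\<zeta> j) (g j)) +
    (norm (deg k (\<mu> j) - deg k \<mu>0) + norm (\<zeta> j - \<zeta>0)) * B" for j
  have eps: "norm (m x * g j x - t j x) \<le> \<epsilon> j" for j x
  proof -
    let ?a = "(laplace_op k (\<mu> j) (g j) - cmult (\<zeta> j) (g j)) x"
    let ?b = "(deg k (\<mu> j) - deg k \<mu>0) x"
    have eq: "m x * g j x - t j x = ?a - (?b - (\<zeta> j - \<zeta>0)) * g j x"
      by (simp add: laplace_apply[OF \<mu>] cmult_apply m_def t_def algebra_simps)
    have "norm ((?b - (\<zeta> j - \<zeta>0)) * g j x)
        \<le> (norm (deg k (\<mu> j) - deg k \<mu>0) + norm (\<zeta> j - \<zeta>0)) * B"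
      unfolding norm_mult
    proof (rule mult_mono)
      show "norm (?b - (\<zeta> j - \<zeta>0)) \<le> norm (deg k (\<mu> j) - deg k \<mu>0) + norm (\<zeta> j - \<zeta>0)"
        using norm_triangle_ineq4[of ?b "\<zeta> j - \<zeta>0"] norm_bounded[of "deg k (\<mu> j) - deg k \<mu>0" x]
        by linarith
      show "norm (g j x) \<le> B" using norm_bounded[of "g j" x] bound[of j] by linarith
    qed auto
    then show ?thesis
      unfolding eq \<epsilon>_def using norm_triangle_ineq4[of ?a "(?b - (\<zeta> j - \<zeta>0)) * g j x"]
        norm_bounded[of "laplace_op k (\<mu> j) (g j) - cmult (\<zeta> j) (g j)" x] by linarith
  qed
  have "\<epsilon> \<longlonglongrightarrow> 0"
    unfolding \<epsilon>_def
    using tendsto_add[OF tendsto_norm_zero[OF approx] tendsto_mult[OF tendsto_add[OF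
          tendsto_norm_zero[OF LIM_zero[OF conv[of "const_bcontfun 1"]]]
          tendsto_norm_zero[OF LIM_zero[OF z]]] tendsto_const[of B]]]
    by simp
  then have eps0: "(\<lambda>j. \<epsilon> (s j)) \<longlonglongrightarrow> 0"
    using s by (rule LIMSEQ_subseq_LIMSEQ[unfolded comp_def])
  have lim: "(\<lambda>j. g (s j)) \<longlonglongrightarrow> g0"
  proof (rule LIM_zero_cancel, rule Lim_null_comparison)
    show "\<forall>\<^sub>F j in sequentially. norm (g (s j) - g0) \<le> (\<epsilon> (s j) + norm (t (s j) - h)) / \<delta>"
    proof (rule always_eventually, rule allI, rule norm_bound)
      fix j x
      have "norm (m x * g (s j) x - h x) \<le> \<epsilon> (s j) + norm (t (s j) - h)"
        using norm_triangle_ineq[of "m x * g (s j) x - t (s j) x" "(t (s j) - h) x"]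
          norm_bounded[of "t (s j) - h" x] eps[of x "s j"] by simp
      moreover have "\<delta> * norm ((g (s j) - g0) x) \<le> norm (m x * g (s j) x - h x)"
      proof -
        have "m x * g (s j) x - h x = m x * (g (s j) - g0) x"
          using m0[of x] by (simp add: g0 algebra_simps)
        then show ?thesis by (simp only: norm_mult) (intro mult_right_mono \<delta>, simp)
      qed
      ultimately show "norm ((g (s j) - g0) x) \<le> (\<epsilon> (s j) + norm (t (s j) - h)) / \<delta>"
        using \<delta>(1) by (simp add: field_simps)
    qed
    have "(\<lambda>j. norm (t (s j) - h)) \<longlonglongrightarrow> 0"
      using h by (simp add: tendsto_norm_zero_iff LIM_zero_iff)
    from tendsto_divide[OF tendsto_add[OF eps0 this] tendsto_const[of \<delta>]]
    show "(\<lambda>j. (\<epsilon> (s j) + norm (t (s j) - h)) / \<delta>) \<longlonglongrightarrow> 0"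
      using \<delta>(1) by simp
  qed
  \<comment> \<open>Now that \<open>g\<close> converges along \<open>s\<close>, the limit
    \<open>h\<close> can be identified as the kernel image of \<open>g0\<close>.\<close>
  have "(\<lambda>j. t (s j)) \<longlonglongrightarrow> ker_op k \<mu>0 g0"
    unfolding t_def
    by (rule ker_op_tendsto[OF \<mu> _ lim])
      (rule LIMSEQ_subseq_LIMSEQ[OF conv s, unfolded comp_def])
  then have "ker_op k \<mu>0 g0 = h"
    using h LIMSEQ_unique by blast
  then have "laplace_op k \<mu>0 g0 x = cmult \<zeta>0 g0 x" for x
  proof -
    assume H: "ker_op k \<mu>0 g0 = h"
    have "m x * g0 x = h x" using m0 by (simp add: g0)
    then show ?thesis
      by (simp add: laplace_apply[OF \<mu>0] cmult_apply H m_def algebra_simps)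
  qed
  with s lim show thesis by (intro that) (auto intro: bcontfun_eqI)
qed

end

section \<open>Lower bounds and empirical measures\<close>

context kernel_space begin

text \<open>On \<open>K\<close> only eigenvalues of the limit operator have to be excluded.
  Otherwise \<open>c = 1 / Suc j\<close> and \<open>N = j\<close> fail for every \<open>j\<close>,
  and normalized counterexamples converge to an eigenfunction of norm 1.\<close>

lemma eventually_lower_bound_compact:
  assumes \<mu>: "\<And>j. subprob (\<mu> j)" and \<mu>0: "subprob \<mu>0"
    and conv: "\<And>g. (\<lambda>j. ker_op k (\<mu> j) g) \<longlonglongrightarrow> ker_op k \<mu>0 g"
    and K: "compact K" and range: "K \<inter> complex_of_real ` range (degree_fun k \<mu>0) = {}"
    and no_eigenvalue: "\<And>\<zeta>. \<zeta> \<in> K \<Longrightarrow> \<not> op_eigenvalue (laplace_op k \<mu>0) \<zeta>"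
  obtains c N where "c > 0"
    "\<And>n \<zeta> g. n \<ge> N \<Longrightarrow> \<zeta> \<in> K \<Longrightarrow> c * norm g \<le> norm (laplace_op k (\<mu> n) g - cmult \<zeta> g)"
proof (rule ccontr)
  assume contr: "\<not> thesis"
  have "\<exists>n \<zeta> g. n \<ge> j \<and> \<zeta> \<in> K \<and> norm g = 1 \<and>
      norm (laplace_op k (\<mu> n) g - cmult \<zeta> g) < 1 / real (Suc j)" for j
  proof -
    have "\<not> (\<forall>n \<zeta> g. n \<ge> j \<longrightarrow> \<zeta> \<in> K \<longrightarrow>
        1 / real (Suc j) * norm g \<le> norm (laplace_op k (\<mu> n) g - cmult \<zeta> g))"
    proof
      assume H: "\<forall>n \<zeta> g. n \<ge> j \<longrightarrow> \<zeta> \<in> K \<longrightarrow>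
        1 / real (Suc j) * norm g \<le> norm (laplace_op k (\<mu> n) g - cmult \<zeta> g)"
      have thesis
        by (rule that[where c = "1 / real (Suc j)" and N = j, OF _ H[rule_format]]) simp_all
      with contr show False ..
    qed
    then obtain n \<zeta> g where *: "n \<ge> j" "\<zeta> \<in> K"
      "norm (laplace_op k (\<mu> n) g - cmult \<zeta> g) < 1 / real (Suc j) * norm g"
      by (auto simp only: not_all not_imp not_le)
    have "g \<noteq> 0" using *(3) by (intro notI) simp
    then have g: "norm g > 0" by simp
    let ?g = "(1 / norm g) *\<^sub>R g"
    have unit: "norm ?g = 1" using g by simp
    have eq: "laplace_op k (\<mu> n) ?g - cmult \<zeta> ?g
        = (1 / norm g) *\<^sub>R (laplace_op k (\<mu> n) g - cmult \<zeta> g)"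
      by (simp add: blinfun.scaleR_right scaleR_diff_right)
    have "norm (laplace_op k (\<mu> n) ?g - cmult \<zeta> ?g)
        = norm (laplace_op k (\<mu> n) g - cmult \<zeta> g) / norm g"
      unfolding eq by simp
    also have "\<dots> < 1 / real (Suc j)"
      using *(3) g by (simp only: pos_divide_less_eq)
    finally have "norm (laplace_op k (\<mu> n) ?g - cmult \<zeta> ?g) < 1 / real (Suc j)" .
    with * unit show ?thesis by blast
  qed
  then obtain n \<zeta> g where n: "\<And>j. n j \<ge> j" and z: "\<And>j. \<zeta> j \<in> K" and g: "\<And>j. norm (g j) = 1"
    and small: "\<And>j. norm (laplace_op k (\<mu> (n j)) (g j) - cmult (\<zeta> j) (g j)) < 1 / real (Suc j)"
    by metis
  obtain \<zeta>0 r where z0: "\<zeta>0 \<in> K" and r: "strict_mono (r :: nat \<Rightarrow> nat)" and lim: "(\<lambda>j. \<zeta> (r j)) \<longlonglongrightarrow> \<zeta>0"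
    using K z unfolding compact_def comp_def by metis
  \<comment> \<open>The indices \<open>n j\<close> were picked one by one and need not increase; the
    convergence assumption only asks that they tend to infinity.\<close>
  have nr: "filterlim (\<lambda>j. n (r j)) at_top sequentially"
    by (rule filterlim_at_top_mono[OF filterlim_subseq[OF r]]) (use n in simp)
  have "(\<lambda>j. laplace_op k (\<mu> (n j)) (g j) - cmult (\<zeta> j) (g j)) \<longlonglongrightarrow> 0"
    by (rule Lim_null_comparison[OF _ LIMSEQ_inverse_real_of_nat])
      (use less_imp_le[OF small] in \<open>simp add: inverse_eq_divide\<close>)
  from LIMSEQ_subseq_LIMSEQ[OF this r]
  have approx: "(\<lambda>j. laplace_op k (\<mu> (n (r j))) (g (r j)) - cmult (\<zeta> (r j)) (g (r j))) \<longlonglongrightarrow> 0"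
    by (simp add: comp_def)
  obtain s g0 where s: "strict_mono (s :: nat \<Rightarrow> nat)" and g0: "(\<lambda>j. g (r (s j))) \<longlonglongrightarrow> g0"
    and eig: "laplace_op k \<mu>0 g0 = cmult \<zeta>0 g0"
    by (rule approximate_eigenfunctions_converge[of "\<lambda>j. \<mu> (n (r j))" \<mu>0 "\<lambda>j. \<zeta> (r j)" \<zeta>0 "\<lambda>j. g (r j)" 1])
      (use \<mu> \<mu>0 filterlim_compose[OF conv nr] lim range z0 g approx in auto)
  have "norm g0 = 1"
    using tendsto_norm[OF g0] g by (simp add: LIMSEQ_const_iff)
  with eig have "op_eigenvalue (laplace_op k \<mu>0) \<zeta>0"
    unfolding op_eigenvalue_def op_eigenfunction_def by (intro exI[of _ g0]) auto
  with no_eigenvalue[OF z0] show False by blast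
qed

text \<open>All operators have norm at most \<open>2 * kmax\<close>, so parameters of modulus above
  \<open>2 * kmax + 1\<close> satisfy the bound with constant 1. The remaining part of
  \<open>K\<close> is compact.\<close>

lemma eventually_lower_bound:
  assumes \<mu>: "\<And>j. subprob (\<mu> j)" and \<mu>0: "subprob \<mu>0"
    and conv: "\<And>g. (\<lambda>j. ker_op k (\<mu> j) g) \<longlonglongrightarrow> ker_op k \<mu>0 g"
    and K: "closed K" and range: "K \<inter> complex_of_real ` range (degree_fun k \<mu>0) = {}"
    and no_eigenvalue: "\<And>\<zeta>. \<zeta> \<in> K \<Longrightarrow> \<not> op_eigenvalue (laplace_op k \<mu>0) \<zeta>"
  obtains c N where "c > 0"
    "\<And>n \<zeta> g. n \<ge> N \<Longrightarrow> \<zeta> \<in> K \<Longrightarrow> c * norm g \<le> norm (laplace_op k (\<mu> n) g - cmult \<zeta> g)"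
proof -
  have "compact (K \<inter> cball 0 (2 * kmax + 1))"
    using K by (simp add: closed_Int_compact)
  then obtain c N where c: "c > 0" and lower: "\<And>n \<zeta> g. n \<ge> N \<Longrightarrow> \<zeta> \<in> K \<inter> cball 0 (2 * kmax + 1) \<Longrightarrow>
      c * norm g \<le> norm (laplace_op k (\<mu> n) g - cmult \<zeta> g)"
    by (rule eventually_lower_bound_compact[OF \<mu> \<mu>0 conv]) (use range no_eigenvalue in auto)
  have "min c 1 * norm g \<le> norm (laplace_op k (\<mu> n) g - cmult \<zeta> g)" if "n \<ge> N" "\<zeta> \<in> K" for n \<zeta> g
  proof (cases "norm \<zeta> \<le> 2 * kmax + 1")
    case True
    have "min c 1 * norm g \<le> c * norm g" by (intro mult_right_mono) auto
    then show ?thesis using lower[of n \<zeta> g] that True by simp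
  next
    case False
    have "min c 1 * norm g \<le> 1 * norm g" by (intro mult_right_mono) auto
    also have "\<dots> \<le> (norm \<zeta> - 2 * kmax) * norm g" using False by (intro mult_right_mono) auto
    also have "\<dots> \<le> norm (cmult \<zeta> g) - norm (laplace_op k (\<mu> n) g)"
      using norm_laplace_le[OF \<mu>, of n g] by (simp add: norm_cmult algebra_simps)
    also have "\<dots> \<le> norm (laplace_op k (\<mu> n) g - cmult \<zeta> g)"
      by (metis norm_minus_commute norm_triangle_ineq2)
    finally show ?thesis .
  qed
  with c show thesis by (intro that[where c = "min c 1" and N = N]) auto
qed

text \<open>Uniform convergence costs half of the distance between \<open>K\<close> and the compact
  range. The margin, independent of \<open>n\<close>, later bounds the eigenfunctions.\<close>

lemma eventually_separated_degree_range:
  assumes \<mu>0: "subprob \<mu>0"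
    and conv: "\<And>g. (\<lambda>j. ker_op k (\<mu> j) g) \<longlonglongrightarrow> ker_op k \<mu>0 g"
    and K: "closed K" and range: "K \<inter> complex_of_real ` range (degree_fun k \<mu>0) = {}"
  obtains \<delta> where "\<delta> > 0"
    "\<forall>\<^sub>F n in sequentially. \<forall>\<zeta>\<in>K. \<forall>x. \<delta> \<le> dist (deg k (\<mu> n) x) \<zeta>"
proof -
  have rg: "complex_of_real ` range (degree_fun k \<mu>0) = range (deg k \<mu>0)"
    by (simp add: image_image deg_apply[OF \<mu>0])
  have "compact (range (deg k \<mu>0))"
    by (intro compact_continuous_image compact) simp
  then have "\<exists>d>0. \<forall>x\<in>range (deg k \<mu>0). \<forall>y\<in>K. d \<le> dist x y"
    by (rule separate_compact_closed) (use K range rg in auto)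
  then obtain d where d: "d > 0" "\<And>x \<zeta>. \<zeta> \<in> K \<Longrightarrow> d \<le> dist (deg k \<mu>0 x) \<zeta>"
    by auto
  have "\<forall>\<^sub>F n in sequentially. dist (deg k (\<mu> n)) (deg k \<mu>0) < d / 2"
    using conv by (rule tendstoD) (use d(1) in simp)
  then have "\<forall>\<^sub>F n in sequentially. \<forall>\<zeta>\<in>K. \<forall>x. d / 2 \<le> dist (deg k (\<mu> n) x) \<zeta>"
  proof eventually_elim
    case (elim n)
    have "d / 2 \<le> dist (deg k (\<mu> n) x) \<zeta>" if "\<zeta> \<in> K" for \<zeta> x
      using d(2)[OF that, of x] elim dist_bounded[of "deg k (\<mu> n)" x "deg k \<mu>0"]
        dist_triangle2[of "deg k \<mu>0 x" \<zeta> "deg k (\<mu> n) x"]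
      by (simp add: dist_commute)
    then show ?case by blast
  qed
  with d(1) show thesis by (intro that[of "d / 2"]) auto
qed

end

section \<open>Empirical measures and the reduction to the matrix\<close>

lemma measurable_uniform_count_measure_lessThan [measurable]:
  "xs \<in> uniform_count_measure {..<n} \<rightarrow>\<^sub>M borel"
  by (simp add: measurable_def sets_uniform_count_measure space_uniform_count_measure)

lemma subprob_empirical: "subprob (empirical_measure n xs)"
  unfolding subprob_def
proof (intro conjI)
  have fin: "finite_measure (uniform_count_measure {..<n})"
    by (rule finite_measureI) (simp add: emeasure_uniform_count_measure_if space_uniform_count_measure)
  show "finite_measure (empirical_measure n xs)"
    unfolding empirical_measure_def by (rule finite_measure.finite_measure_distr[OF fin]) simp
  show "sets (empirical_measure n xs) = sets borel"
    by (simp add: empirical_measure_def)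
  show "measure (empirical_measure n xs) (space (empirical_measure n xs)) \<le> 1"
    by (simp add: empirical_measure_def measure_distr measure_uniform_count_measure_if
        space_uniform_count_measure)
qed

lemma integral_empirical:
  fixes f :: "'a::topological_space \<Rightarrow> 'b::{banach, second_countable_topology}"
  assumes "f \<in> borel_measurable borel"
  shows "(\<integral>y. f y \<partial>empirical_measure n xs) = (1 / real n) *\<^sub>R (\<Sum>i<n. f (xs i))"
proof -
  have "(\<integral>y. f y \<partial>empirical_measure n xs) = (\<integral>i. f (xs i) \<partial>uniform_count_measure {..<n})"
    unfolding empirical_measure_def by (rule integral_distr) (use assms in simp_all)
  then show ?thesis
    by (simp add: uniform_count_measure_def lebesgue_integral_point_measure_finite scaleR_sum_right)
qed

lemma scaled_laplace_mat_carrier: "scaled_laplace_mat k n xs \<in> carrier_mat n n"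
  by (rule carrier_matI)
    (simp_all add: scaled_laplace_mat_def laplace_mat_def degree_mat_def similarity_mat_def)

context kernel_space begin

lemma ker_op_empirical:
  "ker_op k (empirical_measure n xs) g x = (\<Sum>i<n. complex_of_real (k x (xs i)) * g (xs i)) / n"
  unfolding ker_op_apply[OF subprob_empirical]
  by (subst integral_empirical) (simp_all add: measurable_ker scaleR_conv_of_real)

lemma deg_empirical:
  "deg k (empirical_measure n xs) x = (\<Sum>i<n. complex_of_real (k x (xs i))) / n"
  by (simp add: ker_op_empirical)

text \<open>Row \<open>i\<close> acts as \<open>U_n\<close> at the sample point \<open>xs i\<close>.
  The weights depend on the index and not on the point, since sample points may coincide.\<close>

lemma scaled_laplace_mat_mult_vec:
  assumes "i < n"
  shows "(scaled_laplace_mat k n xs *\<^sub>v vec n w) $ i =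
    deg k (empirical_measure n xs) (xs i) * w i - (\<Sum>j<n. complex_of_real (k (xs i) (xs j)) * w j) / n"
proof -
  have entry: "scaled_laplace_mat k n xs $$ (i, j) =
      (if i = j then (\<Sum>m<n. complex_of_real (k (xs i) (xs m))) / n else 0) -
        complex_of_real (k (xs i) (xs j)) / n" if "j < n" for j
    using assms that
    by (simp add: scaled_laplace_mat_def laplace_mat_def degree_mat_def similarity_mat_def diff_divide_distrib)
  have "(scaled_laplace_mat k n xs *\<^sub>v vec n w) $ i = (\<Sum>j<n. scaled_laplace_mat k n xs $$ (i, j) * w j)"
    using assms scaled_laplace_mat_carrier[of k n xs]
    by (simp add: scalar_prod_def atLeast0LessThan)
  also have "\<dots> = (\<Sum>j<n. (if i = j then (\<Sum>m<n. complex_of_real (k (xs i) (xs m))) / n * w j else 0) -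
        complex_of_real (k (xs i) (xs j)) / n * w j)"
    by (intro sum.cong) (auto simp: entry left_diff_distrib)
  also have "\<dots> = (\<Sum>m<n. complex_of_real (k (xs i) (xs m))) / n * w i -
      (\<Sum>j<n. complex_of_real (k (xs i) (xs j)) / n * w j)"
    using assms by (simp add: sum_subtractf)
  finally show ?thesis
    by (simp add: deg_empirical sum_divide_distrib)
qed

lemma eigenvector_empirical:
  assumes "eigenvector (scaled_laplace_mat k n xs) (vec n w) \<zeta>"
  shows "\<exists>i<n. w i \<noteq> 0"
    and "\<And>i. i < n \<Longrightarrow> deg k (empirical_measure n xs) (xs i) * w i -
      (\<Sum>j<n. complex_of_real (k (xs i) (xs j)) * w j) / n = \<zeta> * w i"
proof -
  have dim: "dim_row (scaled_laplace_mat k n xs) = n"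
    using scaled_laplace_mat_carrier[of k n xs] by simp
  show "\<exists>i<n. w i \<noteq> 0"
    using assms unfolding eigenvector_def dim by (metis eq_vecI dim_vec index_vec index_zero_vec)
  fix i assume "i < n"
  then show "deg k (empirical_measure n xs) (xs i) * w i -
      (\<Sum>j<n. complex_of_real (k (xs i) (xs j)) * w j) / n = \<zeta> * w i"
    using assms unfolding eigenvector_def scaled_laplace_mat_mult_vec[OF \<open>i < n\<close>, symmetric]
    by simp
qed

text \<open>Dividing by \<open>deg - \<zeta>\<close> extends a vector to a function on the whole
  space, and the linear system says exactly that the extension agrees with the vector at the sample
  points. The case \<open>h = 0\<close> gives eigenfunctions, general \<open>h\<close>
  surjectivity.\<close>

lemma laplace_empirical_solution:
  fixes h :: "'a \<Rightarrow>\<^sub>C complex"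
  assumes range: "\<zeta> \<notin> complex_of_real ` range (degree_fun k (empirical_measure n xs))"
    and w: "\<And>i. i < n \<Longrightarrow> deg k (empirical_measure n xs) (xs i) * w i -
      (\<Sum>j<n. complex_of_real (k (xs i) (xs j)) * w j) / n = \<zeta> * w i + h (xs i)"
  obtains g :: "'a \<Rightarrow>\<^sub>C complex" where "\<And>i. i < n \<Longrightarrow> g (xs i) = w i"
    "laplace_op k (empirical_measure n xs) g - cmult \<zeta> g = h"
    "\<And>x. g x = (h x + (\<Sum>j<n. complex_of_real (k x (xs j)) * w j) / n) /
        (deg k (empirical_measure n xs) x - \<zeta>)"
proof -
  let ?\<mu> = "empirical_measure n xs"
  define f where "f x = (h x + (\<Sum>j<n. complex_of_real (k x (xs j)) * w j) / n) / (deg k ?\<mu> x - \<zeta>)" for x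
  have nz: "deg k ?\<mu> x - \<zeta> \<noteq> 0" for x
    using range by (auto simp: deg_apply[OF subprob_empirical])
  have kx: "continuous_on UNIV (\<lambda>x. k x y)" for y
    using continuous_on_compose2[OF k_cont, of UNIV "\<lambda>x. (x, y)"]
    by (simp add: continuous_on_Pair)
  have "continuous_on UNIV f"
    \<comment> \<open>For \<open>n = 0\<close> the division by \<open>n\<close> yields 0, so the
      quotient rule for continuity is used for positive \<open>n\<close> only.\<close>
    unfolding f_def using nz by (cases "n = 0") (auto intro!: continuous_intros kx)
  then have f: "Bcontfun f x = f x" for x
    by (simp add: Bcontfun_inverse continuous_in_bcontfun compact)
  \<comment> \<open>The system determines \<open>w i\<close> from the point \<open>xs i\<close>, so
    coinciding sample points cause no conflict.\<close>
  have fw: "f (xs i) = w i" if "i < n" for i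
    using w[OF that] nz[of "xs i"] by (simp add: f_def field_simps)
  show thesis
  proof (rule that)
    show "Bcontfun f (xs i) = w i" if "i < n" for i
      using fw[OF that] by (simp add: f)
    show "laplace_op k ?\<mu> (Bcontfun f) - cmult \<zeta> (Bcontfun f) = h"
    proof (rule bcontfun_eqI)
      fix x
      have "(\<Sum>i<n. complex_of_real (k x (xs i)) * f (xs i)) = (\<Sum>i<n. complex_of_real (k x (xs i)) * w i)"
        using fw by (intro sum.cong) auto
      moreover have "(deg k ?\<mu> x - \<zeta>) * f x = h x + (\<Sum>j<n. complex_of_real (k x (xs j)) * w j) / n"
        using nz[of x] by (simp add: f_def)
      ultimately show "(laplace_op k ?\<mu> (Bcontfun f) - cmult \<zeta> (Bcontfun f)) x = h x"
        by (simp add: laplace_apply[OF subprob_empirical] cmult_apply f ker_op_empirical[of _ _ "Bcontfun f"] algebra_simps)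
    qed
  qed (simp add: f f_def)
qed

text \<open>The sample values determine the eigenfunction. Hence they cannot all vanish, and
  uniqueness and real values can be checked on the sample.\<close>

lemma eigenfunction_empirical_formula:
  fixes g :: "'a \<Rightarrow>\<^sub>C complex"
  assumes range: "\<zeta> \<notin> complex_of_real ` range (degree_fun k (empirical_measure n xs))"
    and g: "laplace_op k (empirical_measure n xs) g = cmult \<zeta> g"
  shows "g x = (\<Sum>j<n. complex_of_real (k x (xs j)) * g (xs j)) / n /
      (deg k (empirical_measure n xs) x - \<zeta>)"
proof -
  have "deg k (empirical_measure n xs) x - \<zeta> \<noteq> 0"
    using range by (auto simp: deg_apply[OF subprob_empirical])
  moreover have "laplace_op k (empirical_measure n xs) g x = cmult \<zeta> g x" using g by simp
  then have "(deg k (empirical_measure n xs) x - \<zeta>) * g x =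
      (\<Sum>j<n. complex_of_real (k x (xs j)) * g (xs j)) / n"
    by (simp add: laplace_apply[OF subprob_empirical] cmult_apply ker_op_empirical[of _ _ g] algebra_simps)
  ultimately show ?thesis by (metis nonzero_mult_div_cancel_left)
qed

text \<open>
  The finite-dimensional Fredholm alternative: off the range of the degree function the resolvent
  equation reduces to a linear system for the values at the sample points.
\<close>

lemma op_spectrum_empirical:
  assumes range: "\<zeta> \<notin> complex_of_real ` range (degree_fun k (empirical_measure n xs))"
    and spec: "\<zeta> \<notin> spectrum (scaled_laplace_mat k n xs)"
  shows "\<zeta> \<notin> op_spectrum (laplace_op k (empirical_measure n xs))"
proof -
  let ?\<mu> = "empirical_measure n xs" and ?A = "scaled_laplace_mat k n xs"
  have cA: "?A \<in> carrier_mat n n" by (rule scaled_laplace_mat_carrier)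
  then have cC: "char_matrix ?A \<zeta> \<in> carrier_mat n n" by simp
  have det: "det (char_matrix ?A \<zeta>) \<noteq> 0"
    using spec eigenvalue_det[OF cA] by (simp add: spectrum_def)
  have not_eigenvalue: "\<not> op_eigenvalue (laplace_op k ?\<mu>) \<zeta>"
  proof
    assume "op_eigenvalue (laplace_op k ?\<mu>) \<zeta>"
    then obtain g where g0: "g \<noteq> 0" and g: "laplace_op k ?\<mu> g = cmult \<zeta> g"
      by (auto simp: op_eigenvalue_def op_eigenfunction_def)
    have "vec n (\<lambda>i. g (xs i)) \<noteq> 0\<^sub>v n"
    proof
      assume "vec n (\<lambda>i. g (xs i)) = 0\<^sub>v n"
      then have "g (xs i) = 0" if "i < n" for i
        using that by (metis index_vec index_zero_vec(1))
      then have "g x = 0" for x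
        using eigenfunction_empirical_formula[OF range g, of x] by simp
      with g0 show False by (auto intro: bcontfun_eqI)
    qed
    moreover have "?A *\<^sub>v vec n (\<lambda>i. g (xs i)) = \<zeta> \<cdot>\<^sub>v vec n (\<lambda>i. g (xs i))"
    proof (rule eq_vecI)
      fix i assume "i < dim_vec (\<zeta> \<cdot>\<^sub>v vec n (\<lambda>i. g (xs i)))"
      then have i: "i < n" by simp
      have "laplace_op k ?\<mu> g (xs i) = cmult \<zeta> g (xs i)" using g by simp
      then show "(?A *\<^sub>v vec n (\<lambda>i. g (xs i))) $ i = (\<zeta> \<cdot>\<^sub>v vec n (\<lambda>i. g (xs i))) $ i"
        using i unfolding scaled_laplace_mat_mult_vec[OF i]
        by (simp add: laplace_apply[OF subprob_empirical] cmult_apply ker_op_empirical[of _ _ g])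
    qed (use cA in simp)
    ultimately have "eigenvector ?A (vec n (\<lambda>i. g (xs i))) \<zeta>"
      using cA by (simp add: eigenvector_def)
    with spec show False by (auto simp: spectrum_def eigenvalue_def)
  qed
  have surj: "\<exists>g. laplace_op k ?\<mu> g - cmult \<zeta> g = h" for h
  proof -
    obtain B where B: "B \<in> carrier_mat n n" "char_matrix ?A \<zeta> * B = 1\<^sub>m n"
      using det_non_zero_imp_unit[OF cC det] unfolding Units_def ring_mat_def by auto
    define u where "u = B *\<^sub>v vec n (\<lambda>i. h (xs i))"
    have u: "u \<in> carrier_vec n" using B by (simp add: u_def)
    define w where "w i = u $ i" for i
    have uw: "u = vec n w" using u by (auto simp: w_def)
    have "char_matrix ?A \<zeta> *\<^sub>v u = vec n (\<lambda>i. h (xs i))"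
      unfolding u_def using B cC by (simp add: assoc_mult_mat_vec[symmetric, of _ n n _ n])
    then have cu: "(char_matrix ?A \<zeta> *\<^sub>v u) $ i = h (xs i)" if "i < n" for i
      using that by simp
    have "?A *\<^sub>v u - \<zeta> \<cdot>\<^sub>v u = char_matrix ?A \<zeta> *\<^sub>v u"
      using cA u by (auto simp: char_matrix_def add_mult_distrib_mat_vec)
    then have "(?A *\<^sub>v vec n w) $ i - \<zeta> * w i = h (xs i)" if "i < n" for i
      using cu[OF that] that cA unfolding uw by (metis index_minus_vec(1) index_smult_vec(1) index_vec dim_vec index_smult_vec(2))
    then have "deg k ?\<mu> (xs i) * w i - (\<Sum>j<n. complex_of_real (k (xs i) (xs j)) * w j) / n = \<zeta> * w i + h (xs i)"
      if "i < n" for i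
      using that scaled_laplace_mat_mult_vec[OF that, of xs w] by (metis diff_eq_eq add.commute)
    from laplace_empirical_solution[OF range this] show ?thesis by metis
  qed
  \<comment> \<open>A constant sequence of measures and a singleton \<open>K\<close> specialize the
    uniform bound to one operator: absence of an eigenvalue bounds the inverse.\<close>
  obtain c N where c: "c > 0" and lower: "\<And>n' \<zeta>' g. n' \<ge> (N :: nat) \<Longrightarrow> \<zeta>' \<in> {\<zeta>} \<Longrightarrow>
      c * norm g \<le> norm (laplace_op k ?\<mu> g - cmult \<zeta>' g)"
    by (rule eventually_lower_bound_compact[of "\<lambda>_. ?\<mu>" ?\<mu> "{\<zeta>}"])
      (use subprob_empirical range not_eigenvalue in auto)
  obtain R where "is_resolvent (laplace_op k ?\<mu>) \<zeta> R"
    by (rule is_resolventI[OF surj c lower[OF order_refl singletonI]])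
  then show ?thesis by (auto simp: op_spectrum_def)
qed

end

section \<open>Almost sure convergence of the empirical kernel operators\<close>

text \<open>Indicators lie between 0 and 1, so the Hoeffding exponent is linear in \<open>n\<close>
  and the deviation probabilities are dominated by a geometric series.\<close>

lemma frequency_tendsto_AE:
  fixes X :: "nat \<Rightarrow> 'w \<Rightarrow> 'a::topological_space"
  assumes \<Omega>: "prob_space \<Omega>" and indep: "prob_space.indep_vars \<Omega> (\<lambda>_. borel) X UNIV"
    and distr: "\<And>i. distr \<Omega> borel (X i) = P" and A: "A \<in> sets borel"
  shows "AE \<omega> in \<Omega>. (\<lambda>n. (\<Sum>i<n. indicat_real A (X i \<omega>)) / n) \<longlonglongrightarrow> measure P A"
proof -
  interpret prob_space \<Omega> by (rule \<Omega>)
  define Y where "Y i \<omega> = indicat_real A (X i \<omega>)" for i \<omega>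
  have X [measurable]: "X i \<in> \<Omega> \<rightarrow>\<^sub>M borel" for i
    using indep by (simp add: indep_vars_def)
  note A [measurable]
  have Y [measurable]: "Y i \<in> borel_measurable \<Omega>" for i
    unfolding Y_def by measurable
  have "indep_vars (\<lambda>_. borel) (\<lambda>i \<omega>. indicat_real A (X i \<omega>)) UNIV"
    by (rule indep_vars_compose2[OF indep]) measurable
  then have "indep_vars (\<lambda>_. borel) Y UNIV"
    by (simp add: Y_def[abs_def])
  from indep_vars_subset[OF this] have indep_Y: "indep_vars (\<lambda>_. borel) Y J" for J
    by simp
  have exp_Y: "expectation (Y i) = measure P A" for i
  proof -
    have "expectation (Y i) = integral\<^sup>L (distr \<Omega> borel (X i)) (indicat_real A)"
      unfolding Y_def by (rule integral_distr[symmetric]) measurable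
    then show ?thesis unfolding distr[of i, symmetric] by simp
  qed
  define E where "E \<epsilon> n = {\<omega> \<in> space \<Omega>. \<bar>(\<Sum>i<n. Y i \<omega>) - n * measure P A\<bar> \<ge> n * \<epsilon>}" for \<epsilon> :: real and n :: nat
  have E_sets: "E \<epsilon> n \<in> sets \<Omega>" for \<epsilon> n
    unfolding E_def by measurable
  have prob_E: "prob (E \<epsilon> n) \<le> 2 * exp (- 2 * \<epsilon>\<^sup>2) ^ n" if "\<epsilon> > 0" for \<epsilon> n
  \<comment> \<open>For the empty sample the exponent would divide by 0; the claimed bound is then
    2.\<close>
  proof (cases "n = 0")
    case True
    then show ?thesis by (simp add: order_trans[OF prob_le_1])
  next
    case False
    interpret Hoeffding_ineq \<Omega> "{..<n}" Y "\<lambda>_. 0" "\<lambda>_. 1" "real n * measure P A"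
      by unfold_locales (auto simp: indep_Y exp_Y Y_def indicator_def)
    have "prob (E \<epsilon> n) \<le> 2 * exp (- 2 * (n * \<epsilon>)\<^sup>2 / (\<Sum>i<n. (1 - 0)\<^sup>2))"
      unfolding E_def using Hoeffding_ineq_abs_ge[of "n * \<epsilon>"] that False by simp
    also have "- 2 * (n * \<epsilon>)\<^sup>2 / (\<Sum>i<n. (1 - 0)\<^sup>2) = n * (- 2 * \<epsilon>\<^sup>2)"
      using False by (simp add: power2_eq_square)
    also have "exp \<dots> = exp (- 2 * \<epsilon>\<^sup>2) ^ n"
      by (rule exp_of_nat_mult)
    finally show ?thesis .
  qed
  have "AE \<omega> in \<Omega>. \<forall>\<^sub>F n in sequentially. \<omega> \<in> space \<Omega> - E \<epsilon> n" if "\<epsilon> > 0" for \<epsilon>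
  proof (rule borel_cantelli_AE1)
    show "summable (\<lambda>n. prob (E \<epsilon> n))"
    proof (rule summable_comparison_test)
      show "\<exists>N. \<forall>n\<ge>N. norm (prob (E \<epsilon> n)) \<le> 2 * exp (- 2 * \<epsilon>\<^sup>2) ^ n"
        using prob_E[OF that] by simp
      show "summable (\<lambda>n. 2 * exp (- 2 * \<epsilon>\<^sup>2) ^ n)"
        using that by (intro summable_mult summable_geometric) simp
    qed
  qed (use E_sets in \<open>auto simp: emeasure_eq_measure\<close>)
  \<comment> \<open>Tolerances \<open>1 / Suc m\<close> suffice, and countably many null sets may be
    united.\<close>
  then have "AE \<omega> in \<Omega>. \<forall>m. \<forall>\<^sub>F n in sequentially. \<omega> \<in> space \<Omega> - E (1 / real (Suc m)) n"
    by (subst AE_all_countable) simp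
  then show ?thesis
  proof eventually_elim
    case (elim \<omega>)
    show ?case
    proof (rule tendstoI)
      fix e :: real assume "e > 0"
      then obtain m where m: "1 / real (Suc m) < e"
        using nat_approx_posE by blast
      from elim[rule_format, of m] eventually_gt_at_top[of 0]
      show "\<forall>\<^sub>F n in sequentially. dist ((\<Sum>i<n. indicat_real A (X i \<omega>)) / real n) (measure P A) < e"
      proof eventually_elim
        case (elim n)
        then have "\<bar>(\<Sum>i<n. Y i \<omega>) - n * measure P A\<bar> < n * (1 / real (Suc m))"
          by (simp add: E_def not_le)
        also have "(\<Sum>i<n. Y i \<omega>) - n * measure P A = n * ((\<Sum>i<n. Y i \<omega>) / n - measure P A)"
          using elim by (simp add: field_simps)
        finally have "\<bar>(\<Sum>i<n. Y i \<omega>) / n - measure P A\<bar> < 1 / real (Suc m)"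
          using elim unfolding abs_mult by (simp only: abs_of_nat mult_less_cancel_left_pos of_nat_0_less_iff)
        then show ?case using m by (simp add: dist_real_def Y_def)
      qed
    qed
  qed
qed

text \<open>Each cell is a ball of a finite cover minus the earlier balls. Coding the cells by
  \<open>idx\<close> makes them disjoint and exhaustive automatically.\<close>

lemma finite_measurable_partition:
  fixes e :: real
  assumes "compact (UNIV :: 'a::metric_space set)" "e > 0"
  obtains N and c :: "nat \<Rightarrow> 'a::metric_space" and idx :: "'a \<Rightarrow> nat"
  where "\<And>x. idx x < N" "\<And>x. dist x (c (idx x)) < e" "\<And>i. {x. idx x = i} \<in> sets borel"
proof -
  obtain C :: "'a set" where C: "finite C" "\<And>x. \<exists>c\<in>C. dist x c < e"
    using compact_UNIV_net[OF assms] by blast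
  obtain c :: "nat \<Rightarrow> 'a" and N where c: "C = c ` {i. i < N}"
    using finite_imp_nat_seg_image_inj_on[OF C(1)] by blast
  define idx where "idx x = (LEAST i. i < N \<and> dist x (c i) < e)" for x
  have ex: "\<exists>i. i < N \<and> dist x (c i) < e" for x
    using C(2)[of x] c by auto
  have idx: "idx x < N" "dist x (c (idx x)) < e" for x
    using LeastI_ex[OF ex[of x]] by (auto simp: idx_def)
  have least: "\<not> dist x (c j) < e" if "j < idx x" for x j
    using not_less_Least[of j "\<lambda>i. i < N \<and> dist x (c i) < e"] that idx(1)[of x]
    unfolding idx_def by auto
  have "{x. idx x = i} \<in> sets borel" for i
  proof (cases "i < N")
    case True
    have "idx x = i \<longleftrightarrow> x \<in> ball (c i) e - (\<Union>j<i. ball (c j) e)" for x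
    proof
      assume "idx x = i"
      then show "x \<in> ball (c i) e - (\<Union>j<i. ball (c j) e)"
        using idx(2)[of x] least[of _ x] by (auto simp: dist_commute)
    next
      assume x: "x \<in> ball (c i) e - (\<Union>j<i. ball (c j) e)"
      then have "idx x \<le> i"
        unfolding idx_def using True by (intro Least_le) (auto simp: dist_commute)
      moreover have "\<not> idx x < i" using x idx(2)[of x] by (auto simp: dist_commute)
      ultimately show "idx x = i" by simp
    qed
    then have "{x. idx x = i} = ball (c i) e - (\<Union>j<i. ball (c j) e)" by blast
    then show ?thesis by simp
  next
    case False
    then have "{x. idx x = i} = {}" using idx(1) by auto
    then show ?thesis by (metis sets.empty_sets)
  qed
  with idx show thesis by (rule that)
qed

lemma measure_empirical:
  assumes "A \<in> sets borel"
  shows "measure (empirical_measure n xs) A = (\<Sum>i<n. indicat_real A (xs i)) / n"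
proof -
  have "measure (empirical_measure n xs) A = (\<integral>y. indicat_real A y \<partial>empirical_measure n xs)"
    by (simp add: empirical_measure_def)
  also have "\<dots> = (\<Sum>i<n. indicat_real A (xs i)) / n"
    by (subst integral_empirical) (use assms in simp_all)
  finally show ?thesis .
qed

context kernel_space begin

text \<open>Replacing \<open>F\<close> by a step function costs at most its oscillation because the
  mass is at most 1; the step function sees only the cell masses.\<close>

lemma integral_partition_approx:
  fixes F :: "'a \<Rightarrow> complex" and N :: nat
  assumes \<mu>: "subprob \<mu>" and int: "integrable \<mu> F"
    and idx: "\<And>x. idx x < N" "\<And>i. {x. idx x = i} \<in> sets borel"
    and close: "\<And>y. norm (F y - F (c (idx y))) \<le> e"
  shows "norm ((\<integral>y. F y \<partial>\<mu>) - (\<Sum>i<N. F (c i) * measure \<mu> {x. idx x = i})) \<le> e"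
proof -
  interpret finite_measure \<mu> using \<mu> by (simp add: subprob_def)
  have sets: "{x. idx x = i} \<in> sets \<mu>" for i
  proof -
    have "sets \<mu> = sets borel" using \<mu> by (simp add: subprob_def)
    with idx(2) show ?thesis by (simp only:)
  qed
  have step: "F (c (idx y)) = (\<Sum>i<N. indicat_real {x. idx x = i} y *\<^sub>R F (c i))" for y
  proof -
    have "(\<Sum>i<N. indicat_real {x. idx x = i} y *\<^sub>R F (c i)) = (\<Sum>i<N. if i = idx y then F (c i) else 0)"
    proof (rule sum.cong)
      fix i show "indicat_real {x. idx x = i} y *\<^sub>R F (c i) = (if i = idx y then F (c i) else 0)"
        by (cases "i = idx y") simp_all
    qed simp
    then show ?thesis using idx(1) by simp
  qed
  have int_step: "integrable \<mu> (\<lambda>y. indicat_real {x. idx x = i} y *\<^sub>R F (c i))" for i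
    using sets by (intro integrable_scaleR_left) (simp add: integrable_indicator_iff emeasure_finite less_top[symmetric])
  have "(\<integral>y. F (c (idx y)) \<partial>\<mu>) = (\<Sum>i<N. F (c i) * measure \<mu> {x. idx x = i})"
    unfolding step
    by (subst Bochner_Integration.integral_sum[OF int_step])
      (use sets in \<open>auto simp: scaleR_conv_of_real mult.commute intro!: sum.cong\<close>)
  moreover have "integrable \<mu> (\<lambda>y. F (c (idx y)))"
    unfolding step by (intro Bochner_Integration.integrable_sum int_step)
  moreover have "norm (\<integral>y. F y - F (c (idx y)) \<partial>\<mu>) \<le> e"
    by (rule norm_integral_subprob[OF \<mu> close])
  ultimately show ?thesis
    using int by (simp add: Bochner_Integration.integral_diff)
qed

text \<open>Uniform continuity of \<open>k x y * g y\<close> in both variables lets one partition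
  serve all \<open>x\<close>, so finitely many cell masses control the supremum norm.\<close>

lemma ker_op_tendsto_partition:
  assumes \<mu>: "\<And>n. subprob (\<mu> n)" and P: "subprob P"
    and partition: "\<And>e. e > 0 \<Longrightarrow> \<exists>(N :: nat) c idx. (\<forall>x. idx x < N \<and> dist x (c (idx x)) < e) \<and>
      (\<forall>i. {x. idx x = i} \<in> sets borel \<and> (\<lambda>n. measure (\<mu> n) {x. idx x = i}) \<longlonglongrightarrow> measure P {x. idx x = i})"
  shows "(\<lambda>n. ker_op k (\<mu> n) g) \<longlonglongrightarrow> ker_op k P g"
proof (rule metric_LIMSEQ_I)
  fix e :: real assume e: "e > 0"
  let ?F = "\<lambda>x y. complex_of_real (k x y) * g y"
  let ?K = "kmax * norm g"
  have "continuous_on UNIV (\<lambda>p. complex_of_real (case p of (x, y) \<Rightarrow> k x y) * g (snd p))"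
    by (intro continuous_intros k_cont) (auto intro: continuous_on_compose2[OF continuous_on_apply_bcontfun continuous_on_snd])
  then have "continuous_on UNIV (\<lambda>(x, y). ?F x y)"
    by (simp add: case_prod_beta)
  then obtain d where d: "d > 0"
    "\<And>x x' y y'. dist x x' < d \<Longrightarrow> dist y y' < d \<Longrightarrow> dist (?F x y) (?F x' y') < e / 4"
    using uniformly_continuous_section[of ?F "e / 4"] e by auto
  obtain N :: nat and c idx where idx: "\<And>x. idx x < N" "\<And>x. dist x (c (idx x)) < d"
      "\<And>i. {x. idx x = i} \<in> sets borel"
    and lim: "\<And>i. (\<lambda>n. measure (\<mu> n) {x. idx x = i}) \<longlonglongrightarrow> measure P {x. idx x = i}"
    using partition[OF d(1)] by blast
  let ?S = "\<lambda>\<nu> x. \<Sum>i<N. ?F x (c i) * complex_of_real (measure \<nu> {x. idx x = i})"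
  have approx: "norm (ker_op k \<nu> g x - ?S \<nu> x) \<le> e / 4" if "subprob \<nu>" for \<nu> x
    unfolding ker_op_apply[OF that]
  proof (rule integral_partition_approx[OF that integrable_ker[OF that] idx(1) idx(3)])
    show "norm (?F x y - ?F x (c (idx y))) \<le> e / 4" for y
      using d(2)[of x x y "c (idx y)"] idx(2)[of y] d(1) by (simp add: dist_norm)
  qed
  have "(\<lambda>n. \<Sum>i<N. ?K * \<bar>measure (\<mu> n) {x. idx x = i} - measure P {x. idx x = i}\<bar>) \<longlonglongrightarrow> (\<Sum>i<N. ?K * 0)"
    by (intro tendsto_sum tendsto_mult tendsto_const tendsto_rabs_zero LIM_zero lim)
  then have "(\<lambda>n. \<Sum>i<N. ?K * \<bar>measure (\<mu> n) {x. idx x = i} - measure P {x. idx x = i}\<bar>) \<longlonglongrightarrow> 0"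
    by simp
  then have "\<forall>\<^sub>F n in sequentially.
      (\<Sum>i<N. ?K * \<bar>measure (\<mu> n) {x. idx x = i} - measure P {x. idx x = i}\<bar>) < e / 4"
    by (rule order_tendstoD(2)) (use e in simp)
  then obtain n0 where n0: "\<And>n. n \<ge> n0 \<Longrightarrow>
      (\<Sum>i<N. ?K * \<bar>measure (\<mu> n) {x. idx x = i} - measure P {x. idx x = i}\<bar>) < e / 4"
    unfolding eventually_sequentially by blast
  have "dist (ker_op k (\<mu> n) g) (ker_op k P g) < e" if "n \<ge> n0" for n
  proof -
    \<comment> \<open>Two discretization errors and the difference of the two sums, each at most
      \<open>e / 4\<close>.\<close>
    have "dist (ker_op k (\<mu> n) g x) (ker_op k P g x) \<le> 3 * e / 4" for x
    proof -
      have "?S (\<mu> n) x - ?S P x =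
          (\<Sum>i<N. ?F x (c i) * complex_of_real (measure (\<mu> n) {x. idx x = i} - measure P {x. idx x = i}))"
        by (simp add: sum_subtractf right_diff_distrib)
      also have "norm \<dots> \<le> (\<Sum>i<N. ?K * \<bar>measure (\<mu> n) {x. idx x = i} - measure P {x. idx x = i}\<bar>)"
      proof (rule sum_norm_le)
        fix i
        show "norm (?F x (c i) * complex_of_real (measure (\<mu> n) {x. idx x = i} - measure P {x. idx x = i}))
            \<le> ?K * \<bar>measure (\<mu> n) {x. idx x = i} - measure P {x. idx x = i}\<bar>"
          using mult_right_mono[OF norm_ker_le[of x "c i" g]
              abs_ge_zero[of "measure (\<mu> n) {x. idx x = i} - measure P {x. idx x = i}"]]
          by (simp only: norm_mult norm_of_real)
      qed
      finally have "norm (?S (\<mu> n) x - ?S P x) < e / 4"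
        using n0[OF that] by linarith
      moreover have "norm (a - b) \<le> norm (a - s) + norm (s - t) + norm (b - t)" for a b s t :: complex
        using norm_triangle_ineq4[of "(a - s) + (s - t)" "b - t"] norm_triangle_ineq[of "a - s" "s - t"]
        by simp
      note this[of "ker_op k (\<mu> n) g x" "ker_op k P g x" "?S (\<mu> n) x" "?S P x"]
      ultimately show ?thesis
        using approx[OF \<mu>, of n x] approx[OF P, of x] by (simp add: dist_norm)
    qed
    then have "dist (ker_op k (\<mu> n) g) (ker_op k P g) \<le> 3 * e / 4" by (rule dist_bound)
    then show ?thesis using e by simp
  qed
  then show "\<exists>n0. \<forall>n\<ge>n0. dist (ker_op k (\<mu> n) g) (ker_op k P g) < e" by blast
qed

text \<open>There are uncountably many \<open>g\<close>, but the partitions are chosen by mesh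
  alone, before \<open>g\<close>. Countably many cells fix the null set, so the quantifier over
  \<open>g\<close> may stand inside.\<close>

lemma ker_op_empirical_tendsto_AE:
  fixes X :: "nat \<Rightarrow> 'w \<Rightarrow> 'a"
  assumes \<Omega>: "prob_space \<Omega>" and indep: "prob_space.indep_vars \<Omega> (\<lambda>_. borel) X UNIV"
    and distr: "\<And>i. distr \<Omega> borel (X i) = P" and P: "subprob P"
  shows "AE \<omega> in \<Omega>. \<forall>g. (\<lambda>n. ker_op k (empirical_measure n (\<lambda>i. X i \<omega>)) g) \<longlonglongrightarrow> ker_op k P g"
proof -
  have "\<exists>(N :: nat) (c :: nat \<Rightarrow> 'a) (idx :: 'a \<Rightarrow> nat). \<forall>x. idx x < N \<and> dist x (c (idx x)) < 1 / real (Suc m) \<and>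
      (\<forall>i. {x. idx x = i} \<in> sets borel)" for m
    using finite_measurable_partition[OF compact, of "1 / real (Suc m)"]
    by (metis of_nat_0_less_iff zero_less_Suc zero_less_divide_1_iff)
  then obtain N :: "nat \<Rightarrow> nat" and c :: "nat \<Rightarrow> nat \<Rightarrow> 'a"
    and idx :: "nat \<Rightarrow> 'a \<Rightarrow> nat" where
    idx: "\<And>m x. idx m x < N m" "\<And>m x. dist x (c m (idx m x)) < 1 / real (Suc m)"
      "\<And>m i. {x. idx m x = i} \<in> sets borel"
    by metis
  have "AE \<omega> in \<Omega>. \<forall>m i. (\<lambda>n. (\<Sum>j<n. indicat_real {x. idx m x = i} (X j \<omega>)) / n)
      \<longlonglongrightarrow> measure P {x. idx m x = i}"
    unfolding AE_all_countable
    by (intro allI frequency_tendsto_AE[OF \<Omega> indep distr idx(3)])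
  then show ?thesis
  proof eventually_elim
    case (elim \<omega>)
    show ?case
    proof (intro allI ker_op_tendsto_partition[OF subprob_empirical P])
      fix e :: real assume "e > 0"
      then obtain m where m: "1 / real (Suc m) < e"
        using nat_approx_posE by blast
      have "idx m x < N m \<and> dist x (c m (idx m x)) < e" for x
        using idx(1)[of m x] idx(2)[of x m] m by auto
      moreover have "(\<lambda>n. measure (empirical_measure n (\<lambda>j. X j \<omega>)) {x. idx m x = i})
          \<longlonglongrightarrow> measure P {x. idx m x = i}" for i
        using elim by (simp add: measure_empirical[OF idx(3)])
      ultimately show "\<exists>(N :: nat) c idx. (\<forall>x. idx x < N \<and> dist x (c (idx x)) < e) \<and>
          (\<forall>i. {x. idx x = i} \<in> sets borel \<and>
            (\<lambda>n. measure (empirical_measure n (\<lambda>j. X j \<omega>)) {x. idx x = i}) \<longlonglongrightarrow> measure P {x. idx x = i})"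
        using idx(3)[of m] by blast
    qed
  qed
qed

end

section \<open>Convergence of eigenvalues and spectral projections\<close>

lemma op_eigenvalue_in_spectrum:
  assumes "op_eigenvalue A \<zeta>" shows "\<zeta> \<in> op_spectrum A"
proof (rule ccontr)
  assume "\<zeta> \<notin> op_spectrum A"
  then obtain R where R: "is_resolvent A \<zeta> R" by (auto simp: op_spectrum_def)
  obtain g where "g \<noteq> 0" "A g = cmult \<zeta> g"
    using assms by (auto simp: op_eigenvalue_def op_eigenfunction_def)
  with is_resolvent_left[OF R, of g] show False by simp
qed

lemma vector_space_cmult:
  "vector_space (\<lambda>c. blinfun_apply (cmult c :: 'a::topological_space cop))"
proof
  fix a b :: complex and x y :: "'a \<Rightarrow>\<^sub>C complex"
  show "cmult a (x + y) = cmult a x + cmult a y" by (rule blinfun.add_right)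
  show "cmult (a + b) x = cmult a x + cmult b x"
    by (rule bcontfun_eqI) (simp add: cmult_apply algebra_simps)
qed (simp_all add: cmult_cmult)

text \<open>Multiplicity 1 confines the generalized eigenspace, and so every eigenfunction, to a
  complex line, which the nonzero \<open>f\<close> spans.\<close>

lemma simple_eigenvalue_proportional:
  fixes A :: "'a::topological_space cop"
  assumes simple: "simple_eigenvalue A \<zeta>" and f: "op_eigenfunction A \<zeta> f"
    and g: "A g = cmult \<zeta> g"
  obtains c where "g = cmult c f"
proof -
  interpret vs: vector_space "\<lambda>c. blinfun_apply (cmult c :: 'a cop)"
    by (rule vector_space_cmult)
  let ?V = "gen_eigenspace A \<zeta>"
  have eig: "h \<in> ?V" if "A h = cmult \<zeta> h" for h
    using that unfolding gen_eigenspace_def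
    by (intro CollectI exI[of _ 1]) (simp add: blinfun.diff_left)
  have dim: "vs.dim ?V = 1"
    using simple by (simp add: simple_eigenvalue_def alg_multiplicity_def)
  define B where "B = (SOME b. \<not> vs.dependent b \<and> vs.span b = vs.span ?V)"
  \<comment> \<open>The dimension is 0 by convention when no basis exists; the value 1 excludes this
    case.\<close>
  have ex: "\<exists>b. \<not> vs.dependent b \<and> vs.span b = vs.span ?V"
  proof (rule ccontr)
    assume "\<not> ?thesis"
    then have "vs.dim ?V = 0" by (simp only: vs.dim_def if_False)
    with dim show False by simp
  qed
  then have "vs.span B = vs.span ?V" and "card B = 1"
    using someI_ex[OF ex] dim by (auto simp: B_def vs.dim_def)
  then obtain b where b: "vs.span {b} = vs.span ?V"
    by (metis card_1_singletonE)
  have "h \<in> range (\<lambda>c. cmult c b)" if "A h = cmult \<zeta> h" for h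
    using vs.span_base[OF eig[OF that]] unfolding b[symmetric] vs.span_singleton .
  then obtain \<alpha> \<beta> where ab: "f = cmult \<alpha> b" "g = cmult \<beta> b"
    using f g unfolding op_eigenfunction_def by blast
  have "f \<noteq> 0" using f by (simp add: op_eigenfunction_def)
  then have "\<alpha> \<noteq> 0" using ab vs.scale_zero_left by blast
  then have "g = cmult (\<beta> / \<alpha>) f" by (simp add: ab cmult_cmult)
  then show thesis by (rule that)
qed

lemma norm_complexify: "norm (complexify f) = norm f"
proof (rule antisym)
  show "norm (complexify f) \<le> norm f"
    by (rule norm_bound) (use norm_bounded[of f] in \<open>simp add: complexify_apply\<close>)
  show "norm f \<le> norm (complexify f)"
    by (rule norm_bound) (use norm_bounded[of "complexify f"] in \<open>simp add: complexify_apply\<close>)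
qed

lemma complexify_inject: "complexify f = complexify g \<longleftrightarrow> f = g"
  by (metis bcontfun_eqI complexify_apply of_real_eq_iff)

text \<open>The band contains every point at which a perturbation of \<open>f\<close> by at most
  \<open>m n\<close> can cross the level \<open>b\<close>; it shrinks to the null set where
  \<open>f = b\<close>.\<close>

lemma measure_level_band_tendsto_0:
  fixes f :: "'a \<Rightarrow> real"
  assumes "finite_measure P" and f [measurable]: "f \<in> borel_measurable P"
    and null: "measure P {x \<in> space P. f x = b} = 0" and m: "m \<longlonglongrightarrow> 0"
  shows "(\<lambda>n. measure P {x \<in> space P. \<bar>f x - b\<bar> \<le> m n}) \<longlonglongrightarrow> 0"
proof (rule tendstoI)
  interpret finite_measure P by fact
  fix e :: real assume e: "e > 0"
  \<comment> \<open>\<open>m\<close> may fail to be monotone; the bands of radius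
    \<open>1 / Suc j\<close> decrease, so continuity from above applies to them.\<close>
  define A where "A j = {x \<in> space P. \<bar>f x - b\<bar> \<le> 1 / real (Suc j)}" for j
  have A: "A j \<in> sets P" for j unfolding A_def by measurable
  have "decseq A"
    unfolding A_def decseq_def by (auto intro: order_trans simp: frac_le)
  then have "(\<lambda>j. measure P (A j)) \<longlonglongrightarrow> measure P (\<Inter>j. A j)"
    using A by (intro finite_Lim_measure_decseq) auto
  also have "(\<Inter>j. A j) = {x \<in> space P. f x = b}"
  proof (intro equalityI subsetI)
    fix x assume x: "x \<in> (\<Inter>j. A j)"
    have "\<bar>f x - b\<bar> \<le> 0"
    proof (rule LIMSEQ_le_const[OF LIMSEQ_inverse_real_of_nat])
      show "\<exists>N. \<forall>n\<ge>N. \<bar>f x - b\<bar> \<le> inverse (real (Suc n))"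
        using x by (auto simp: A_def inverse_eq_divide)
    qed
    then show "x \<in> {x \<in> space P. f x = b}" using x by (auto simp: A_def)
  qed (auto simp: A_def)
  finally have "\<forall>\<^sub>F j in sequentially. measure P (A j) < e"
    unfolding null using e by (rule order_tendstoD(2))
  then obtain j where j: "measure P (A j) < e"
    by (auto simp: eventually_sequentially)
  have "\<forall>\<^sub>F n in sequentially. m n < 1 / real (Suc j)"
    using m by (rule order_tendstoD(2)) simp
  then show "\<forall>\<^sub>F n in sequentially. dist (measure P {x \<in> space P. \<bar>f x - b\<bar> \<le> m n}) 0 < e"
  proof eventually_elim
    case (elim n)
    have "measure P {x \<in> space P. \<bar>f x - b\<bar> \<le> m n} \<le> measure P (A j)"
      by (rule finite_measure_mono[OF _ A]) (use elim in \<open>auto simp: A_def\<close>)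
    with j show ?case by simp
  qed
qed

section \<open>Convergence of the operators, pointwise and uniformly on compact sets\<close>

lemma (in kernel_space) laplace_op_tendsto:
  assumes \<mu>: "\<And>j. subprob (\<mu> j)" and \<mu>0: "subprob \<mu>0"
    and conv: "\<And>g. (\<lambda>j. ker_op k (\<mu> j) g) \<longlonglongrightarrow> ker_op k \<mu>0 g"
  shows "(\<lambda>j. laplace_op k (\<mu> j) g) \<longlonglongrightarrow> laplace_op k \<mu>0 g"
proof (rule LIM_zero_cancel, rule Lim_null_comparison)
  let ?b = "\<lambda>j. norm (deg k (\<mu> j) - deg k \<mu>0) * norm g + norm (ker_op k (\<mu> j) g - ker_op k \<mu>0 g)"
  show "\<forall>\<^sub>F j in sequentially. norm (laplace_op k (\<mu> j) g - laplace_op k \<mu>0 g) \<le> ?b j"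
  proof (rule always_eventually, rule allI, rule norm_bound)
    fix j x
    have "(laplace_op k (\<mu> j) g - laplace_op k \<mu>0 g) x =
        (deg k (\<mu> j) - deg k \<mu>0) x * g x - (ker_op k (\<mu> j) g - ker_op k \<mu>0 g) x"
      by (simp add: laplace_apply \<mu> \<mu>0 algebra_simps)
    also have "norm \<dots> \<le> norm ((deg k (\<mu> j) - deg k \<mu>0) x * g x) + norm ((ker_op k (\<mu> j) g - ker_op k \<mu>0 g) x)"
      by (rule norm_triangle_ineq4)
    also have "\<dots> \<le> ?b j"
      unfolding norm_mult by (intro add_mono mult_mono norm_bounded) auto
    finally show "norm ((laplace_op k (\<mu> j) g - laplace_op k \<mu>0 g) x) \<le> ?b j" .
  qed
  show "?b \<longlonglongrightarrow> 0"
    using tendsto_add[OF tendsto_mult[OF tendsto_norm_zero[OF LIM_zero[OF conv[of "const_bcontfun 1"]]]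
          tendsto_const[of "norm g"]] tendsto_norm_zero[OF LIM_zero[OF conv[of g]]]]
    by simp
qed

text \<open>The common Lipschitz constant \<open>2 * kmax\<close> makes pointwise convergence
  uniform on compact sets, here meant for the resolvent values of \<open>U\<close> along a
  circle.\<close>

lemma (in kernel_space) laplace_op_tendsto_uniform:
  assumes \<mu>: "\<And>j. subprob (\<mu> j)" and \<mu>0: "subprob \<mu>0"
    and conv: "\<And>g. (\<lambda>j. ker_op k (\<mu> j) g) \<longlonglongrightarrow> ker_op k \<mu>0 g"
    and H: "compact H" and e: "e > 0"
  shows "\<forall>\<^sub>F j in sequentially. \<forall>h\<in>H. norm (laplace_op k (\<mu> j) h - laplace_op k \<mu>0 h) < e"
proof -
  \<comment> \<open>Moving to a net point costs \<open>e / 4\<close> for each of the two operators,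
    leaving \<open>e / 2\<close> for convergence on the net.\<close>
  define d where "d = e / (8 * kmax)"
  have d: "d > 0" using e kmax(1) by (simp add: d_def)
  obtain C where C: "finite C" "H \<subseteq> (\<Union>c\<in>C. ball c d)"
    using H d by (auto simp: compact_eq_totally_bounded)
  have "\<forall>\<^sub>F j in sequentially. \<forall>c\<in>C. dist (laplace_op k (\<mu> j) c) (laplace_op k \<mu>0 c) < e / 2"
    using C(1) e tendstoD[OF laplace_op_tendsto[OF \<mu> \<mu>0 conv], of "e / 2"]
    by (simp add: eventually_ball_finite)
  then show ?thesis
  proof eventually_elim
    case (elim j)
    show ?case
    proof
      fix h assume "h \<in> H"
      then obtain c where c: "c \<in> C" "norm (h - c) < d"
        using C(2) by (auto simp: dist_norm norm_minus_commute)
      have lip: "norm (laplace_op k \<nu> h - laplace_op k \<nu> c) \<le> e / 4" if "subprob \<nu>" for \<nu>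
      proof -
        have "norm (laplace_op k \<nu> h - laplace_op k \<nu> c) \<le> 2 * kmax * norm (h - c)"
          using norm_laplace_le[OF that, of "h - c"] by (simp add: blinfun.diff_right)
        also have "\<dots> \<le> 2 * kmax * d" using c(2) kmax(1) by (intro mult_left_mono) auto
        also have "\<dots> = e / 4" using kmax(1) by (simp add: d_def)
        finally show ?thesis .
      qed
      have "norm (a - b) \<le> norm (a - s) + norm (s - t) + norm (b - t)"
        for a b s t :: "'a \<Rightarrow>\<^sub>C complex"
        using norm_triangle_ineq4[of "(a - s) + (s - t)" "b - t"] norm_triangle_ineq[of "a - s" "s - t"]
        by simp
      note this[of "laplace_op k (\<mu> j) h" "laplace_op k \<mu>0 h" "laplace_op k (\<mu> j) c" "laplace_op k \<mu>0 c"]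
      then show "norm (laplace_op k (\<mu> j) h - laplace_op k \<mu>0 h) < e"
        using lip[OF \<mu>, of j] lip[OF \<mu>0] elim c(1) unfolding dist_norm by fastforce
    qed
  qed
qed

text \<open>The sample is one fixed realization \<open>xs\<close>. \<open>M_closure\<close> guards
  against parameters in \<open>M\<close> that drift to another point of the spectrum, or to the
  range of the degree function, on the boundary of \<open>M\<close>.\<close>

locale laplace_limit = kernel_space k
  for k :: "'a::metric_space \<Rightarrow> 'a \<Rightarrow> real" +
  fixes P :: "'a measure" and xs :: "nat \<Rightarrow> 'a" and lam :: complex and M :: "complex set"
  assumes subprob_P: "subprob P"
    and conv: "\<And>g. (\<lambda>n. ker_op k (empirical_measure n xs) g) \<longlonglongrightarrow> ker_op k P g"
    and lam_range: "lam \<notin> complex_of_real ` range (degree_fun k P)"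
    and M_open: "open M"
    and M_spectrum: "op_spectrum (laplace_op k P) \<inter> M = {lam}"
    and M_closure: "(op_spectrum (laplace_op k P) \<union> complex_of_real ` range (degree_fun k P))
                      \<inter> closure M = {lam}"
begin

abbreviation U where "U \<equiv> laplace_op k P"
abbreviation Us where "Us n \<equiv> laplace_op k (empirical_measure n xs)"
abbreviation Ls where "Ls n \<equiv> scaled_laplace_mat k n xs"

lemma closure_range: "closure M \<inter> complex_of_real ` range (degree_fun k P) = {}"
proof -
  have "C \<inter> B = {}" if "(A \<union> B) \<inter> C = {z}" "z \<notin> B" for A B C :: "complex set" and z
  proof -
    have "C \<inter> B \<subseteq> {z}" unfolding that(1)[symmetric] by (rule Int_greatest) auto
    with that(2) show ?thesis by blast
  qed
  from this[OF M_closure lam_range] show ?thesis .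
qed

lemma closure_spectrum: "\<zeta> \<in> closure M \<Longrightarrow> \<zeta> \<in> op_spectrum U \<Longrightarrow> \<zeta> = lam"
  using M_closure by (metis IntI UnI1 singletonD)

lemma eventually_range:
  obtains \<delta> where "\<delta> > 0"
    "\<forall>\<^sub>F n in sequentially. \<forall>\<zeta>\<in>M. \<forall>x. \<delta> \<le> dist (deg k (empirical_measure n xs) x) \<zeta>"
proof -
  obtain \<delta> where "\<delta> > 0" "\<forall>\<^sub>F n in sequentially. \<forall>\<zeta>\<in>closure M. \<forall>x. \<delta> \<le> dist (deg k (empirical_measure n xs) x) \<zeta>"
    by (rule eventually_separated_degree_range[OF subprob_P conv closed_closure closure_range])
  then show thesis
    by (intro that[of \<delta>]) (auto elim!: eventually_mono intro: closure_subset[THEN subsetD])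
qed

lemma eventually_not_in_range:
  "\<forall>\<^sub>F n in sequentially. \<forall>\<zeta>\<in>M. \<zeta> \<notin> complex_of_real ` range (degree_fun k (empirical_measure n xs))"
proof -
  obtain \<delta> where "\<delta> > 0"
    "\<forall>\<^sub>F n in sequentially. \<forall>\<zeta>\<in>M. \<forall>x. \<delta> \<le> dist (deg k (empirical_measure n xs) x) \<zeta>"
    by (rule eventually_range)
  from this(2) show ?thesis
  proof eventually_elim
    case (elim n)
    show ?case
    proof (intro ballI notI)
      fix \<zeta> assume "\<zeta> \<in> M" "\<zeta> \<in> complex_of_real ` range (degree_fun k (empirical_measure n xs))"
      then obtain x where "\<zeta> = deg k (empirical_measure n xs) x"
        by (auto simp: deg_apply[OF subprob_empirical])
      with elim[rule_format, OF \<open>\<zeta> \<in> M\<close>, of x] \<open>\<delta> > 0\<close> show False by simp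
    qed
  qed
qed

text \<open>Serves twice: it keeps matrix eigenvalues in \<open>M\<close> close to
  \<open>lam\<close>, and it bounds the resolvents of \<open>U_n\<close> on a circle around
  \<open>lam\<close> uniformly in \<open>n\<close>.\<close>

lemma lower_bound_away:
  assumes "r > 0"
  obtains c N where "c > 0"
    "\<And>n \<zeta> g. n \<ge> N \<Longrightarrow> \<zeta> \<in> closure M - ball lam r \<Longrightarrow> c * norm g \<le> norm (Us n g - cmult \<zeta> g)"
proof (rule eventually_lower_bound[OF subprob_empirical subprob_P conv, of "closure M - ball lam r" thesis])
  show "closed (closure M - ball lam r)" by (intro closed_Diff) auto
  show "(closure M - ball lam r) \<inter> complex_of_real ` range (degree_fun k P) = {}"
    using closure_range by blast
  show "\<not> op_eigenvalue U \<zeta>" if "\<zeta> \<in> closure M - ball lam r" for \<zeta>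
    using that op_eigenvalue_in_spectrum[of U \<zeta>] closure_spectrum[of \<zeta>] assms by auto
qed (use that in blast)

text \<open>An eigenvector extends to an eigenfunction of \<open>U_n\<close> with the same
  parameter, which the lower bound forbids away from \<open>lam\<close>.\<close>

lemma eventually_eigenvalues_near:
  assumes "r > 0"
  shows "\<forall>\<^sub>F n in sequentially. spectrum (Ls n) \<inter> M \<subseteq> ball lam r"
proof -
  obtain c N where c: "c > 0" and lower: "\<And>n \<zeta> g. n \<ge> N \<Longrightarrow> \<zeta> \<in> closure M - ball lam r \<Longrightarrow>
      c * norm g \<le> norm (Us n g - cmult \<zeta> g)"
    by (rule lower_bound_away[OF assms]) blast
  from eventually_not_in_range eventually_ge_at_top[of N] show ?thesis
  proof eventually_elim
    case (elim n)
    show ?case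
    proof
      fix \<zeta> assume z: "\<zeta> \<in> spectrum (Ls n) \<inter> M"
      then obtain v where v: "eigenvector (Ls n) v \<zeta>"
        by (auto simp: spectrum_def eigenvalue_def)
      have "v = vec n (\<lambda>i. v $ i)"
        using v scaled_laplace_mat_carrier[of k n xs] by (auto simp: eigenvector_def)
      with v have v: "eigenvector (Ls n) (vec n (\<lambda>i. v $ i)) \<zeta>" by metis
      have rg: "\<zeta> \<notin> complex_of_real ` range (degree_fun k (empirical_measure n xs))"
        using elim z by blast
      have "deg k (empirical_measure n xs) (xs i) * v $ i -
          (\<Sum>j<n. complex_of_real (k (xs i) (xs j)) * v $ j) / n
          = \<zeta> * v $ i + (0 :: 'a \<Rightarrow>\<^sub>C complex) (xs i)" if "i < n" for i
        using eigenvector_empirical(2)[OF v that] by simp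
      note sol = laplace_empirical_solution[OF rg this]
      obtain g :: "'a \<Rightarrow>\<^sub>C complex" where g: "\<And>i. i < n \<Longrightarrow> g (xs i) = v $ i" "Us n g - cmult \<zeta> g = 0"
        by (rule sol) (assumption, rule that)
      have "g \<noteq> 0" using eigenvector_empirical(1)[OF v] g(1) by auto
      then have "\<not> c * norm g \<le> norm (Us n g - cmult \<zeta> g)"
        using c unfolding g(2) by (simp add: not_le)
      then have "\<zeta> \<notin> closure M - ball lam r" using lower[of n \<zeta> g] elim by blast
      then show "\<zeta> \<in> ball lam r" using z closure_subset by blast
    qed
  qed
qed

lemma eigenvalues_tendsto:
  assumes "\<forall>\<^sub>F n in sequentially. lams n \<in> spectrum (Ls n) \<inter> M"
  shows "lams \<longlonglongrightarrow> lam"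
proof (rule tendstoI)
  fix e :: real assume "e > 0"
  from eventually_eigenvalues_near[OF this] assms
  show "\<forall>\<^sub>F n in sequentially. dist (lams n) lam < e"
    by eventually_elim (auto simp: dist_commute)
qed

text \<open>Finiteness, which the residue argument asks for, is inherited from the matrix.\<close>

lemma eventually_spectrum_part:
  assumes "r > 0"
  shows "\<forall>\<^sub>F n in sequentially. op_spectrum (Us n) \<inter> M \<subseteq> ball lam r \<and> finite (op_spectrum (Us n) \<inter> M)"
  using eventually_not_in_range eventually_eigenvalues_near[OF assms]
proof eventually_elim
  case (elim n)
  have "op_spectrum (Us n) \<inter> M \<subseteq> spectrum (Ls n) \<inter> M"
  proof
    fix \<zeta> assume z: "\<zeta> \<in> op_spectrum (Us n) \<inter> M"
    then have "\<zeta> \<in> M" by simp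
    from op_spectrum_empirical[OF bspec[OF elim(1) this]] z show "\<zeta> \<in> spectrum (Ls n) \<inter> M" by blast
  qed
  moreover have "finite (spectrum (Ls n))"
    by (rule card_finite_spectrum(1)[OF scaled_laplace_mat_carrier])
  ultimately show ?case
    using elim(2) finite_subset by blast
qed

lemma clinear_U: "clinear_op U" and clinear_Un: "clinear_op (Us n)"
  by (rule clinear_laplace[OF subprob_P], rule clinear_laplace[OF subprob_empirical])

lemma isolated_part_open: "isolated_part (A :: 'a cop) (op_spectrum A \<inter> M)"
  using M_open by (auto simp: isolated_part_def)

text \<open>Existence of the projections is claimed along with convergence, so that the latter is
  not vacuous. The curves behind \<open>Pr_n\<close> and \<open>Pr\<close> are arbitrary; uniqueness
  exchanges them for one circle in \<open>M\<close>.\<close>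

lemma spectral_projections_converge:
  "(\<exists>Pr. is_spectral_projection U {lam} Pr) \<and>
   (\<exists>N. (\<forall>n>N. isolated_part (Us n) (op_spectrum (Us n) \<inter> M) \<and>
                (\<exists>Q. is_spectral_projection (Us n) (op_spectrum (Us n) \<inter> M) Q)) \<and>
        (\<forall>Pr_n Pr.
           (\<forall>n>N. is_spectral_projection (Us n) (op_spectrum (Us n) \<inter> M) (Pr_n n)) \<longrightarrow>
           is_spectral_projection U {lam} Pr \<longrightarrow>
           (\<forall>g. (\<lambda>n. Pr_n n g) \<longlonglongrightarrow> Pr g)))"
proof -
  obtain r where r: "r > 0" "cball lam r \<subseteq> M"
    using M_open M_spectrum open_contains_cball by blast
  have iso: "isolated_part U {lam}"
    using isolated_part_open[of U] M_spectrum by simp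
  have out: "op_spectrum U - {lam} \<subseteq> - cball lam r"
    using M_spectrum r(2) by blast
  have sph: "sphere lam r \<inter> op_spectrum U = {}"
  proof (rule equals0I)
    fix x assume x: "x \<in> sphere lam r \<inter> op_spectrum U"
    then have "x \<in> op_spectrum U \<inter> M" using r(2) by auto
    then have "x = lam" unfolding M_spectrum by simp
    with x r(1) show False by simp
  qed
  obtain Q where Q: "circle_projection U lam r Q"
    by (rule circle_projection_exists[OF clinear_U r(1) sph])
  have QU: "is_spectral_projection U {lam} Q"
    by (rule circle_projection_imp_spectral_projection[OF r(1) _ out Q]) (use r in simp)
  have out_n: "op_spectrum A - op_spectrum A \<inter> M \<subseteq> - cball lam r" for A :: "'a cop"
    using r(2) by blast
  obtain N0 where N0: "\<And>n. n \<ge> N0 \<Longrightarrow> op_spectrum (Us n) \<inter> M \<subseteq> ball lam r"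
    "\<And>n. n \<ge> N0 \<Longrightarrow> finite (op_spectrum (Us n) \<inter> M)"
    using eventually_spectrum_part[OF r(1)] unfolding eventually_sequentially by blast
  have sph_n: "sphere lam r \<inter> op_spectrum (Us n) = {}" if "n \<ge> N0" for n
    using N0(1)[OF that] r(2) by (fastforce simp: subset_iff)
  have ex: "\<exists>Q. circle_projection (Us n) lam r Q" if "n \<ge> N0" for n
    by (rule circle_projection_exists[OF clinear_Un r(1) sph_n[OF that]]) blast
  define Qn where "Qn n = (SOME Q. circle_projection (Us n) lam r Q)" for n
  have Qn: "circle_projection (Us n) lam r (Qn n)" if "n \<ge> N0" for n
    unfolding Qn_def by (rule someI_ex[OF ex[OF that]])
  have QUs: "is_spectral_projection (Us n) (op_spectrum (Us n) \<inter> M) (Qn n)" if "n \<ge> N0" for n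
    by (rule circle_projection_imp_spectral_projection[OF r(1) N0(1)[OF that] out_n Qn[OF that]])
  have lim: "(\<lambda>n. Qn n g) \<longlonglongrightarrow> Q g" for g
  proof (rule metric_LIMSEQ_I)
    fix e :: real assume e: "e > 0"
    obtain c N1 where c: "c > 0" and lower: "\<And>n \<zeta> g. n \<ge> N1 \<Longrightarrow> \<zeta> \<in> closure M - ball lam r \<Longrightarrow>
        c * norm g \<le> norm (Us n g - cmult \<zeta> g)"
      by (rule lower_bound_away[OF r(1)]) blast
    \<comment> \<open>The resolvent values of \<open>U\<close> at \<open>g\<close> along the circle
      form a compact set, on which \<open>U_n\<close> converges uniformly.\<close>
    let ?H = "(\<lambda>\<zeta>. resolvent U \<zeta> g) ` sphere lam r"
    have "continuous_on (sphere lam r) (\<lambda>\<zeta>. resolvent U \<zeta> g)"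
      by (intro bounded_linear.continuous_on[OF blinfun.bounded_linear_left]
          continuous_on_subset[OF continuous_on_resolvent[OF clinear_U]]) (use sph in blast)
    then have "compact ?H" by (rule compact_continuous_image) simp
    \<comment> \<open>Division by \<open>c\<close> in the lower bound and the factor
      \<open>r\<close> of the contour estimate turn this tolerance into
      \<open>e / 2\<close>.\<close>
    moreover have "e * c / (2 * r) > 0" using e c r(1) by simp
    ultimately have "\<forall>\<^sub>F n in sequentially. \<forall>h\<in>?H. norm (Us n h - U h) < e * c / (2 * r)"
      by (rule laplace_op_tendsto_uniform[OF subprob_empirical subprob_P conv])
    then obtain N2 where N2: "\<And>n \<zeta>. n \<ge> N2 \<Longrightarrow> \<zeta> \<in> sphere lam r \<Longrightarrow>
        norm (Us n (resolvent U \<zeta> g) - U (resolvent U \<zeta> g)) < e * c / (2 * r)"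
      unfolding eventually_sequentially by blast
    have "dist (Qn n g) (Q g) < e" if n: "n \<ge> max N0 (max N1 N2)" for n
    proof -
      have "norm (resolvent (Us n) \<zeta> g - resolvent U \<zeta> g) \<le> e / (2 * r)" if z: "\<zeta> \<in> sphere lam r" for \<zeta>
      proof -
        let ?h = "resolvent U \<zeta> g" and ?R = "resolvent (Us n) \<zeta>"
        have R: "is_resolvent (Us n) \<zeta> ?R"
          using sph_n[of n] z n by (intro is_resolvent_resolvent) auto
        have R0: "is_resolvent U \<zeta> (resolvent U \<zeta>)"
          using sph z by (intro is_resolvent_resolvent) auto
        have "c * norm (?R g - ?h) \<le> norm (Us n (?R g - ?h) - cmult \<zeta> (?R g - ?h))"
          by (rule lower) (use n z r(2) closure_subset in \<open>auto simp: subset_iff\<close>)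
        \<comment> \<open>Both resolvent equations have right side \<open>g\<close>, which cancels;
          what remains is the difference of the operators at the fixed function
          \<open>?h\<close>.\<close>
        also have "Us n (?R g - ?h) - cmult \<zeta> (?R g - ?h) = U ?h - Us n ?h"
          using is_resolvent_right[OF R, of g] is_resolvent_right[OF R0, of g]
          by (simp add: blinfun.diff_right algebra_simps)
        also have "norm \<dots> \<le> e * c / (2 * r)"
          using N2[of n \<zeta>] n z by (simp add: norm_minus_commute)
        finally have "c * norm (?R g - ?h) \<le> c * (e / (2 * r))" by (simp add: mult.commute)
        then show ?thesis unfolding mult_le_cancel_left_pos[OF c] .
      qed
      then have "norm (Qn n g - Q g) \<le> r * (e / (2 * r))"
        by (intro circle_projection_diff_bound[OF r(1) Qn Q]) (use n in auto)
      then show ?thesis using r(1) e by (simp add: dist_norm)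
    qed
    then show "\<exists>n0. \<forall>n\<ge>n0. dist (Qn n g) (Q g) < e" by blast
  qed
  have limits: "(\<lambda>n. Pr_n n g) \<longlonglongrightarrow> Pr g"
    if Pr_n: "\<forall>n>N0. is_spectral_projection (Us n) (op_spectrum (Us n) \<inter> M) (Pr_n n)"
      and Pr: "is_spectral_projection U {lam} Pr" for Pr_n Pr g
  proof -
    have "Pr = Q"
      by (rule spectral_projection_unique[OF clinear_U _ iso Pr QU]) simp
    moreover have "Pr_n n = Qn n" if "n > N0" for n
      using that Pr_n
      by (intro spectral_projection_unique[OF clinear_Un N0(2) isolated_part_open _ QUs]) auto
    then have "\<forall>\<^sub>F n in sequentially. Qn n g = Pr_n n g"
      by (intro eventually_mono[OF eventually_gt_at_top[of N0]]) simp
    from Lim_transform_eventually[OF lim this] have "(\<lambda>n. Pr_n n g) \<longlonglongrightarrow> Q g" .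
    ultimately show ?thesis by simp
  qed
  have QU_ex: "\<exists>Pr. is_spectral_projection U {lam} Pr"
    using QU by (rule exI)
  have "\<exists>Q. is_spectral_projection (Us n) (op_spectrum (Us n) \<inter> M) Q" if "n > N0" for n
    using QUs[OF less_imp_le[OF that]] by (rule exI)
  then have "\<forall>n>N0. isolated_part (Us n) (op_spectrum (Us n) \<inter> M) \<and>
      (\<exists>Q. is_spectral_projection (Us n) (op_spectrum (Us n) \<inter> M) Q)"
    using isolated_part_open by simp
  moreover have "\<forall>Pr_n Pr.
      (\<forall>n>N0. is_spectral_projection (Us n) (op_spectrum (Us n) \<inter> M) (Pr_n n)) \<longrightarrow>
      is_spectral_projection U {lam} Pr \<longrightarrow> (\<forall>g. (\<lambda>n. Pr_n n g) \<longlonglongrightarrow> Pr g)"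
    using limits by simp
  ultimately show ?thesis using QU_ex by (intro conjI exI[of _ N0])
qed

end

section \<open>Convergence of eigenvectors\<close>

locale laplace_sample_limit = laplace_limit k P xs lam M
  for k :: "'a::metric_space \<Rightarrow> 'a \<Rightarrow> real" and P xs lam M +
  assumes support: "measure_support P = UNIV"
    and k_pos: "\<And>x y. 0 < k x y"
begin

text \<open>
  Since \<open>k\<close> is positive, a bump function that vanishes at all
  sample points would have vanishing integral in the limit.
\<close>

lemma sample_meets_open:
  fixes b :: "'a \<Rightarrow> real"
  assumes b_cont: "continuous_on UNIV b" and b_nonneg: "\<And>x. 0 \<le> b x" and b_pos: "0 < b x0"
  shows "\<exists>i. 0 < b (xs i)"
proof (rule ccontr)
  assume "\<not> (\<exists>i. 0 < b (xs i))"
  then have zero: "b (xs i) = 0" for i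
    using b_nonneg[of "xs i"] by (simp add: not_less order_antisym)
  interpret finite_measure P using subprob_P by (simp add: subprob_def)
  have sets_P: "sets P = sets borel" using subprob_P by (simp add: subprob_def)
  define g where "g = Bcontfun (\<lambda>x. complex_of_real (b x))"
  have g: "g x = complex_of_real (b x)" for x
    unfolding g_def by (subst Bcontfun_inverse)
      (auto intro!: continuous_in_bcontfun compact continuous_intros b_cont)
  have "ker_op k (empirical_measure n xs) g x0 = 0" for n
    unfolding ker_op_empirical by (simp add: g zero)
  moreover have "(\<lambda>n. ker_op k (empirical_measure n xs) g x0) \<longlonglongrightarrow> ker_op k P g x0"
    by (rule tendsto_bcontfun_uniform_limit[OF conv, THEN tendsto_uniform_limitI]) simp
  ultimately have "ker_op k P g x0 = 0"
    by (simp add: LIMSEQ_const_iff)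
  then have "complex_of_real (\<integral>y. k x0 y * b y \<partial>P) = 0"
    by (simp add: ker_op_apply[OF subprob_P] g flip: of_real_mult integral_complex_of_real)
  then have int0: "(\<integral>y. k x0 y * b y \<partial>P) = 0" by simp
  have "integrable P (\<lambda>y. complex_of_real (k x0 y * b y))"
    using integrable_ker[OF subprob_P, of x0 g] by (simp add: g)
  then have int: "integrable P (\<lambda>y. k x0 y * b y)"
    by (simp only: complex_of_real_integrable_eq)
  \<comment> \<open>A nonnegative integrand with integral 0 vanishes almost everywhere. As
    \<open>k\<close> is positive, the nonempty open set where \<open>b > 0\<close> is null, against
    the full support of \<open>P\<close>.\<close>
  have "AE y in P. k x0 y * b y = 0"
    using integral_nonneg_eq_0_iff_AE[OF int] int0 k_pos b_nonneg by (simp add: less_imp_le)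
  then have ae: "AE y in P. \<not> 0 < b y"
  proof eventually_elim
    case (elim y)
    then show ?case using k_pos[of x0 y] by auto
  qed
  have "open {y. 0 < b y}"
    by (rule open_Collect_less[OF continuous_on_const b_cont])
  then have "{y. 0 < b y} \<in> sets P" unfolding sets_P by (rule borel_open)
  then have "emeasure P {y. 0 < b y} = 0"
    using AE_iff_measurable[of "{y. 0 < b y}" P "\<lambda>y. \<not> 0 < b y"] ae sets_eq_imp_space_eq[OF sets_P]
    by simp
  moreover have "x0 \<in> measure_support P" using support by simp
  ultimately show False
    using \<open>open {y. 0 < b y}\<close> b_pos unfolding measure_support_def by force
qed

text \<open>The bump is the positive part of the excess of \<open>norm (h x)\<close> over
  \<open>norm h - e\<close>. An index found once serves all larger \<open>n\<close>.\<close>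

lemma sample_sup_norm:
  fixes h :: "'a \<Rightarrow>\<^sub>C complex"
  assumes "e > 0"
  shows "\<forall>\<^sub>F n in sequentially. \<exists>i<n. norm h - e < norm (h (xs i))"
proof -
  obtain x0 where x0: "norm h - e < norm (h x0)"
    using norm_bound[of h "norm h - e"] assms by (meson not_le diff_less_eq less_add_same_cancel1)
  have "continuous_on UNIV (\<lambda>x. max 0 (norm (h x) - (norm h - e)))"
    by (intro continuous_intros) auto
  from sample_meets_open[OF this, of x0] x0
  obtain i where "0 < max 0 (norm (h (xs i)) - (norm h - e))" by auto
  then have "norm h - e < norm (h (xs i))" by simp
  then show ?thesis
    unfolding eventually_sequentially by (intro exI[of _ "Suc i"]) (auto simp: Suc_le_eq)
qed

text \<open>A real eigenvector of a real matrix has a real eigenvalue, so the explicit formula for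
  the eigenfunction takes real values.\<close>

lemma eigenfunction_of_eigenvector:
  assumes rg: "\<zeta> \<notin> complex_of_real ` range (degree_fun k (empirical_measure n xs))"
    and v: "eigenvector (Ls n) (vec n (\<lambda>i. complex_of_real (v i))) \<zeta>"
  shows "\<exists>!h. eigenfunction_of_vector k n xs \<zeta> v h"
proof -
  let ?\<mu> = "empirical_measure n xs" and ?w = "\<lambda>i. complex_of_real (v i)"
  have deg_real: "deg k ?\<mu> x \<in> \<real>" for x by (simp add: deg_apply[OF subprob_empirical])
  have eq: "deg k ?\<mu> (xs i) * ?w i - (\<Sum>j<n. complex_of_real (k (xs i) (xs j)) * ?w j) / n
      = \<zeta> * ?w i + (0 :: 'a \<Rightarrow>\<^sub>C complex) (xs i)" if "i < n" for i
    using eigenvector_empirical(2)[OF v that] by simp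
  obtain i where i: "i < n" "?w i \<noteq> 0"
    using eigenvector_empirical(1)[OF v] by blast
  \<comment> \<open>A nonzero coordinate of the eigenvector expresses \<open>\<zeta>\<close> through
    real numbers.\<close>
  have "\<zeta> = (deg k ?\<mu> (xs i) * ?w i - (\<Sum>j<n. complex_of_real (k (xs i) (xs j)) * ?w j) / n) / ?w i"
    using eq[OF i(1)] i(2) by (simp add: field_simps)
  also have "\<dots> \<in> \<real>"
    by (intro Reals_divide Reals_diff Reals_mult sum_in_Reals deg_real) auto
  finally have z_real: "\<zeta> \<in> \<real>" .
  note sol = laplace_empirical_solution[OF rg eq]
  obtain g :: "'a \<Rightarrow>\<^sub>C complex" where g: "\<And>i. i < n \<Longrightarrow> g (xs i) = ?w i" "Us n g - cmult \<zeta> g = 0"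
    by (rule sol) (assumption, rule that)
  have eig: "Us n g = cmult \<zeta> g" using g(2) by simp
  have g_real: "g x \<in> \<real>" for x
  proof -
    have "g x = (\<Sum>j<n. complex_of_real (k x (xs j)) * g (xs j)) / n / (deg k ?\<mu> x - \<zeta>)"
      by (rule eigenfunction_empirical_formula[OF rg eig])
    also have "\<dots> \<in> \<real>"
      by (intro Reals_divide Reals_diff Reals_mult sum_in_Reals deg_real z_real) (auto simp: g(1))
    finally show ?thesis .
  qed
  define h where "h = Bcontfun (\<lambda>x. Re (g x))"
  have h: "h x = Re (g x)" for x
    unfolding h_def by (subst Bcontfun_inverse)
      (auto intro!: continuous_in_bcontfun compact continuous_intros)
  have hg: "complexify h = g"
    by (rule bcontfun_eqI) (simp add: complexify_apply h g_real)
  show ?thesis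
  proof (rule ex1I)
    have "g \<noteq> 0" using i g(1)[OF i(1)] by auto
    then show "eigenfunction_of_vector k n xs \<zeta> v h"
      using eig g(1) by (simp add: eigenfunction_of_vector_def op_eigenfunction_def hg h)
  next
    fix h' assume "eigenfunction_of_vector k n xs \<zeta> v h'"
    then have h': "Us n (complexify h') = cmult \<zeta> (complexify h')" "\<And>i. i < n \<Longrightarrow> h' (xs i) = v i"
      by (auto simp: eigenfunction_of_vector_def op_eigenfunction_def)
    have "complexify h' x = g x" for x
      using eigenfunction_empirical_formula[OF rg h'(1), of x] eigenfunction_empirical_formula[OF rg eig, of x]
      by (simp add: complexify_apply h'(2) g(1) cong: sum.cong_simp)
    then have "complexify h' = g" by (rule bcontfun_eqI)
    then show "h' = h" using hg complexify_inject by metis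
  qed
qed

text \<open>The normalization controls sample values only; the eigenvalue equation carries the bound
  to all points, with a constant free of \<open>n\<close>.\<close>

lemma eigenfunctions_bounded:
  fixes g :: "'a \<Rightarrow>\<^sub>C complex"
  assumes \<delta>: "\<delta> > 0" "\<And>x. \<delta> \<le> dist (deg k (empirical_measure n xs) x) \<zeta>"
    and eig: "Us n g = cmult \<zeta> g" and bound: "\<And>i. i < n \<Longrightarrow> norm (g (xs i)) \<le> 1"
  shows "norm g \<le> kmax / \<delta>"
proof (rule norm_bound)
  fix x
  let ?d = "deg k (empirical_measure n xs) x"
  have "laplace_op k (empirical_measure n xs) g x = cmult \<zeta> g x" using eig by simp
  then have "(?d - \<zeta>) * g x = (\<Sum>j<n. complex_of_real (k x (xs j)) * g (xs j)) / n"
    by (simp add: laplace_apply[OF subprob_empirical] cmult_apply ker_op_empirical[of _ _ g] algebra_simps)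
  then have "norm (?d - \<zeta>) * norm (g x) = norm (\<Sum>j<n. complex_of_real (k x (xs j)) * g (xs j)) / n"
    by (metis norm_mult norm_divide norm_of_nat)
  also have "\<dots> \<le> kmax"
  proof (cases "n = 0")
    case False
    have "norm (\<Sum>j<n. complex_of_real (k x (xs j)) * g (xs j)) \<le> (\<Sum>j<n. kmax)"
    proof (rule sum_norm_le)
      fix j assume "j \<in> {..<n}"
      then have "\<bar>k x (xs j)\<bar> * norm (g (xs j)) \<le> kmax * 1"
        using bound kmax(1) kmax(2)[of x "xs j"] by (intro mult_mono) auto
      then show "norm (complex_of_real (k x (xs j)) * g (xs j)) \<le> kmax"
        by (simp add: norm_mult)
    qed
    then show ?thesis using False by (simp add: divide_le_eq mult.commute)
  qed (use kmax in \<open>simp add: less_imp_le\<close>)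
  finally have "norm (?d - \<zeta>) * norm (g x) \<le> kmax" .
  moreover have "\<delta> * norm (g x) \<le> norm (?d - \<zeta>) * norm (g x)"
    using \<delta>(2)[of x] by (intro mult_right_mono) (auto simp: dist_norm)
  ultimately show "norm (g x) \<le> kmax / \<delta>"
    using \<delta>(1) by (simp add: le_divide_eq mult.commute)
qed

text \<open>The normalization survives in the limit because the sample points become dense.\<close>

lemma norm_limit_normalized:
  fixes g :: "nat \<Rightarrow> 'a \<Rightarrow>\<^sub>C complex"
  assumes r: "filterlim r at_top sequentially" and g: "g \<longlonglongrightarrow> g0"
    and le: "\<And>j i. i < r j \<Longrightarrow> norm (g j (xs i)) \<le> 1"
    and ex: "\<And>j. \<exists>i<r j. norm (g j (xs i)) = 1"
  shows "norm g0 = 1"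
proof (rule antisym)
  have lim: "(\<lambda>j. norm (g j)) \<longlonglongrightarrow> norm g0" by (rule tendsto_norm[OF g])
  have "1 \<le> norm (g j)" for j
    using ex[of j] norm_bounded[of "g j"] by metis
  then show "1 \<le> norm g0"
    by (intro LIMSEQ_le_const[OF lim]) auto
  show "norm g0 \<le> 1"
  proof (rule field_le_epsilon)
    fix e :: real assume e: "e > 0"
    have "\<forall>\<^sub>F j in sequentially. \<exists>i<r j. norm g0 - e / 2 < norm (g0 (xs i))"
      by (rule filterlim_iff[THEN iffD1, rule_format, OF r sample_sup_norm]) (use e in simp)
    moreover have "\<forall>\<^sub>F j in sequentially. dist (g j) g0 < e / 2"
      using g by (rule tendstoD) (use e in simp)
    ultimately have "\<forall>\<^sub>F j in sequentially. norm g0 \<le> 1 + e"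
    proof eventually_elim
      case (elim j)
      then obtain i where i: "i < r j" "norm g0 - e / 2 < norm (g0 (xs i))" by blast
      have "norm (g0 (xs i)) \<le> norm (g j (xs i)) + dist (g j (xs i)) (g0 (xs i))"
        using norm_triangle_ineq2[of "g0 (xs i)" "g j (xs i)"] by (simp add: dist_norm norm_minus_commute)
      then show ?case
        using i le[OF i(1)] dist_bounded[of "g j" "xs i" g0] elim(2) by linarith
    qed
    then show "norm g0 \<le> 1 + e" by (simp add: eventually_const_iff)
  qed
qed


text \<open>Over a nonempty finite index set the supremum is attained; over the empty one it would
  carry no information.\<close>

lemma max_sample_value:
  fixes v :: "nat \<Rightarrow> real"
  assumes n: "n > 0" and sup: "(SUP i\<in>{..<n}. \<bar>v i\<bar>) = 1"
  shows "\<And>i. i < n \<Longrightarrow> \<bar>v i\<bar> \<le> 1" and "\<exists>i<n. \<bar>v i\<bar> = 1"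
proof -
  have ne: "{..<n} \<noteq> {}" using n by auto
  have max: "Max ((\<lambda>i. \<bar>v i\<bar>) ` {..<n}) = 1"
    using sup ne by (simp add: cSup_eq_Max)
  show "\<bar>v i\<bar> \<le> 1" if "i < n" for i
    unfolding max[symmetric] using that by (intro Max_ge) auto
  have "1 \<in> (\<lambda>i. \<bar>v i\<bar>) ` {..<n}"
    unfolding max[symmetric] using ne by (intro Max_in) auto
  then show "\<exists>i<n. \<bar>v i\<bar> = 1" by force
qed

text \<open>The quantity \<open>m n\<close>, the distance to the nearer of \<open>f\<close> and
  \<open>- f\<close>, ignores signs, so a subsequence argument applies to it; the sign is read off
  afterwards.\<close>

lemma eigenvectors_converge:
  fixes lams :: "nat \<Rightarrow> complex" and v :: "nat \<Rightarrow> nat \<Rightarrow> real" and f :: "'a \<Rightarrow>\<^sub>C real"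
  assumes simple: "simple_eigenvalue U lam"
    and ev: "\<forall>\<^sub>F n in sequentially.
            lams n \<in> spectrum (Ls n) \<inter> M \<and>
            eigenvector (Ls n) (vec n (\<lambda>i. complex_of_real (v n i))) (lams n) \<and>
            (SUP i\<in>{..<n}. \<bar>v n i\<bar>) = 1"
    and f: "op_eigenfunction U lam (complexify f)" "norm f = 1"
  shows "(\<forall>\<^sub>F n in sequentially. \<exists>!h. eigenfunction_of_vector k n xs (lams n) (v n) h) \<and>
         (\<exists>a :: nat \<Rightarrow> real. (\<forall>n. a n \<in> {1, - 1}) \<and>
            (\<lambda>n. SUP i\<in>{..<n}. \<bar>a n * v n i - f (xs i)\<bar>) \<longlonglongrightarrow> 0 \<and>
            (\<forall>f_n :: nat \<Rightarrow> 'a \<Rightarrow>\<^sub>C real.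
               (\<forall>\<^sub>F n in sequentially.
                  eigenfunction_of_vector k n xs (lams n) (v n) (f_n n)) \<longrightarrow>
               (\<forall>b. measure P {x. f x = b} = 0 \<longrightarrow>
                  (\<lambda>n. measure P (sym_diff {x. f x > b} {x. a n * f_n n x > b})) \<longlonglongrightarrow> 0)))"
proof -
  have lams: "lams \<longlonglongrightarrow> lam"
    using ev by (intro eigenvalues_tendsto) (auto elim: eventually_mono)
  have npos: "n > 0" if "eigenvector (Ls n) (vec n w) \<zeta>" for n w \<zeta>
    using eigenvector_empirical(1)[OF that] by auto
  have unique: "\<forall>\<^sub>F n in sequentially. \<exists>!h. eigenfunction_of_vector k n xs (lams n) (v n) h"
    using ev eventually_not_in_range
    by eventually_elim (rule eigenfunction_of_eigenvector; blast)
  \<comment> \<open>Meaningful for large \<open>n\<close> only; for the others the value is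
    arbitrary, which the limits do not see, and \<open>a n\<close> is a sign in any case.\<close>
  define F where "F n = (THE h. eigenfunction_of_vector k n xs (lams n) (v n) h)" for n
  define m where "m n = min (norm (F n - f)) (norm (F n + f))" for n
  define a :: "nat \<Rightarrow> real" where "a n = (if norm (F n - f) \<le> norm (F n + f) then 1 else - 1)" for n
  obtain \<delta> where \<delta>: "\<delta> > 0"
    and sep: "\<forall>\<^sub>F n in sequentially. \<forall>\<zeta>\<in>M. \<forall>x. \<delta> \<le> dist (deg k (empirical_measure n xs) x) \<zeta>"
    by (rule eventually_range)
  have F: "\<forall>\<^sub>F n in sequentially. n > 0 \<and> eigenfunction_of_vector k n xs (lams n) (v n) (F n) \<and>
      (\<forall>i<n. \<bar>v n i\<bar> \<le> 1) \<and> (\<exists>i<n. \<bar>v n i\<bar> = 1) \<and> norm (F n) \<le> kmax / \<delta>"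
    using ev unique sep
  proof eventually_elim
    case (elim n)
    have n: "n > 0" using elim(1) npos by blast
    have Fn: "eigenfunction_of_vector k n xs (lams n) (v n) (F n)"
      unfolding F_def by (rule theI'[OF elim(2)])
    have v: "\<And>i. i < n \<Longrightarrow> \<bar>v n i\<bar> \<le> 1" "\<exists>i<n. \<bar>v n i\<bar> = 1"
      using max_sample_value[OF n, of "v n"] elim(1) by blast+
    have "norm (complexify (F n)) \<le> kmax / \<delta>"
    proof (rule eigenfunctions_bounded[OF \<delta>])
      show "\<delta> \<le> dist (deg k (empirical_measure n xs) x) (lams n)" for x
        using elim(1,3) by blast
    qed (use Fn v(1) in \<open>auto simp: eigenfunction_of_vector_def op_eigenfunction_def complexify_apply\<close>)
    then show ?case using n Fn v by (simp add: norm_complexify)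
  qed
  have m: "m \<longlonglongrightarrow> 0"
  proof (rule ccontr)
    assume "\<not> m \<longlonglongrightarrow> 0"
    then obtain e where e: "e > 0" "\<not> (\<forall>\<^sub>F n in sequentially. dist (m n) 0 < e)"
      unfolding tendsto_iff by blast
    obtain r0 where r0: "strict_mono (r0 :: nat \<Rightarrow> nat)" "\<And>n. \<not> dist (m (r0 n)) 0 < e"
      using not_eventually_sequentiallyD[OF e(2)] by blast
    obtain N where N: "\<And>n. n \<ge> N \<Longrightarrow> n > 0 \<and> eigenfunction_of_vector k n xs (lams n) (v n) (F n) \<and>
        (\<forall>i<n. \<bar>v n i\<bar> \<le> 1) \<and> (\<exists>i<n. \<bar>v n i\<bar> = 1) \<and> norm (F n) \<le> kmax / \<delta>"
      using F unfolding eventually_sequentially by blast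
    \<comment> \<open>The shift by \<open>N\<close> makes the eventual properties hold along the
      whole subsequence.\<close>
    define r where "r j = r0 (j + N)" for j
    have r: "strict_mono r"
      using r0(1) by (simp add: r_def strict_mono_def)
    have rN: "r j \<ge> N" for j
      using strict_mono_imp_increasing[OF r0(1), of "j + N"] by (simp add: r_def)
    have big: "e \<le> m (r j)" for j
      using r0(2)[of "j + N"] by (simp add: r_def m_def dist_real_def not_less)
    define g where "g j = complexify (F (r j))" for j
    have eig: "Us (r j) (g j) = cmult (lams (r j)) (g j)"
      and gx: "\<And>i. i < r j \<Longrightarrow> g j (xs i) = complex_of_real (v (r j) i)" for j
      using N[OF rN[of j]]
      by (auto simp: g_def eigenfunction_of_vector_def op_eigenfunction_def complexify_apply)
    have bound: "norm (g j) \<le> kmax / \<delta>" for j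
      using N[OF rN[of j]] by (simp add: g_def norm_complexify)
    have rinf: "filterlim r at_top sequentially" by (rule filterlim_subseq[OF r])
    obtain s g0 where s: "strict_mono (s :: nat \<Rightarrow> nat)" and g0: "(\<lambda>j. g (s j)) \<longlonglongrightarrow> g0"
      and eig0: "U g0 = cmult lam g0"
    proof (rule approximate_eigenfunctions_converge[of "\<lambda>j. empirical_measure (r j) xs" P
          "\<lambda>j. lams (r j)" lam g "kmax / \<delta>"])
      show "(\<lambda>j. ker_op k (empirical_measure (r j) xs) g) \<longlonglongrightarrow> ker_op k P g" for g
        by (rule filterlim_compose[OF conv rinf])
      show "(\<lambda>j. lams (r j)) \<longlonglongrightarrow> lam" by (rule filterlim_compose[OF lams rinf])
      show "(\<lambda>j. Us (r j) (g j) - cmult (lams (r j)) (g j)) \<longlonglongrightarrow> 0" by (simp add: eig)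
    qed (use subprob_empirical subprob_P lam_range bound in auto)
    have "norm g0 = 1"
    proof (rule norm_limit_normalized[OF filterlim_compose[OF rinf filterlim_subseq[OF s]] g0])
      show "norm (g (s j) (xs i)) \<le> 1" if "i < r (s j)" for i j
        using that N[OF rN[of "s j"]] by (simp add: gx)
      show "\<exists>i<r (s j). norm (g (s j) (xs i)) = 1" for j
      proof -
        obtain i where "i < r (s j)" "\<bar>v (r (s j)) i\<bar> = 1"
          using N[OF rN[of "s j"]] by blast
        then show ?thesis by (intro exI[of _ i]) (simp add: gx)
      qed
    qed
    obtain c where c: "g0 = cmult c (complexify f)"
      by (rule simple_eigenvalue_proportional[OF simple f(1) eig0])
    have "norm c = 1"
      using \<open>norm g0 = 1\<close> f(2) by (simp add: c norm_cmult norm_complexify)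
    have g0x: "(\<lambda>j. g (s j) x) \<longlonglongrightarrow> g0 x" for x
      by (rule tendsto_bcontfun_uniform_limit[OF g0, THEN tendsto_uniform_limitI]) simp
    \<comment> \<open>Limits of real-valued functions are real-valued; at a point where
      \<open>f\<close> is nonzero this forces the unimodular \<open>c\<close> to be real.\<close>
    have "Im (g0 x) = 0" for x
      using tendsto_Im[OF g0x[of x]] by (simp add: g_def complexify_apply LIMSEQ_const_iff)
    moreover obtain x where "f x \<noteq> 0"
      using f(2) by (metis bcontfun_eqI norm_zero zero_bcontfun.rep_eq zero_neq_one)
    moreover have "Im (g0 x) = Im c * f x"
      by (simp add: c cmult_apply complexify_apply)
    ultimately have "Im c = 0" by simp
    with \<open>norm c = 1\<close> have "c = 1 \<or> c = - 1"
      by (auto simp: complex_eq_iff cmod_def)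
    then have "g0 = complexify f \<or> g0 = - complexify f"
      using c by (auto intro!: bcontfun_eqI simp: cmult_apply)
    moreover have "\<forall>\<^sub>F j in sequentially. dist (g (s j)) g0 < e"
      using g0 e(1) by (rule tendstoD)
    then obtain j where "dist (g (s j)) g0 < e"
      by (auto simp: eventually_sequentially)
    moreover have "complexify (F (r (s j))) - complexify f = complexify (F (r (s j)) - f)"
      "complexify (F (r (s j))) + complexify f = complexify (F (r (s j)) + f)"
      by (auto intro!: bcontfun_eqI simp: complexify_apply)
    ultimately have "m (r (s j)) < e"
      by (auto simp: m_def dist_norm g_def norm_complexify min_less_iff_disj)
    with big[of "s j"] show False by simp
  qed
  have am: "\<bar>a n * F n x - f x\<bar> \<le> m n" for n x
    using norm_bounded[of "F n - f" x] norm_bounded[of "F n + f" x]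
    by (auto simp: a_def m_def min_def abs_minus_commute)
  have "(\<lambda>n. SUP i\<in>{..<n}. \<bar>a n * v n i - f (xs i)\<bar>) \<longlonglongrightarrow> 0"
  proof (rule Lim_null_comparison[OF _ m])
    show "\<forall>\<^sub>F n in sequentially. norm (SUP i\<in>{..<n}. \<bar>a n * v n i - f (xs i)\<bar>) \<le> m n"
      using F
    proof eventually_elim
      case (elim n)
      then have n: "n > 0" and v: "\<And>i. i < n \<Longrightarrow> F n (xs i) = v n i"
        by (auto simp: eigenfunction_of_vector_def)
      have "(SUP i\<in>{..<n}. \<bar>a n * v n i - f (xs i)\<bar>) \<le> m n"
        using n am[of n] v by (intro cSUP_least) (auto simp flip: v)
      moreover have "0 \<le> (SUP i\<in>{..<n}. \<bar>a n * v n i - f (xs i)\<bar>)"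
        using n by (intro cSUP_upper2[of _ _ 0]) auto
      ultimately show ?case by simp
    qed
  qed
  moreover have "(\<lambda>n. measure P (sym_diff {x. f x > b} {x. a n * f_n n x > b})) \<longlonglongrightarrow> 0"
    if f_n: "\<forall>\<^sub>F n in sequentially. eigenfunction_of_vector k n xs (lams n) (v n) (f_n n)"
      and null: "measure P {x. f x = b} = 0" for f_n :: "nat \<Rightarrow> 'a \<Rightarrow>\<^sub>C real" and b
  proof (rule Lim_null_comparison)
    interpret finite_measure P using subprob_P by (simp add: subprob_def)
    have sets_P: "sets P = sets borel" using subprob_P by (simp add: subprob_def)
    have space_P: "space P = UNIV" using sets_eq_imp_space_eq[OF sets_P] by simp
    have meas: "apply_bcontfun f \<in> borel_measurable P"
      using borel_measurable_continuous_onI[OF continuous_on_apply_bcontfun]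
        measurable_cong_sets[OF sets_P refl] by blast
    have band: "{x. \<bar>f x - b\<bar> \<le> m n} \<in> sets P" for n
      using measurable_sets[OF borel_measurable_abs[OF borel_measurable_diff[OF meas borel_measurable_const[of b]]], of "{..m n}"]
      by (simp add: space_P vimage_def)
    show "(\<lambda>n. measure P {x. \<bar>f x - b\<bar> \<le> m n}) \<longlonglongrightarrow> 0"
      using measure_level_band_tendsto_0[OF finite_measure_axioms meas _ m, of b] null
      by (simp add: space_P)
    show "\<forall>\<^sub>F n in sequentially. norm (measure P (sym_diff {x. f x > b} {x. a n * f_n n x > b}))
        \<le> measure P {x. \<bar>f x - b\<bar> \<le> m n}"
      using f_n F unique
    proof eventually_elim
      case (elim n)
      \<comment> \<open>By uniqueness the signs chosen for \<open>F\<close> serve every admissible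
        \<open>f_n\<close>.\<close>
      then have "f_n n = F n" by blast
      have "sym_diff {x. f x > b} {x. a n * f_n n x > b} \<subseteq> {x. \<bar>f x - b\<bar> \<le> m n}"
      proof
        fix x assume "x \<in> sym_diff {x. f x > b} {x. a n * f_n n x > b}"
        then have "f x > b \<and> a n * F n x \<le> b \<or> f x \<le> b \<and> a n * F n x > b"
          by (auto simp: \<open>f_n n = F n\<close>)
        then show "x \<in> {x. \<bar>f x - b\<bar> \<le> m n}" using am[of n x] by auto
      qed
      then show ?case
        using finite_measure_mono[OF _ band] by simp
    qed
  qed
  ultimately show ?thesis
    using unique by (intro conjI exI[of _ a]) (auto simp: a_def)
qed

end

section \<open>Spectral convergence\<close>

text \<open>Conditions on sequences are imposed for large \<open>n\<close>, since for
  \<open>n = 0\<close> the matrix has empty spectrum. Norm 1 fixes the scale of \<open>v n\<close>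
  and \<open>f\<close> up to sign. A level set of positive mass could be cut by arbitrarily small
  perturbations of \<open>f\<close>, hence the condition on \<open>b\<close>.\<close>

theorem theorem21:
  fixes P :: "'a::metric_space measure"
    and \<Omega> :: "'w measure"
    and X :: "nat \<Rightarrow> 'w \<Rightarrow> 'a"
    and k :: "'a \<Rightarrow> 'a \<Rightarrow> real"
    and l :: real
    and lam :: complex
    and M :: "complex set"
  assumes compact: "compact (UNIV :: 'a set)"
    and P_prob: "prob_space P"
    and P_borel: "sets P = sets borel"
    and P_support: "measure_support P = UNIV"
    and \<Omega>_prob: "prob_space \<Omega>"
    and X_indep: "prob_space.indep_vars \<Omega> (\<lambda>_. borel) X UNIV"
    and X_distr: "\<And>i. distr \<Omega> borel (X i) = P"
    and k_sym: "\<And>x y. k x y = k y x"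
    and k_cont: "continuous_on UNIV (\<lambda>(x, y). k x y)"
    and l_pos: "l > 0"
    and k_lower: "\<And>x y. k x y > l"
    and lam_eigenvalue: "op_eigenvalue (laplace_op k P) lam"
    and lam_range: "lam \<notin> complex_of_real ` range (degree_fun k P)"
    and M_open: "open M"
    and M_spectrum: "op_spectrum (laplace_op k P) \<inter> M = {lam}"
    and M_closure: "(op_spectrum (laplace_op k P) \<union> complex_of_real ` range (degree_fun k P))
                      \<inter> closure M = {lam}"
  shows
    "(AE \<omega> in \<Omega>. \<forall>lams :: nat \<Rightarrow> complex.
        (\<forall>\<^sub>F n in sequentially.
           lams n \<in> spectrum (scaled_laplace_mat k n (\<lambda>i. X i \<omega>)) \<inter> M) \<longrightarrow>
        lams \<longlonglongrightarrow> lam)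
     \<and>
     (AE \<omega> in \<Omega>.
        let U = laplace_op k P;
            U_n = (\<lambda>n. laplace_op k (empirical_measure n (\<lambda>i. X i \<omega>)))
        in (\<exists>Pr. is_spectral_projection U {lam} Pr) \<and>
           (\<exists>N. (\<forall>n>N. isolated_part (U_n n) (op_spectrum (U_n n) \<inter> M) \<and>
                        (\<exists>Q. is_spectral_projection (U_n n) (op_spectrum (U_n n) \<inter> M) Q)) \<and>
                (\<forall>Pr_n Pr.
                   (\<forall>n>N. is_spectral_projection (U_n n) (op_spectrum (U_n n) \<inter> M) (Pr_n n)) \<longrightarrow>
                   is_spectral_projection U {lam} Pr \<longrightarrow>
                   (\<forall>g. (\<lambda>n. Pr_n n g) \<longlonglongrightarrow> Pr g))))
     \<and>
     (simple_eigenvalue (laplace_op k P) lam \<longrightarrow>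
      (AE \<omega> in \<Omega>. \<forall>(lams :: nat \<Rightarrow> complex) (v :: nat \<Rightarrow> nat \<Rightarrow> real) (f :: 'a \<Rightarrow>\<^sub>C real).
         (\<forall>\<^sub>F n in sequentially.
            lams n \<in> spectrum (scaled_laplace_mat k n (\<lambda>i. X i \<omega>)) \<inter> M \<and>
            eigenvector (scaled_laplace_mat k n (\<lambda>i. X i \<omega>))
              (vec n (\<lambda>i. complex_of_real (v n i))) (lams n) \<and>
            (SUP i\<in>{..<n}. \<bar>v n i\<bar>) = 1) \<longrightarrow>
         op_eigenfunction (laplace_op k P) lam (complexify f) \<longrightarrow> norm f = 1 \<longrightarrow>
         (\<forall>\<^sub>F n in sequentially.
            \<exists>!h. eigenfunction_of_vector k n (\<lambda>i. X i \<omega>) (lams n) (v n) h) \<and>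
         (\<exists>a :: nat \<Rightarrow> real. (\<forall>n. a n \<in> {1, - 1}) \<and>
            (\<lambda>n. SUP i\<in>{..<n}. \<bar>a n * v n i - f (X i \<omega>)\<bar>) \<longlonglongrightarrow> 0 \<and>
            (\<forall>f_n :: nat \<Rightarrow> 'a \<Rightarrow>\<^sub>C real.
               (\<forall>\<^sub>F n in sequentially.
                  eigenfunction_of_vector k n (\<lambda>i. X i \<omega>) (lams n) (v n) (f_n n)) \<longrightarrow>
               (\<forall>b. measure P {x. f x = b} = 0 \<longrightarrow>
                  (\<lambda>n. measure P (sym_diff {x. f x > b} {x. a n * f_n n x > b})) \<longlonglongrightarrow> 0)))))"
proof -
  let ?U = "laplace_op k P"
  have ks: "kernel_space k" by (rule kernel_space.intro[OF compact k_cont])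
  have P: "subprob P"
    using P_prob P_borel prob_space.prob_space[OF P_prob] prob_space.finite_measure[OF P_prob]
    by (simp add: subprob_def)
  have limit: "laplace_sample_limit k P (\<lambda>i. X i \<omega>) lam M"
    if "\<forall>g. (\<lambda>n. ker_op k (empirical_measure n (\<lambda>i. X i \<omega>)) g) \<longlonglongrightarrow> ker_op k P g" for \<omega>
    unfolding laplace_sample_limit_def laplace_sample_limit_axioms_def
      laplace_limit_def laplace_limit_axioms_def
    using ks P that lam_range M_open M_spectrum M_closure P_support l_pos k_lower
    by (auto intro: less_trans)
  \<comment> \<open>One null set serves all three claims and all sequences in them.\<close>
  have ae: "AE \<omega> in \<Omega>. laplace_sample_limit k P (\<lambda>i. X i \<omega>) lam M"
    using kernel_space.ker_op_empirical_tendsto_AE[OF ks \<Omega>_prob X_indep X_distr P]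
    by eventually_elim (rule limit)
  have limit': "laplace_limit k P (\<lambda>i. X i \<omega>) lam M"
    if "laplace_sample_limit k P (\<lambda>i. X i \<omega>) lam M" for \<omega>
    using that by (simp add: laplace_sample_limit_def)
  show ?thesis
    unfolding Let_def
  proof (intro conjI impI, goal_cases)
    case 1
    show ?case
      using ae by eventually_elim (blast intro: laplace_limit.eigenvalues_tendsto[OF limit'])
  next
    case 2
    show ?case
      using ae by eventually_elim (rule laplace_limit.spectral_projections_converge[OF limit'])
  next
    case 3
    note converge = laplace_sample_limit.eigenvectors_converge[OF _ 3]
    show ?case
      using ae by eventually_elim (intro allI impI, rule converge)
  qed
qed

end
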